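(* If a sequence of integral current spaces $M_j=(X_j,d_j,T_j)\in\mathcal M^m$ converges in the intrinsic flat sense to an integral current space $M_0=(X_0,d_0,T_0)\in\mathcal M^m$, then there is a separable complete metric space $Z$ and isometric embeddings $\varphi_j:X_j\to Z$ ($j=0,1,2,\dots$) such that $\varphi_{j\#}T_j$ flat converges to $\varphi_{0\#}T_0$ in $Z$, i.e. $d_F^Z(\varphi_{j\#}T_j,\varphi_{0\#}T_0)\to0$, and thus $\varphi_{j\#}T_j$ converges weakly to $\varphi_{0\#}T_0$ as well.
   Context: Currents (Ambrosio–Kirchheim). Let $Z$ be a complete metric space, $m\ge 0$. $\mathcal D^m(Z)$ is the set of tuples $(f,\pi_1,\dots,\pi_m)$ with $f:Z\to\mathbb R$ bounded Lipschitz and $\pi_i:Z\to\mathbb R$ Lipschitz. An $m$-dimensional current $T$ on $Z$ is a real-valued multilinear functional on $\mathcal D^m(Z)$ such that: (i) $T(f,\pi_1,\dots,\pi_m)=0$ if some $\pi_i$ is constant on a neighborhood of $\{f\ne0\}$; (ii) $T$ is continuous under pointwise convergence of the $\pi_i$ with $\mathrm{Lip}(\pi_i)\le1$; (iii) there is a finite Borel measure $\mu$ with $|T(f,\pi_1,\dots,\pi_m)|\le\prod_i\mathrm{Lip}(\pi_i)\int_Z|f|\,d\mu$ for all tuples. The smallest such $\mu$ is the mass measure $\|T\|$, and $\mathbf M(T)=\|T\|(Z)$. Push-forward by a Lipschitz map: $\varphi_\#T(f,\pi_1,\dots,\pi_m)=T(f\circ\varphi,\pi_1\circ\varphi,\dots,\pi_m\circ\varphi)$.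 Boundary: $\partial T(f,\pi_1,\dots,\pi_{m-1})=T(1,f,\pi_1,\dots,\pi_{m-1})$. For $m\ge1$, $T$ is integer rectifiable if there are countably many bi-Lipschitz maps $\varphi_i:A_i\to Z$ ($A_i\subset\mathbb R^m$ precompact Borel) with pairwise disjoint images and $\theta_i\in L^1(A_i,\mathbb N)$, $\mathbb N=\{1,2,\dots\}$, with $T=\sum_i\varphi_{i\#}[\![\theta_i]\!]$ and $\mathbf M(T)=\sum_i\mathbf M(\varphi_{i\#}[\![\theta_i]\!])$, where $\varphi_{i\#}[\![\theta_i]\!](f,\pi)=\int_{A_i}\theta_i\,(f\circ\varphi_i)\det\nabla(\pi\circ\varphi_i)\,d\mathcal L^m$; for $m=0$ it is a finite integer combination of point evaluations $f\mapsto f(p)$. $T$ is an integral current, $T\in\mathbf I_m(Z)$, if it is integer rectifiable and $\partial T$ has finite mass. The canonical set is $\mathrm{set}(T)=\{p\in Z:\liminf_{r\to0}\|T\|(B_p(r))/(\omega_mr^m)>0\}$. Weak convergence $S_j\to S$ of currents in $Z$ means $S_j(f,\pi_1,\dots,\pi_m)\to S(f,\pi_1,\dots,\pi_m)$ for every $(f,\pi_1,\dots,\pi_m)\in\mathcal D^m(Z)$. Flat distance in $Z$: for $S,T\in\mathbf I_m(Z)$, $d_F^Z(S,T)=\inf\{\mathbf M(U)+\mathbf M(V): S-T=U+\partial V,\ U\in\mathbf I_m(Z),\ V\in\mathbf I_{m+1}(Z)\}$. Integral current spaces. An $m$-dimensional integral current space $(X,d,T)$ is a metric space $(X,d)$ with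 $T\in\mathbf I_m(\bar X)$ on the metric completion $\bar X$ such that $\mathrm{set}(T)=X$. $\mathcal M^m$ is the class of these, including the zero space $\mathbf 0$ (with $T=0$). An isometric embedding is a distance-preserving map; an isometric embedding $\varphi$ of $X$ into a complete $Z$ extends to $\bar X$, and $\varphi_\#T$ is the push-forward under this extension. Intrinsic flat distance. For $M_i=(X_i,d_i,T_i)\in\mathcal M^m$, $d_{\mathcal F}(M_1,M_2)=\inf d_F^Z(\varphi_{1\#}T_1,\varphi_{2\#}T_2)$, the infimum over all complete metric spaces $Z$ and isometric embeddings $\varphi_i:\bar X_i\to Z$. The zero space is considered to embed in any $Z$ with push-forward $0$. Intrinsic flat convergence $M_j\to M_0$ means $d_{\mathcal F}(M_j,M_0)\to0$. *)

theory Defs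
  imports "HOL-Analysis.Analysis" "Jordan_Normal_Form.Determinant"
begin

text \<open>
  Metric spaces are carrier based (type \<^typ>\<open>'a metric\<close>), so functions on \<open>Z\<close> are total functions
  on the ambient type whose values outside \<^term>\<open>mspace Z\<close> are irrelevant. In particular a current
  is only meaningful on \<open>test_forms m Z\<close>, and equalities between currents are stated there.
  No congruence axiom is needed: multilinearity and the mass bound force a current to depend only
  on the restrictions of its arguments to \<^term>\<open>mspace Z\<close>. The empty metric space is allowed.
\<close>

type_synonym 'a functional = "('a \<Rightarrow> real) \<Rightarrow> ('a \<Rightarrow> real) list \<Rightarrow> real"

subsection \<open>Metric preliminaries\<close>

abbreviation lipschitz_fun :: "'a metric \<Rightarrow> ('a \<Rightarrow> real) \<Rightarrow> bool" where
  "lipschitz_fun Z f \<equiv> Lipschitz_continuous_map Z euclidean_metric f"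

definition lip :: "'a metric \<Rightarrow> ('a \<Rightarrow> real) \<Rightarrow> real" where
  "lip Z f = Inf {L. L \<ge> 0 \<and> (\<forall>x\<in>mspace Z. \<forall>y\<in>mspace Z. \<bar>f x - f y\<bar> \<le> L * mdist Z x y)}"

definition borel_of_metric :: "'a metric \<Rightarrow> 'a measure" where
  "borel_of_metric Z = sigma (mspace Z) {U. openin (mtopology_of Z) U}"

definition isometric_embedding :: "'a metric \<Rightarrow> 'b metric \<Rightarrow> ('a \<Rightarrow> 'b) \<Rightarrow> bool" where
  "isometric_embedding X Z \<phi> \<longleftrightarrow> \<phi> \<in> mspace X \<rightarrow> mspace Z \<and>
     (\<forall>x\<in>mspace X. \<forall>y\<in>mspace X. mdist Z (\<phi> x) (\<phi> y) = mdist X x y)"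

subsection \<open>Currents\<close>

definition test_forms :: "nat \<Rightarrow> 'a metric \<Rightarrow> (('a \<Rightarrow> real) \<times> ('a \<Rightarrow> real) list) set" where
  "test_forms m Z = {(f, \<pi>). lipschitz_fun Z f \<and> bounded (f ` mspace Z) \<and>
     length \<pi> = m \<and> (\<forall>p\<in>set \<pi>. lipschitz_fun Z p)}"

definition multilinear :: "nat \<Rightarrow> 'a metric \<Rightarrow> 'a functional \<Rightarrow> bool" where
  "multilinear m Z T \<longleftrightarrow>
     (\<forall>f g \<pi> a b. (f, \<pi>) \<in> test_forms m Z \<longrightarrow> (g, \<pi>) \<in> test_forms m Z \<longrightarrow>
        T (\<lambda>x. a * f x + b * g x) \<pi> = a * T f \<pi> + b * T g \<pi>) \<and>
     (\<forall>f \<pi> i p q a b. (f, \<pi>) \<in> test_forms m Z \<longrightarrow> i < m \<longrightarrow>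
        lipschitz_fun Z p \<longrightarrow> lipschitz_fun Z q \<longrightarrow>
        T f (\<pi>[i := (\<lambda>x. a * p x + b * q x)]) = a * T f (\<pi>[i := p]) + b * T f (\<pi>[i := q]))"

definition local_functional :: "nat \<Rightarrow> 'a metric \<Rightarrow> 'a functional \<Rightarrow> bool" where
  "local_functional m Z T \<longleftrightarrow>
     (\<forall>f \<pi>. (f, \<pi>) \<in> test_forms m Z \<longrightarrow>
        (\<exists>i<m. \<exists>U c. openin (mtopology_of Z) U \<and> {x \<in> mspace Z. f x \<noteq> 0} \<subseteq> U \<and>
           (\<forall>x\<in>U. (\<pi> ! i) x = c)) \<longrightarrow>
        T f \<pi> = 0)"

definition continuous_functional :: "nat \<Rightarrow> 'a metric \<Rightarrow> 'a functional \<Rightarrow> bool" where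
  "continuous_functional m Z T \<longleftrightarrow>
     (\<forall>f \<pi> P. (f, \<pi>) \<in> test_forms m Z \<longrightarrow>
        (\<forall>j::nat. (f, P j) \<in> test_forms m Z \<and> (\<forall>p\<in>set (P j). lip Z p \<le> 1)) \<longrightarrow>
        (\<forall>i<m. \<forall>x\<in>mspace Z. (\<lambda>j. (P j ! i) x) \<longlonglongrightarrow> (\<pi> ! i) x) \<longrightarrow>
        (\<lambda>j. T f (P j)) \<longlonglongrightarrow> T f \<pi>)"

definition mass_bound :: "nat \<Rightarrow> 'a metric \<Rightarrow> 'a functional \<Rightarrow> 'a measure \<Rightarrow> bool" where
  "mass_bound m Z T \<mu> \<longleftrightarrow> finite_measure \<mu> \<and> sets \<mu> = sets (borel_of_metric Z) \<and>
     (\<forall>(f, \<pi>) \<in> test_forms m Z. \<bar>T f \<pi>\<bar> \<le> prod_list (map (lip Z) \<pi>) * (LINT x|\<mu>. \<bar>f x\<bar>))"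

definition has_finite_mass :: "nat \<Rightarrow> 'a metric \<Rightarrow> 'a functional \<Rightarrow> bool" where
  "has_finite_mass m Z T \<longleftrightarrow> (\<exists>\<mu>. mass_bound m Z T \<mu>)"

definition current :: "nat \<Rightarrow> 'a metric \<Rightarrow> 'a functional \<Rightarrow> bool" where
  "current m Z T \<longleftrightarrow> multilinear m Z T \<and> local_functional m Z T \<and>
     continuous_functional m Z T \<and> has_finite_mass m Z T"

definition mass_measure :: "nat \<Rightarrow> 'a metric \<Rightarrow> 'a functional \<Rightarrow> 'a measure" where
  "mass_measure m Z T = (THE \<mu>. mass_bound m Z T \<mu> \<and>
     (\<forall>\<nu>. mass_bound m Z T \<nu> \<longrightarrow> (\<forall>B\<in>sets (borel_of_metric Z). emeasure \<mu> B \<le> emeasure \<nu> B)))"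

definition mass :: "nat \<Rightarrow> 'a metric \<Rightarrow> 'a functional \<Rightarrow> ennreal" where
  "mass m Z T = (if has_finite_mass m Z T then emeasure (mass_measure m Z T) (mspace Z) else \<infinity>)"

definition push_forward :: "('a \<Rightarrow> 'b) \<Rightarrow> 'a functional \<Rightarrow> 'b functional" where
  "push_forward \<phi> T f \<pi> = T (f \<circ> \<phi>) (map (\<lambda>p. p \<circ> \<phi>) \<pi>)"

definition boundary :: "'a functional \<Rightarrow> 'a functional" where
  "boundary T f \<pi> = T (\<lambda>_. 1) (f # \<pi>)"

definition weakly_converges :: "nat \<Rightarrow> 'a metric \<Rightarrow> (nat \<Rightarrow> 'a functional) \<Rightarrow> 'a functional \<Rightarrow> bool" where
  "weakly_converges m Z S S' \<longleftrightarrow> (\<forall>(f, \<pi>) \<in> test_forms m Z. (\<lambda>j. S j f \<pi>) \<longlonglongrightarrow> S' f \<pi>)"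

subsection \<open>Integral currents\<close>

text \<open>
  The dimension has to vary inside formulas (fillings have dimension \<open>m + 1\<close>), so \<open>\<real>\<^sup>m\<close> is the set of
  extensional functions on \<open>{..<m}\<close>, on which the product measure of \<^term>\<open>lborel\<close> is Lebesgue measure
  on Borel sets. The completion is needed because the integrands below are Borel measurable only
  up to null sets.
\<close>

definition rspace :: "nat \<Rightarrow> (nat \<Rightarrow> real) metric" where
  "rspace m = metric ({..<m} \<rightarrow>\<^sub>E UNIV, \<lambda>x y. L2_set (\<lambda>k. x k - y k) {..<m})"

lemma Metric_space_rspace:
  "Metric_space ({..<m::nat} \<rightarrow>\<^sub>E (UNIV :: real set)) (\<lambda>x y. L2_set (\<lambda>k. x k - y k) {..<m})"
proof
  fix x y z :: "nat \<Rightarrow> real"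
  show "L2_set (\<lambda>k. x k - y k) {..<m} = L2_set (\<lambda>k. y k - x k) {..<m}"
    by (simp add: L2_set_def power2_commute)
  show "L2_set (\<lambda>k. x k - y k) {..<m} = 0 \<longleftrightarrow> x = y"
    if "x \<in> {..<m} \<rightarrow>\<^sub>E UNIV" "y \<in> {..<m} \<rightarrow>\<^sub>E UNIV"
    using that by (auto simp: L2_set_eq_0_iff intro: PiE_ext)
  show "L2_set (\<lambda>k. x k - z k) {..<m} \<le> L2_set (\<lambda>k. x k - y k) {..<m} + L2_set (\<lambda>k. y k - z k) {..<m}"
    using L2_set_triangle_ineq[of "\<lambda>k. x k - y k" "\<lambda>k. y k - z k" "{..<m}"] by simp
qed simp

lemma mspace_rspace [simp]: "mspace (rspace m) = {..<m} \<rightarrow>\<^sub>E UNIV"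
  and mdist_rspace: "mdist (rspace m) x y = L2_set (\<lambda>k. x k - y k) {..<m}"
  by (simp_all add: rspace_def Metric_space.mspace_metric Metric_space.mdist_metric
      Metric_space_rspace)

definition rborel :: "nat \<Rightarrow> (nat \<Rightarrow> real) measure" where
  "rborel m = (\<Pi>\<^sub>M k\<in>{..<m}. lborel)"

definition rlebesgue :: "nat \<Rightarrow> (nat \<Rightarrow> real) measure" where
  "rlebesgue m = completion (rborel m)"

text \<open>
  The derivative at \<open>x\<close> relative to \<open>A\<close>. For \<open>g\<close> Lipschitz on a Borel set \<open>A\<close> it exists and is
  unique at almost every point of \<open>A\<close>, where it is the gradient of any Lipschitz extension of \<open>g\<close> to
  \<open>\<real>\<^sup>m\<close> (Rademacher's theorem and Lebesgue's density theorem).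
\<close>

definition grad_within :: "nat \<Rightarrow> (nat \<Rightarrow> real) set \<Rightarrow> ((nat \<Rightarrow> real) \<Rightarrow> real) \<Rightarrow>
    (nat \<Rightarrow> real) \<Rightarrow> nat \<Rightarrow> real" where
  "grad_within m A g x = (SOME D. \<forall>\<epsilon>>0. \<exists>\<delta>>0. \<forall>y\<in>A. mdist (rspace m) y x < \<delta> \<longrightarrow>
     \<bar>g y - g x - (\<Sum>k<m. D k * (y k - x k))\<bar> \<le> \<epsilon> * mdist (rspace m) y x)"

definition jacobian_det :: "nat \<Rightarrow> (nat \<Rightarrow> real) set \<Rightarrow> ((nat \<Rightarrow> real) \<Rightarrow> real) list \<Rightarrow>
    (nat \<Rightarrow> real) \<Rightarrow> real" where
  "jacobian_det m A g x = Determinant.det (Matrix.mat m m (\<lambda>(i, k). grad_within m A (g ! i) x k))"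

definition param_current :: "nat \<Rightarrow> (nat \<Rightarrow> real) set \<Rightarrow> ((nat \<Rightarrow> real) \<Rightarrow> 'a) \<Rightarrow>
    ((nat \<Rightarrow> real) \<Rightarrow> nat) \<Rightarrow> 'a functional" where
  "param_current m A \<phi> \<theta> f \<pi> = (LINT x:A|rlebesgue m.
     real (\<theta> x) * f (\<phi> x) * jacobian_det m A (map (\<lambda>p. p \<circ> \<phi>) \<pi>) x)"

definition bi_lipschitz_on :: "nat \<Rightarrow> (nat \<Rightarrow> real) set \<Rightarrow> 'a metric \<Rightarrow> ((nat \<Rightarrow> real) \<Rightarrow> 'a) \<Rightarrow> bool" where
  "bi_lipschitz_on m A Z \<phi> \<longleftrightarrow> \<phi> \<in> A \<rightarrow> mspace Z \<and>
     (\<exists>c>0. \<exists>C>0. \<forall>x\<in>A. \<forall>y\<in>A. c * mdist (rspace m) x y \<le> mdist Z (\<phi> x) (\<phi> y) \<and>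
        mdist Z (\<phi> x) (\<phi> y) \<le> C * mdist (rspace m) x y)"

text \<open>The parametrisations form a sequence; finite and empty families arise with \<open>A i = {}\<close>.\<close>

definition integer_rectifiable :: "nat \<Rightarrow> 'a metric \<Rightarrow> 'a functional \<Rightarrow> bool" where
  "integer_rectifiable m Z T \<longleftrightarrow>
     (if m = 0 then
        \<exists>P (c :: 'a \<Rightarrow> int). finite P \<and> P \<subseteq> mspace Z \<and>
          (\<forall>(f, \<pi>) \<in> test_forms 0 Z. T f \<pi> = (\<Sum>p\<in>P. of_int (c p) * f p))
      else
        \<exists>(A :: nat \<Rightarrow> (nat \<Rightarrow> real) set) (\<phi> :: nat \<Rightarrow> (nat \<Rightarrow> real) \<Rightarrow> 'a) (\<theta> :: nat \<Rightarrow> (nat \<Rightarrow> real) \<Rightarrow> nat).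
          (\<forall>i. A i \<in> sets (rborel m) \<and>
               compactin (mtopology_of (rspace m)) (mtopology_of (rspace m) closure_of A i) \<and>
               bi_lipschitz_on m (A i) Z (\<phi> i) \<and>
               (\<forall>x\<in>A i. \<theta> i x \<ge> 1) \<and> set_integrable (rlebesgue m) (A i) (\<lambda>x. real (\<theta> i x))) \<and>
          disjoint_family (\<lambda>i. \<phi> i ` A i) \<and>
          (\<forall>(f, \<pi>) \<in> test_forms m Z. (\<lambda>i. param_current m (A i) (\<phi> i) (\<theta> i) f \<pi>) sums T f \<pi>) \<and>
          mass m Z T = (\<Sum>i. mass m Z (param_current m (A i) (\<phi> i) (\<theta> i))))"

text \<open>There is no boundary condition for \<open>m = 0\<close>.\<close>

definition integral_current :: "nat \<Rightarrow> 'a metric \<Rightarrow> 'a functional \<Rightarrow> bool" where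
  "integral_current m Z T \<longleftrightarrow> current m Z T \<and> integer_rectifiable m Z T \<and>
     (m \<ge> 1 \<longrightarrow> has_finite_mass (m - 1) Z (boundary T))"

definition canonical_set :: "nat \<Rightarrow> 'a metric \<Rightarrow> 'a functional \<Rightarrow> 'a set" where
  "canonical_set m Z T = {p \<in> mspace Z.
     Liminf (at_right 0) (\<lambda>r. ereal (measure (mass_measure m Z T) (mball_of Z p r) /
       (unit_ball_vol (real m) * r ^ m))) > 0}"

definition flat_distance :: "nat \<Rightarrow> 'a metric \<Rightarrow> 'a functional \<Rightarrow> 'a functional \<Rightarrow> ennreal" where
  "flat_distance m Z S T = Inf {mass m Z U + mass (Suc m) Z V | U V.
     integral_current m Z U \<and> integral_current (Suc m) Z V \<and>
     (\<forall>(f, \<pi>) \<in> test_forms m Z. S f \<pi> - T f \<pi> = U f \<pi> + boundary V f \<pi>)}"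

subsection \<open>Integral current spaces\<close>

text \<open>
  A space \<open>(X, d, T)\<close> comes together with a metric completion that contains \<open>X\<close> as a dense subset:
  \<open>closure_metric M\<close> is the completion, \<open>points M\<close> is \<open>X\<close>, and \<open>d\<close> is the restriction of the metric
  to \<open>X\<close>. The zero space is the case of empty carriers, where every current vanishes; it embeds in
  every \<open>Z\<close> and its push-forward is \<open>0\<close>.
\<close>

record 'a current_space =
  closure_metric :: "'a metric"
  points :: "'a set"
  structure_current :: "'a functional"

definition space_metric :: "'a current_space \<Rightarrow> 'a metric" where
  "space_metric M = submetric (closure_metric M) (points M)"

definition integral_current_space :: "nat \<Rightarrow> 'a current_space \<Rightarrow> bool" where
  "integral_current_space m M \<longleftrightarrow>
     mcomplete_of (closure_metric M) \<and> points M \<subseteq> mspace (closure_metric M) \<and>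
     mtopology_of (closure_metric M) closure_of points M = mspace (closure_metric M) \<and>
     integral_current m (closure_metric M) (structure_current M) \<and>
     canonical_set m (closure_metric M) (structure_current M) = points M"

text \<open>The (unique) extension to the completion of an isometric embedding of \<open>X\<close> into a complete space.\<close>

definition extend_embedding :: "'a current_space \<Rightarrow> 'b metric \<Rightarrow> ('a \<Rightarrow> 'b) \<Rightarrow> 'a \<Rightarrow> 'b" where
  "extend_embedding M Z \<phi> =
     (SOME \<psi>. isometric_embedding (closure_metric M) Z \<psi> \<and> (\<forall>x\<in>points M. \<psi> x = \<phi> x))"

text \<open>
  HOL cannot quantify over types in a formula, so the infimum over all complete metric spaces \<open>Z\<close>
  ranges over those with carrier in a type \<open>'z\<close>, given as a parameter. Integral current spaces and
  fillings live in separable subspaces, so the value is the same for all \<open>'z\<close> of at least the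
  cardinality of the continuum; for smaller \<open>'z\<close> it can only be larger (\<open>\<infinity>\<close> if no \<open>Z\<close> fits in \<open>'z\<close>).
  An assumption that the distance is small is therefore most general for arbitrary \<open>'z\<close>.
\<close>

definition intrinsic_flat_distance :: "'z itself \<Rightarrow> nat \<Rightarrow> 'a current_space \<Rightarrow> 'b current_space \<Rightarrow> ennreal" where
  "intrinsic_flat_distance _ m M\<^sub>1 M\<^sub>2 =
     Inf {flat_distance m Z (push_forward \<phi>\<^sub>1 (structure_current M\<^sub>1))
                            (push_forward \<phi>\<^sub>2 (structure_current M\<^sub>2)) | (Z :: 'z metric) \<phi>\<^sub>1 \<phi>\<^sub>2.
       mcomplete_of Z \<and> isometric_embedding (closure_metric M\<^sub>1) Z \<phi>\<^sub>1 \<and>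
       isometric_embedding (closure_metric M\<^sub>2) Z \<phi>\<^sub>2}"

end

theory Submission
  imports Defs
begin

text \<open>
  For all large \<open>j\<close> the intrinsic flat distance from \<open>M\<^sub>j\<close> to \<open>M\<^sub>0\<close> is finite, so there are a complete
  space \<open>Z\<^sub>j\<close> that contains isometric copies of both completions and integral currents \<open>U\<^sub>j\<close>, \<open>V\<^sub>j\<close>
  on \<open>Z\<^sub>j\<close> of almost minimal total mass such that \<open>U\<^sub>j + \<partial>V\<^sub>j\<close> is the difference of the two
  push-forwards. Gluing all the \<open>Z\<^sub>j\<close> along their copies of \<open>M\<^sub>0\<close> produces one space in which all
  fillings live at once, and there the flat distances tend to \<open>0\<close>. Two points need care: the glued
  space has to be separable although the \<open>Z\<^sub>j\<close> are arbitrary, and integral currents of the same mass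
  have to be produced in it.

  An integral current is a countable sum of integrals over Lipschitz images of subsets of Euclidean
  space (or a finite sum of point evaluations). Its value on \<open>(f, \<pi>)\<close> therefore depends only on the
  restrictions of \<open>f\<close> and \<open>\<pi>\<close> to a separable set (\<open>rectifiable_within_determined\<close>). Moreover the
  completion of an integral current space is separable (\<open>integral_current_space_separable\<close>), since the
  canonical set lies in the closure of that set. Hence only a separable closed part \<open>Y\<^sub>j\<close> of \<open>Z\<^sub>j\<close>
  matters, and it suffices to embed the sets \<open>Y\<^sub>j\<close>.

  The relation \<open>corresponds\<close> expresses that \<open>T'\<close> on \<open>W\<close> is the image of \<open>T\<close> on \<open>Z\<close> under an
  isometry \<open>F\<close> that is defined only on a subset \<open>Y\<close> of \<open>Z\<close>: the values agree on all pairs of test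
  forms that agree through \<open>F\<close>. McShane's extension supplies such pairs, with the same Lipschitz
  constants. The relation can be inverted, so an inequality between masses
  (\<open>mass_transport_le\<close>) gives the equality (\<open>mass_transport_eq\<close>) that keeps a current integer
  rectifiable. The axioms of a current are inherited by \<open>T'\<close>; for continuity this rests
  on extensions that converge pointwise on all of \<open>Z\<close> (\<open>vanishing_extension\<close>), and for locality on
  flattening a coordinate function near one of its level sets (\<open>local_transport\<close>).

  Every statement about masses presupposes a least mass bound. It is obtained in
  \<open>least_mass_bound_exists\<close> by minimising the total mass, as the minimum of two mass bounds is again
  one. The underlying argument cuts a test form into two by a Lipschitz function, and \<open>splittable\<close> is
  the property of a functional that makes this work. A single parametrised piece has it for elementary
  reasons (\<open>param_current_splittable\<close>).

  The gluing takes place inside the space of bounded sequences (\<open>common_embedding\<close>): the distances to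
  a dense sequence of \<open>Y\<^sub>j\<close> embed \<open>Y\<^sub>j\<close> isometrically, and on the other \<open>Y\<^sub>i\<close> the same coordinates are
  defined by extending their restrictions to the copy of \<open>M\<^sub>0\<close>. The required space is the closure of
  the images. Finally, the mass bounds for \<open>U\<close> and \<open>V\<close> show that flat convergence implies weak
  convergence (\<open>flat_imp_weak_convergence\<close>).
\<close>

section \<open>Lipschitz functions and their extension\<close>

lemma mdist_self [simp]: "x \<in> mspace Z \<Longrightarrow> mdist Z x x = 0"
  using mdist_zero[of x Z x] by simp

text \<open>
  Lipschitz bounds relative to a subset, for functions that are given on a part of the space only
  and are to be extended with the same constant.
\<close>

definition lip_le :: "'a metric \<Rightarrow> 'a set \<Rightarrow> real \<Rightarrow> ('a \<Rightarrow> real) \<Rightarrow> bool" where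
  "lip_le Z Y L f \<longleftrightarrow> 0 \<le> L \<and> (\<forall>x\<in>Y. \<forall>y\<in>Y. \<bar>f x - f y\<bar> \<le> L * mdist Z x y)"

lemma lip_leI:
  assumes "0 \<le> L" "\<And>x y. x \<in> Y \<Longrightarrow> y \<in> Y \<Longrightarrow> f x - f y \<le> L * mdist Z x y"
  shows "lip_le Z Y L f"
  unfolding lip_le_def
proof (intro conjI ballI)
  fix x y assume "x \<in> Y" "y \<in> Y"
  then show "\<bar>f x - f y\<bar> \<le> L * mdist Z x y"
    using assms(2)[of x y] assms(2)[of y x] by (simp add: mdist_commute abs_le_iff)
qed (fact assms(1))

lemma lip_le_nonneg: "lip_le Z Y L f \<Longrightarrow> 0 \<le> L"
  by (simp add: lip_le_def)

lemma lip_leD: "lip_le Z Y L f \<Longrightarrow> x \<in> Y \<Longrightarrow> y \<in> Y \<Longrightarrow> \<bar>f x - f y\<bar> \<le> L * mdist Z x y"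
  by (simp add: lip_le_def)

lemma lip_le_subset: "lip_le Z Y L f \<Longrightarrow> X \<subseteq> Y \<Longrightarrow> lip_le Z X L f"
  by (auto simp: lip_le_def)

lemma lip_le_mono: "lip_le Z Y L f \<Longrightarrow> L \<le> L' \<Longrightarrow> lip_le Z Y L' f"
  unfolding lip_le_def by (meson mdist_nonneg mult_right_mono order_trans)

lemma lipschitz_fun_iff_lip_le: "lipschitz_fun Z f \<longleftrightarrow> (\<exists>L. lip_le Z (mspace Z) L f)"
proof
  assume "lipschitz_fun Z f"
  then obtain B where "B > 0" "\<forall>x\<in>mspace Z. \<forall>y\<in>mspace Z. dist (f x) (f y) \<le> B * mdist Z x y"
    unfolding Lipschitz_continuous_map_pos by auto
  then have "lip_le Z (mspace Z) B f"
    by (simp add: lip_le_def dist_real_def)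
  then show "\<exists>L. lip_le Z (mspace Z) L f" ..
next
  assume "\<exists>L. lip_le Z (mspace Z) L f"
  then show "lipschitz_fun Z f"
    by (auto simp: Lipschitz_continuous_map_def lip_le_def dist_real_def)
qed

lemma lipschitz_funI: "lip_le Z (mspace Z) L f \<Longrightarrow> lipschitz_fun Z f"
  using lipschitz_fun_iff_lip_le by blast

lemma lip_eq: "lip Z f = Inf {L. lip_le Z (mspace Z) L f}"
  by (simp add: lip_def lip_le_def)

lemma lip_le_imp_lip_le: "lip_le Z (mspace Z) L f \<Longrightarrow> lip Z f \<le> L"
  unfolding lip_eq by (rule cInf_lower) (auto simp: bdd_below_def lip_le_def)

lemma lip_nonneg: "lipschitz_fun Z f \<Longrightarrow> 0 \<le> lip Z f"
  unfolding lip_eq lipschitz_fun_iff_lip_le by (rule cInf_greatest) (auto simp: lip_le_def)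

text \<open>
  The infimum in the definition of \<open>lip\<close> is attained: for two points at positive distance the
  difference quotient is a lower bound of all admissible constants.
\<close>

lemma lip_le_lip:
  assumes "lipschitz_fun Z f"
  shows "lip_le Z (mspace Z) (lip Z f) f"
proof (rule lip_leI)
  show "0 \<le> lip Z f" using assms by (rule lip_nonneg)
  fix x y assume xy: "x \<in> mspace Z" "y \<in> mspace Z"
  show "f x - f y \<le> lip Z f * mdist Z x y"
  proof (cases "mdist Z x y = 0")
    case True
    then show ?thesis using xy by simp
  next
    case False
    then have pos: "0 < mdist Z x y" by (simp add: less_le)
    have "(f x - f y) / mdist Z x y \<le> lip Z f"
      unfolding lip_eq
    proof (rule cInf_greatest)
      show "{L. lip_le Z (mspace Z) L f} \<noteq> {}" using assms lipschitz_fun_iff_lip_le by blast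
      fix L assume "L \<in> {L. lip_le Z (mspace Z) L f}"
      then show "(f x - f y) / mdist Z x y \<le> L"
        using pos xy by (simp add: divide_le_eq) (meson abs_le_D1 lip_leD)
    qed
    then show ?thesis using pos by (simp add: divide_le_eq)
  qed
qed

lemma lip_le_const [simp]: "lip_le Z Y L (\<lambda>_. c) \<longleftrightarrow> 0 \<le> L"
  by (auto simp: lip_le_def)

lemma lip_le_add:
  assumes "lip_le Z Y L f" "lip_le Z Y L' g"
  shows "lip_le Z Y (L + L') (\<lambda>x. f x + g x)"
  unfolding lip_le_def
proof (intro conjI ballI)
  show "0 \<le> L + L'" using assms by (simp add: lip_le_def)
  fix x y assume "x \<in> Y" "y \<in> Y"
  then show "\<bar>(f x + g x) - (f y + g y)\<bar> \<le> (L + L') * mdist Z x y"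
    using lip_leD[OF assms(1), of x y] lip_leD[OF assms(2), of x y] by (simp add: distrib_right)
qed

lemma lip_le_cmult:
  assumes "lip_le Z Y L f"
  shows "lip_le Z Y (\<bar>c\<bar> * L) (\<lambda>x. c * f x)"
  unfolding lip_le_def
proof (intro conjI ballI)
  show "0 \<le> \<bar>c\<bar> * L" using assms by (simp add: lip_le_def)
  fix x y assume "x \<in> Y" "y \<in> Y"
  then show "\<bar>c * f x - c * f y\<bar> \<le> \<bar>c\<bar> * L * mdist Z x y"
    using mult_left_mono[OF lip_leD[OF assms(1), of x y], of "\<bar>c\<bar>"]
    by (simp add: abs_mult[symmetric] right_diff_distrib mult.assoc)
qed

lemma lip_le_contract:
  assumes "lip_le Z Y L f" "\<And>s t. \<bar>h s - h t\<bar> \<le> \<bar>s - t\<bar>"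
  shows "lip_le Z Y L (\<lambda>x. h (f x))"
  using assms unfolding lip_le_def by (meson order_trans)

lemma lip_le_minus: "lip_le Z Y L f \<Longrightarrow> lip_le Z Y L (\<lambda>x. - f x)"
  by (rule lip_le_contract) auto

lemma lip_le_diff:
  "lip_le Z Y L f \<Longrightarrow> lip_le Z Y L' g \<Longrightarrow> lip_le Z Y (L + L') (\<lambda>x. f x - g x)"
  using lip_le_add[OF _ lip_le_minus, of Z Y L f L' g] by simp

lemma lip_le_mult:
  assumes f: "lip_le Z Y L f" "\<And>x. x \<in> Y \<Longrightarrow> \<bar>f x\<bar> \<le> B"
    and g: "lip_le Z Y L' g" "\<And>x. x \<in> Y \<Longrightarrow> \<bar>g x\<bar> \<le> B'" and "0 \<le> B" "0 \<le> B'"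
  shows "lip_le Z Y (B * L' + B' * L) (\<lambda>x. f x * g x)"
  unfolding lip_le_def
proof (intro conjI ballI)
  show "0 \<le> B * L' + B' * L" using assms by (simp add: lip_le_def)
  fix x y assume xy: "x \<in> Y" "y \<in> Y"
  have "\<bar>f x * g x - f y * g y\<bar> = \<bar>f x * (g x - g y) + g y * (f x - f y)\<bar>"
    by (simp add: algebra_simps)
  also have "\<dots> \<le> \<bar>f x\<bar> * \<bar>g x - g y\<bar> + \<bar>g y\<bar> * \<bar>f x - f y\<bar>"
    by (metis abs_mult abs_triangle_ineq)
  also have "\<dots> \<le> B * (L' * mdist Z x y) + B' * (L * mdist Z x y)"
    using xy assms by (intro add_mono mult_mono lip_leD[OF f(1)] lip_leD[OF g(1)]) auto
  finally show "\<bar>f x * g x - f y * g y\<bar> \<le> (B * L' + B' * L) * mdist Z x y"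
    by (simp add: algebra_simps)
qed

lemma lipschitz_fun_combination:
  assumes "lipschitz_fun Z f" "lipschitz_fun Z g"
  shows "lipschitz_fun Z (\<lambda>x. a * f x + b * g x)"
  using assms lip_le_add lip_le_cmult unfolding lipschitz_fun_iff_lip_le by blast

lemma lipschitz_fun_scale: "lipschitz_fun Z f \<Longrightarrow> lipschitz_fun Z (\<lambda>x. a * f x)"
  using lip_le_cmult unfolding lipschitz_fun_iff_lip_le by blast

lemma bounded_image_iff: "bounded (f ` A) \<longleftrightarrow> (\<exists>B\<ge>0. \<forall>x\<in>A. \<bar>f x :: real\<bar> \<le> B)"
proof
  assume "bounded (f ` A)"
  then obtain B where "\<forall>x\<in>A. \<bar>f x\<bar> \<le> B" by (auto simp: bounded_iff)
  then show "\<exists>B\<ge>0. \<forall>x\<in>A. \<bar>f x\<bar> \<le> B" by (intro exI[of _ "\<bar>B\<bar>"]) auto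
qed (auto simp: bounded_iff)

lemma lipschitz_fun_mult:
  assumes "lipschitz_fun Z f" "bounded (f ` mspace Z)" "lipschitz_fun Z g" "bounded (g ` mspace Z)"
  shows "lipschitz_fun Z (\<lambda>x. f x * g x)"
  using assms lip_le_mult[of Z "mspace Z"] unfolding lipschitz_fun_iff_lip_le bounded_image_iff
  by blast

text \<open>
  McShane's extension, the largest \<open>L\<close>-Lipschitz function that lies below \<open>g\<close> on \<open>Y\<close>. For empty \<open>Y\<close>
  it is the infimum of the empty set, a constant, and hence still Lipschitz.
\<close>

definition mcshane :: "'a metric \<Rightarrow> 'a set \<Rightarrow> real \<Rightarrow> ('a \<Rightarrow> real) \<Rightarrow> 'a \<Rightarrow> real" where
  "mcshane Z Y L g x = (INF y\<in>Y. g y + L * mdist Z x y)"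

lemma mcshane_lower:
  assumes g: "lip_le Z Y L g" and Y: "Y \<subseteq> mspace Z" and x: "x \<in> mspace Z" and y: "y \<in> Y"
  shows "mcshane Z Y L g x \<le> g y + L * mdist Z x y"
  unfolding mcshane_def
proof (rule cINF_lower[OF _ y])
  show "bdd_below ((\<lambda>y. g y + L * mdist Z x y) ` Y)"
  proof (rule bdd_belowI2)
    fix z assume z: "z \<in> Y"
    have "L * mdist Z y z \<le> L * (mdist Z x y + mdist Z x z)"
      using mdist_triangle[of y Z x z] Y x y z lip_le_nonneg[OF g]
      by (intro mult_left_mono) (auto simp: mdist_commute)
    then show "g y - L * mdist Z x y \<le> g z + L * mdist Z x z"
      using lip_leD[OF g y z] by (simp add: algebra_simps abs_le_iff)
  qed
qed

lemma mcshane_greatest: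
  "Y \<noteq> {} \<Longrightarrow> (\<And>y. y \<in> Y \<Longrightarrow> b \<le> g y + L * mdist Z x y) \<Longrightarrow> b \<le> mcshane Z Y L g x"
  unfolding mcshane_def by (rule cINF_greatest) auto

lemma mcshane_eq:
  assumes g: "lip_le Z Y L g" and Y: "Y \<subseteq> mspace Z" and y: "y \<in> Y"
  shows "mcshane Z Y L g y = g y"
proof (rule antisym)
  show "mcshane Z Y L g y \<le> g y"
    using mcshane_lower[OF g Y _ y, of y] y Y by (auto simp: subset_iff)
  show "g y \<le> mcshane Z Y L g y"
    using y lip_leD[OF g y] by (intro mcshane_greatest) (auto simp: abs_le_iff algebra_simps)
qed

lemma lip_le_mcshane:
  assumes g: "lip_le Z Y L g" and Y: "Y \<subseteq> mspace Z"
  shows "lip_le Z (mspace Z) L (mcshane Z Y L g)"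
proof (rule lip_leI)
  show L: "0 \<le> L" using g by (rule lip_le_nonneg)
  fix x x' assume x: "x \<in> mspace Z" "x' \<in> mspace Z"
  show "mcshane Z Y L g x - mcshane Z Y L g x' \<le> L * mdist Z x x'"
  proof (cases "Y = {}")
    case True
    then show ?thesis using L by (simp add: mcshane_def)
  next
    case False
    have "mcshane Z Y L g x - L * mdist Z x x' \<le> mcshane Z Y L g x'"
    proof (rule mcshane_greatest[OF False])
      fix y assume y: "y \<in> Y"
      have "L * mdist Z x y \<le> L * (mdist Z x x' + mdist Z x' y)"
        using mdist_triangle[of x Z x' y] x y Y L by (intro mult_left_mono) auto
      then show "mcshane Z Y L g x - L * mdist Z x x' \<le> g y + L * mdist Z x' y"
        using mcshane_lower[OF g Y x(1) y] by (simp add: algebra_simps)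
    qed
    then show ?thesis by simp
  qed
qed

lemma lipschitz_extension:
  assumes "lip_le Z Y L g" "Y \<subseteq> mspace Z"
  obtains h where "lip_le Z (mspace Z) L h" "\<And>y. y \<in> Y \<Longrightarrow> h y = g y"
  using lip_le_mcshane[OF assms] mcshane_eq[OF assms] by blast

lemma lipschitz_extension_bounded:
  assumes "lip_le Z Y L g" "Y \<subseteq> mspace Z" "0 \<le> B" "\<And>y. y \<in> Y \<Longrightarrow> \<bar>g y\<bar> \<le> B"
  obtains h where "lip_le Z (mspace Z) L h" "\<And>y. y \<in> Y \<Longrightarrow> h y = g y" "\<And>x. \<bar>h x\<bar> \<le> B"
proof -
  obtain h where h: "lip_le Z (mspace Z) L h" "\<And>y. y \<in> Y \<Longrightarrow> h y = g y"
    using lipschitz_extension[OF assms(1,2)] by metis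
  show thesis
  proof (rule that)
    show "lip_le Z (mspace Z) L (\<lambda>x. max (- B) (min B (h x)))"
      by (rule lip_le_contract[OF h(1)]) auto
    show "max (- B) (min B (h y)) = g y" if "y \<in> Y" for y
      using h(2)[OF that] assms(4)[OF that] by auto
    show "\<bar>max (- B) (min B (h x))\<bar> \<le> B" for x
      using assms(3) by auto
  qed
qed

text \<open>
  Extending the zero function with constant \<open>1\<close> gives the distance to \<open>Y\<close>.
\<close>

abbreviation dist_to :: "'a metric \<Rightarrow> 'a set \<Rightarrow> 'a \<Rightarrow> real" where
  "dist_to Z Y \<equiv> mcshane Z Y 1 (\<lambda>_. 0)"

lemma lip_le_dist_to: "Y \<subseteq> mspace Z \<Longrightarrow> lip_le Z (mspace Z) 1 (dist_to Z Y)"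
  by (rule lip_le_mcshane) auto

lemma dist_to_zero: "Y \<subseteq> mspace Z \<Longrightarrow> y \<in> Y \<Longrightarrow> dist_to Z Y y = 0"
  by (rule mcshane_eq) auto

lemma dist_to_pos:
  assumes "closedin (mtopology_of Z) Y" "Y \<noteq> {}" "x \<in> mspace Z" "x \<notin> Y"
  shows "0 < dist_to Z Y x"
proof -
  interpret Metric_space "mspace Z" "mdist Z" by simp
  obtain r where r: "r > 0" "disjnt Y (mball x r)"
    using assms closedin_metric unfolding mtopology_of_def by blast
  have "r \<le> dist_to Z Y x"
  proof (rule mcshane_greatest[OF assms(2)])
    fix y assume "y \<in> Y"
    moreover have "y \<in> mspace Z"
      using \<open>y \<in> Y\<close> assms(1) closedin_subset by fastforce
    ultimately show "r \<le> 0 + 1 * mdist Z x y"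
      using r(2) assms(3) by (auto simp: disjnt_iff not_less)
  qed
  then show ?thesis using r by simp
qed

section \<open>Borel measures on a metric space\<close>

lemma space_borel_of_metric [simp]: "space (borel_of_metric Z) = mspace Z"
  by (simp add: borel_of_metric_def space_measure_of_conv)

lemma openin_subset_mspace: "openin (mtopology_of Z) U \<Longrightarrow> U \<subseteq> mspace Z"
  by (metis openin_subset topspace_mtopology_of)

lemma sets_borel_of_metric:
  "sets (borel_of_metric Z) = sigma_sets (mspace Z) {U. openin (mtopology_of Z) U}"
  unfolding borel_of_metric_def by (rule sets_measure_of) (auto dest: openin_subset_mspace)

lemma openin_borel: "openin (mtopology_of Z) U \<Longrightarrow> U \<in> sets (borel_of_metric Z)"
  by (simp add: sets_borel_of_metric sigma_sets.Basic)

lemma closedin_borel: "closedin (mtopology_of Z) C \<Longrightarrow> C \<in> sets (borel_of_metric Z)"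
  by (metis closedin_def double_diff openin_borel order_refl sets.compl_sets
      space_borel_of_metric topspace_mtopology_of)

lemma openin_preimage_lipschitz:
  assumes "lipschitz_fun Z f" "open S"
  shows "openin (mtopology_of Z) {x \<in> mspace Z. f x \<in> S}"
proof -
  have "continuous_map (mtopology_of Z) euclideanreal f"
    using Lipschitz_continuous_imp_continuous_map[OF assms(1)] by simp
  then show ?thesis
    using openin_continuous_map_preimage[of "mtopology_of Z" euclideanreal f S] assms(2) by simp
qed

lemma lipschitz_borel_measurable:
  assumes "lipschitz_fun Z f"
  shows "f \<in> borel_measurable (borel_of_metric Z)"
proof (rule borel_measurableI)
  fix S :: "real set" assume "open S"
  have "f -` S \<inter> space (borel_of_metric Z) = {x \<in> mspace Z. f x \<in> S}" by auto
  then show "f -` S \<inter> space (borel_of_metric Z) \<in> sets (borel_of_metric Z)"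
    using openin_borel[OF openin_preimage_lipschitz[OF assms \<open>open S\<close>]] by simp
qed

lemma lipschitz_measurable_sets:
  "sets \<mu> = sets (borel_of_metric Z) \<Longrightarrow> lipschitz_fun Z f \<Longrightarrow> f \<in> borel_measurable \<mu>"
  using lipschitz_borel_measurable measurable_cong_sets by blast

lemma space_eq_mspace: "sets \<mu> = sets (borel_of_metric Z) \<Longrightarrow> space \<mu> = mspace Z"
  by (metis sets_eq_imp_space_eq space_borel_of_metric)

lemma bounded_lipschitz_integrable:
  assumes "finite_measure \<mu>" "sets \<mu> = sets (borel_of_metric Z)"
    "lipschitz_fun Z f" "bounded (f ` mspace Z)"
  shows "integrable \<mu> f"
proof -
  obtain B where "\<forall>x\<in>mspace Z. \<bar>f x\<bar> \<le> B" using assms(4) by (auto simp: bounded_image_iff)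
  then show ?thesis
    using assms space_eq_mspace[OF assms(2)] lipschitz_measurable_sets[OF assms(2,3)]
    by (intro finite_measure.integrable_const_bound[where B=B]) auto
qed

definition unit_lipschitz :: "'a metric \<Rightarrow> ('a \<Rightarrow> real) \<Rightarrow> bool" where
  "unit_lipschitz Z \<eta> \<longleftrightarrow> lipschitz_fun Z \<eta> \<and> (\<forall>x. 0 \<le> \<eta> x \<and> \<eta> x \<le> 1)"

lemma unit_lipschitz_bounded: "unit_lipschitz Z \<eta> \<Longrightarrow> bounded (\<eta> ` A)"
  by (auto simp: unit_lipschitz_def bounded_image_iff intro!: exI[of _ 1])

lemma unit_lipschitz_compl: "unit_lipschitz Z \<eta> \<Longrightarrow> unit_lipschitz Z (\<lambda>x. 1 - \<eta> x)"
  using lipschitz_fun_combination[of Z "\<lambda>_. 1" \<eta> 1 "-1"]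
  by (auto simp: unit_lipschitz_def lipschitz_fun_iff_lip_le intro: exI[of _ "0::real"])

definition cutoff :: "'a metric \<Rightarrow> 'a set \<Rightarrow> nat \<Rightarrow> 'a \<Rightarrow> real" where
  "cutoff Z C n x = max 0 (min 1 (1 - real n * dist_to Z C x))"

lemma unit_lipschitz_cutoff:
  assumes "C \<subseteq> mspace Z"
  shows "unit_lipschitz Z (cutoff Z C n)"
proof -
  have "lip_le Z (mspace Z) (\<bar>- real n\<bar> * 1) (\<lambda>x. - real n * dist_to Z C x)"
    by (rule lip_le_cmult[OF lip_le_dist_to[OF assms]])
  then have "lip_le Z (mspace Z) (\<bar>- real n\<bar> * 1) (\<lambda>x. max 0 (min 1 (1 + - real n * dist_to Z C x)))"
    by (rule lip_le_contract) auto
  then have "lip_le Z (mspace Z) (\<bar>- real n\<bar> * 1) (cutoff Z C n)"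
    by (simp add: cutoff_def[abs_def])
  then show ?thesis
    by (auto simp: unit_lipschitz_def cutoff_def intro: lipschitz_funI)
qed

lemma cutoff_eq_1: "C \<subseteq> mspace Z \<Longrightarrow> x \<in> C \<Longrightarrow> cutoff Z C n x = 1"
  by (simp add: cutoff_def dist_to_zero)

lemma cutoff_tendsto:
  assumes "closedin (mtopology_of Z) C" "C \<noteq> {}" "x \<in> mspace Z"
  shows "(\<lambda>n. cutoff Z C n x) \<longlonglongrightarrow> indicator C x"
proof (cases "x \<in> C")
  case True
  have "C \<subseteq> mspace Z" using assms(1) closedin_subset by fastforce
  then show ?thesis using True by (simp add: cutoff_eq_1)
next
  case False
  let ?d = "dist_to Z C x"
  have d: "?d > 0" using dist_to_pos[OF assms(1,2,3) False] .
  have "eventually (\<lambda>n. cutoff Z C n x = 0) sequentially"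
  proof (rule eventually_sequentiallyI)
    fix n assume "nat \<lceil>1 / ?d\<rceil> \<le> n"
    then have "1 / ?d \<le> real n" by linarith
    then have "1 \<le> real n * ?d" using d by (simp add: field_simps)
    then show "cutoff Z C n x = 0" by (simp add: cutoff_def)
  qed
  then show ?thesis using False by (simp add: tendsto_eventually)
qed

text \<open>
  Dominated convergence, in the form in which cut-off functions are used to concentrate a mass bound
  on a set.
\<close>

lemma LINT_tendsto_indicator:
  assumes \<mu>: "finite_measure \<mu>" "sets \<mu> = sets (borel_of_metric Z)"
    and A: "A \<in> sets (borel_of_metric Z)"
    and g: "g \<in> borel_measurable \<mu>" "\<And>x. x \<in> mspace Z \<Longrightarrow> \<bar>g x\<bar> \<le> B"
    and \<eta>: "\<And>n. unit_lipschitz Z (\<eta> n)" "\<And>x. x \<in> mspace Z \<Longrightarrow> (\<lambda>n. \<eta> n x) \<longlonglongrightarrow> indicator A x"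
  shows "(\<lambda>n. LINT x|\<mu>. g x * \<eta> n x) \<longlonglongrightarrow> (LINT x|\<mu>. g x * indicator A x)"
proof (rule integral_dominated_convergence[where w="\<lambda>_. B"])
  interpret finite_measure \<mu> by fact
  note sp = space_eq_mspace[OF \<mu>(2)]
  show "integrable \<mu> (\<lambda>_. B)" by simp
  show "(\<lambda>x. g x * indicator A x) \<in> borel_measurable \<mu>"
    using g(1) A \<mu>(2) by (intro borel_measurable_times borel_measurable_indicator) auto
  show "(\<lambda>x. g x * \<eta> n x) \<in> borel_measurable \<mu>" for n
    using g(1) \<eta>(1)[of n] lipschitz_measurable_sets[OF \<mu>(2)]
    by (intro borel_measurable_times) (auto simp: unit_lipschitz_def)
  show "AE x in \<mu>. (\<lambda>n. g x * \<eta> n x) \<longlonglongrightarrow> g x * indicator A x"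
    using \<eta>(2) sp by (intro AE_I2 tendsto_mult tendsto_const) auto
  show "AE x in \<mu>. norm (g x * \<eta> n x) \<le> B" for n
  proof (intro AE_I2)
    fix x assume "x \<in> space \<mu>"
    then have "\<bar>g x\<bar> \<le> B" using g(2) sp by auto
    moreover have "\<bar>g x\<bar> * \<bar>\<eta> n x\<bar> \<le> \<bar>g x\<bar> * 1"
      using \<eta>(1)[of n] by (intro mult_left_mono) (auto simp: unit_lipschitz_def)
    ultimately show "norm (g x * \<eta> n x) \<le> B" by (simp add: abs_mult)
  qed
qed

definition l1_gap :: "'a measure \<Rightarrow> ('a \<Rightarrow> real) \<Rightarrow> 'a set \<Rightarrow> real" where
  "l1_gap \<mu> \<eta> A = (LINT x|\<mu>. \<bar>\<eta> x - indicator A x\<bar>)"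

text \<open>
  Both measures are approximated by the same function, because a test form will be cut into two parts
  that are estimated with two different mass bounds.
\<close>

definition approximable :: "'a metric \<Rightarrow> 'a measure \<Rightarrow> 'a measure \<Rightarrow> 'a set \<Rightarrow> bool" where
  "approximable Z \<mu> \<nu> A \<longleftrightarrow>
     (\<forall>\<epsilon>>0. \<exists>\<eta>. unit_lipschitz Z \<eta> \<and> l1_gap \<mu> \<eta> A < \<epsilon> \<and> l1_gap \<nu> \<eta> A < \<epsilon>)"

lemma approximableI:
  assumes "\<And>n. unit_lipschitz Z (\<eta> n)"
    and "(\<lambda>n::nat. l1_gap \<mu> (\<eta> n) A) \<longlonglongrightarrow> 0" "(\<lambda>n. l1_gap \<nu> (\<eta> n) A) \<longlonglongrightarrow> 0"
  shows "approximable Z \<mu> \<nu> A"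
  unfolding approximable_def
proof (intro allI impI)
  fix \<epsilon> :: real assume "\<epsilon> > 0"
  then have "eventually (\<lambda>n. l1_gap \<mu> (\<eta> n) A < \<epsilon>) sequentially"
    "eventually (\<lambda>n. l1_gap \<nu> (\<eta> n) A < \<epsilon>) sequentially"
    using assms(2,3) by (auto dest: order_tendstoD)
  then have "eventually (\<lambda>n. l1_gap \<mu> (\<eta> n) A < \<epsilon> \<and> l1_gap \<nu> (\<eta> n) A < \<epsilon>) sequentially"
    by (rule eventually_conj)
  then show "\<exists>\<eta>. unit_lipschitz Z \<eta> \<and> l1_gap \<mu> \<eta> A < \<epsilon> \<and> l1_gap \<nu> \<eta> A < \<epsilon>"
    using assms(1) by (auto simp: eventually_sequentially)
qed

lemma l1_gap_integrable:
  assumes "finite_measure \<kappa>" "sets \<kappa> = sets (borel_of_metric Z)" "A \<in> sets (borel_of_metric Z)"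
    "unit_lipschitz Z \<eta>"
  shows "integrable \<kappa> (\<lambda>x. \<bar>\<eta> x - indicator A x\<bar>)"
proof -
  have "integrable \<kappa> \<eta>"
    using assms unit_lipschitz_bounded by (intro bounded_lipschitz_integrable) (auto simp: unit_lipschitz_def)
  moreover have "integrable \<kappa> (indicator A :: _ \<Rightarrow> real)"
    using assms finite_measure.emeasure_finite[OF assms(1), of A]
    by (auto simp: integrable_indicator_iff top.not_eq_extremum)
  ultimately show ?thesis by auto
qed

lemma l1_gap_tendsto_0:
  assumes \<kappa>: "finite_measure \<kappa>" "sets \<kappa> = sets (borel_of_metric Z)"
    and g: "\<And>n. (\<lambda>x. \<bar>g n x - indicator A x\<bar>) \<in> borel_measurable \<kappa>"
    and bound: "\<And>n x. \<bar>g n x - indicator A x\<bar> \<le> 1"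
    and lim: "\<And>x. x \<in> mspace Z \<Longrightarrow> (\<lambda>n::nat. g n x) \<longlonglongrightarrow> indicator A x"
  shows "(\<lambda>n. l1_gap \<kappa> (g n) A) \<longlonglongrightarrow> 0"
proof -
  interpret finite_measure \<kappa> by fact
  have "(\<lambda>n. l1_gap \<kappa> (g n) A) \<longlonglongrightarrow> (LINT x|\<kappa>. 0)"
    unfolding l1_gap_def
  proof (rule integral_dominated_convergence[where w="\<lambda>_. 1"])
    show "integrable \<kappa> (\<lambda>_. 1::real)" by simp
    show "(\<lambda>x. \<bar>g n x - indicator A x\<bar>) \<in> borel_measurable \<kappa>" for n by (rule g)
    show "AE x in \<kappa>. (\<lambda>n. \<bar>g n x - indicator A x\<bar>) \<longlonglongrightarrow> 0"
    proof (intro AE_I2)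
      fix x assume "x \<in> space \<kappa>"
      then have "(\<lambda>n. g n x) \<longlonglongrightarrow> indicator A x" using lim space_eq_mspace[OF \<kappa>(2)] by simp
      then show "(\<lambda>n. \<bar>g n x - indicator A x\<bar>) \<longlonglongrightarrow> 0" using LIM_zero tendsto_rabs_zero by blast
    qed
    show "AE x in \<kappa>. norm \<bar>g n x - indicator A x\<bar> \<le> 1" for n using bound by simp
  qed auto
  then show ?thesis by simp
qed

lemma approximable_openin:
  assumes \<mu>: "finite_measure \<mu>" "sets \<mu> = sets (borel_of_metric Z)"
    and \<nu>: "finite_measure \<nu>" "sets \<nu> = sets (borel_of_metric Z)"
    and U: "openin (mtopology_of Z) U"
  shows "approximable Z \<mu> \<nu> U"
proof -
  let ?C = "mspace Z - U"
  have UA: "U \<in> sets (borel_of_metric Z)" using U by (rule openin_borel)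
  have C: "closedin (mtopology_of Z) ?C"
    using U by (metis closedin_diff closedin_topspace topspace_mtopology_of)
  define \<eta> where "\<eta> n x = (if ?C = {} then 1 else 1 - cutoff Z ?C n x)" for n x
  have u: "unit_lipschitz Z (\<eta> n)" for n
    unfolding \<eta>_def using unit_lipschitz_compl[OF unit_lipschitz_cutoff[of ?C Z n]]
    by (cases "?C = {}") (auto simp: unit_lipschitz_def lipschitz_fun_iff_lip_le)
  have lim: "(\<lambda>n. \<eta> n x) \<longlonglongrightarrow> indicator U x" if "x \<in> mspace Z" for x
  proof (cases "?C = {}")
    case True
    then show ?thesis using that by (auto simp: \<eta>_def indicator_def)
  next
    case False
    have "(\<lambda>n. 1 - cutoff Z ?C n x) \<longlonglongrightarrow> 1 - indicator ?C x"
      by (intro tendsto_diff tendsto_const cutoff_tendsto[OF C False that])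
    moreover have "1 - indicator ?C x = (indicator U x :: real)"
      using that by (auto simp: indicator_def)
    ultimately show ?thesis unfolding \<eta>_def if_not_P[OF False] by simp
  qed
  have bound: "\<bar>\<eta> n x - indicator U x\<bar> \<le> 1" for n x
    using u[of n] by (auto simp: unit_lipschitz_def indicator_def)
  have "(\<lambda>n. l1_gap \<kappa> (\<eta> n) U) \<longlonglongrightarrow> 0"
    if \<kappa>: "finite_measure \<kappa>" "sets \<kappa> = sets (borel_of_metric Z)" for \<kappa>
    by (rule l1_gap_tendsto_0[OF \<kappa> borel_measurable_integrable[OF l1_gap_integrable[OF \<kappa> UA u]] bound lim])
  from approximableI[OF u this[OF \<mu>] this[OF \<nu>]] show ?thesis .
qed

lemma approximable_compl:
  assumes "space \<mu> = mspace Z" "space \<nu> = mspace Z" "approximable Z \<mu> \<nu> A"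
  shows "approximable Z \<mu> \<nu> (mspace Z - A)"
proof -
  have eq: "l1_gap \<kappa> (\<lambda>x. 1 - \<eta> x) (mspace Z - A) = l1_gap \<kappa> \<eta> A" if "space \<kappa> = mspace Z" for \<kappa> \<eta>
    unfolding l1_gap_def using that by (intro Bochner_Integration.integral_cong) (auto simp: indicator_def)
  show ?thesis
    unfolding approximable_def
  proof (intro allI impI)
    fix \<epsilon> :: real assume "\<epsilon> > 0"
    then obtain \<eta> where "unit_lipschitz Z \<eta>" "l1_gap \<mu> \<eta> A < \<epsilon>" "l1_gap \<nu> \<eta> A < \<epsilon>"
      using assms(3) unfolding approximable_def by auto
    then show "\<exists>\<eta>. unit_lipschitz Z \<eta> \<and> l1_gap \<mu> \<eta> (mspace Z - A) < \<epsilon> \<and> l1_gap \<nu> \<eta> (mspace Z - A) < \<epsilon>"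
      using unit_lipschitz_compl[of Z \<eta>]
      by (intro exI[of _ "\<lambda>x. 1 - \<eta> x"]) (simp add: eq assms(1,2))
  qed
qed

text \<open>
  A disjoint union is close to a finite partial union. The sum of the approximations of the finitely
  many parts is close to the indicator of that partial union, and truncating the sum at \<open>1\<close> only
  brings it closer to an indicator.
\<close>

lemma approximable_UN:
  assumes \<mu>: "finite_measure \<mu>" "sets \<mu> = sets (borel_of_metric Z)"
    and \<nu>: "finite_measure \<nu>" "sets \<nu> = sets (borel_of_metric Z)"
    and disj: "disjoint_family A" and AS: "\<And>i::nat. A i \<in> sets (borel_of_metric Z)"
    and appr: "\<And>i. approximable Z \<mu> \<nu> (A i)"
  shows "approximable Z \<mu> \<nu> (\<Union>i. A i)"
  unfolding approximable_def
proof (intro allI impI)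
  fix \<epsilon> :: real assume \<epsilon>: "\<epsilon> > 0"
  let ?U = "\<Union>i. A i" and ?s = "\<lambda>n x. \<Sum>i<n. indicator (A i) x :: real"
  have sums: "(\<lambda>n. ?s n x) \<longlonglongrightarrow> indicator ?U x" for x
    unfolding sums_def[symmetric]
    by (rule indicator_sums) (use disj in \<open>auto simp: disjoint_family_on_def\<close>)
  have bound1: "\<bar>?s n x - indicator ?U x\<bar> \<le> 1" for n x
  proof -
    have "?s n x = indicator (\<Union>i<n. A i) x"
      using disj by (intro indicator_UN_disjoint[symmetric]) (auto intro: disjoint_family_on_mono)
    then show ?thesis by (auto simp: indicator_def)
  qed
  have meas: "(\<lambda>x. \<bar>?s n x - indicator ?U x\<bar>) \<in> borel_measurable \<kappa>"
    if "sets \<kappa> = sets (borel_of_metric Z)" for \<kappa> :: "'a measure" and n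
  proof -
    have [measurable]: "A i \<in> sets \<kappa>" for i using AS that by simp
    show ?thesis by measurable
  qed
  have "eventually (\<lambda>n. l1_gap \<kappa> (?s n) ?U < \<epsilon>/2) sequentially"
    if \<kappa>: "finite_measure \<kappa>" "sets \<kappa> = sets (borel_of_metric Z)" for \<kappa>
    by (rule order_tendstoD(2)[OF l1_gap_tendsto_0[OF \<kappa> meas[OF \<kappa>(2)] bound1 sums]]) (use \<epsilon> in simp)
  from eventually_conj[OF this[OF \<mu>] this[OF \<nu>]]
  obtain n where n: "l1_gap \<mu> (?s n) ?U < \<epsilon>/2" "l1_gap \<nu> (?s n) ?U < \<epsilon>/2"
    by (auto simp: eventually_sequentially)
  define \<delta> where "\<delta> = \<epsilon> / (2 * (real n + 1))"
  (* One half of the error is spent on cutting off the union, the other is shared by its n parts. *)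
  have \<delta>: "\<delta> > 0" "real n * \<delta> \<le> \<epsilon>/2" using \<epsilon> by (auto simp: \<delta>_def field_simps)
  have "\<forall>i. \<exists>\<eta>. unit_lipschitz Z \<eta> \<and> l1_gap \<mu> \<eta> (A i) < \<delta> \<and> l1_gap \<nu> \<eta> (A i) < \<delta>"
    using appr \<delta>(1) by (simp add: approximable_def)
  from choice[OF this] obtain \<eta> where
    "\<forall>i. unit_lipschitz Z (\<eta> i) \<and> l1_gap \<mu> (\<eta> i) (A i) < \<delta> \<and> l1_gap \<nu> (\<eta> i) (A i) < \<delta>" by (rule exE)
  then have \<eta>: "\<And>i. unit_lipschitz Z (\<eta> i)" "\<And>i. l1_gap \<mu> (\<eta> i) (A i) < \<delta>" "\<And>i. l1_gap \<nu> (\<eta> i) (A i) < \<delta>"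
    by simp_all
  define \<psi> where "\<psi> x = min 1 (\<Sum>i<n. \<eta> i x)" for x
  have "lipschitz_fun Z (\<lambda>x. \<Sum>i<k. \<eta> i x)" for k
  proof (induction k)
    case (Suc k)
    then show ?case
      using lipschitz_fun_combination[of Z "\<lambda>x. \<Sum>i<k. \<eta> i x" "\<eta> k" 1 1] \<eta>(1)[of k]
      by (simp add: unit_lipschitz_def)
  qed (auto simp: lipschitz_fun_iff_lip_le)
  then obtain L where "lip_le Z (mspace Z) L (\<lambda>x. \<Sum>i<n. \<eta> i x)"
    by (auto simp: lipschitz_fun_iff_lip_le)
  then have "lip_le Z (mspace Z) L \<psi>"
    unfolding \<psi>_def by (rule lip_le_contract) auto
  then have \<psi>: "unit_lipschitz Z \<psi>"
    using \<eta>(1) by (auto simp: unit_lipschitz_def \<psi>_def intro!: sum_nonneg lipschitz_funI)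
  have bound: "l1_gap \<kappa> \<psi> ?U < \<epsilon>"
    if \<kappa>: "finite_measure \<kappa>" "sets \<kappa> = sets (borel_of_metric Z)"
      and less: "\<And>i. l1_gap \<kappa> (\<eta> i) (A i) < \<delta>" "l1_gap \<kappa> (?s n) ?U < \<epsilon>/2" for \<kappa>
  proof -
    interpret finite_measure \<kappa> by fact
    have i1: "integrable \<kappa> (\<lambda>x. \<bar>\<eta> i x - indicator (A i) x\<bar>)" for i
      using l1_gap_integrable[OF \<kappa> AS \<eta>(1)] .
    have i2: "integrable \<kappa> (\<lambda>x. \<bar>?s n x - indicator ?U x\<bar>)"
      by (rule integrable_const_bound[where B=1, OF _ meas[OF \<kappa>(2)]]) (use bound1 in simp)
    have "l1_gap \<kappa> \<psi> ?U \<le> (LINT x|\<kappa>. (\<Sum>i<n. \<bar>\<eta> i x - indicator (A i) x\<bar>) + \<bar>?s n x - indicator ?U x\<bar>)"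
      unfolding l1_gap_def
    proof (rule integral_mono)
      show "integrable \<kappa> (\<lambda>x. \<bar>\<psi> x - indicator ?U x\<bar>)"
        using AS by (intro l1_gap_integrable[OF \<kappa> _ \<psi>]) auto
      show "integrable \<kappa> (\<lambda>x. (\<Sum>i<n. \<bar>\<eta> i x - indicator (A i) x\<bar>) + \<bar>?s n x - indicator ?U x\<bar>)"
        using i1 i2 by auto
      fix x
      have "\<bar>\<psi> x - indicator ?U x\<bar> \<le> \<bar>(\<Sum>i<n. \<eta> i x) - indicator ?U x\<bar>"
        by (auto simp: \<psi>_def indicator_def)
      also have "\<dots> \<le> \<bar>(\<Sum>i<n. \<eta> i x) - ?s n x\<bar> + \<bar>?s n x - indicator ?U x\<bar>" by simp
      also have "\<bar>(\<Sum>i<n. \<eta> i x) - ?s n x\<bar> \<le> (\<Sum>i<n. \<bar>\<eta> i x - indicator (A i) x\<bar>)"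
        unfolding sum_subtractf[symmetric] by (rule sum_abs)
      finally show "\<bar>\<psi> x - indicator ?U x\<bar> \<le>
          (\<Sum>i<n. \<bar>\<eta> i x - indicator (A i) x\<bar>) + \<bar>?s n x - indicator ?U x\<bar>" by simp
    qed
    also have "\<dots> = (\<Sum>i<n. l1_gap \<kappa> (\<eta> i) (A i)) + l1_gap \<kappa> (?s n) ?U"
      unfolding l1_gap_def using i1 i2 by simp
    also have "\<dots> < real n * \<delta> + \<epsilon>/2"
      using less sum_bounded_above[of "{..<n}" "\<lambda>i. l1_gap \<kappa> (\<eta> i) (A i)" \<delta>]
      by (intro add_le_less_mono) (auto simp: less_imp_le)
    also have "\<dots> \<le> \<epsilon>" using \<delta> by simp
    finally show ?thesis .
  qed
  show "\<exists>\<eta>. unit_lipschitz Z \<eta> \<and> l1_gap \<mu> \<eta> ?U < \<epsilon> \<and> l1_gap \<nu> \<eta> ?U < \<epsilon>"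
    by (intro exI[of _ \<psi>] conjI \<psi> bound[OF \<mu> \<eta>(2) n(1)] bound[OF \<nu> \<eta>(3) n(2)])
qed

text \<open>
  The open sets form an intersection-stable generator, so
  it is enough to treat open sets, complements and disjoint unions.
\<close>

lemma approximable_borel:
  assumes \<mu>: "finite_measure \<mu>" "sets \<mu> = sets (borel_of_metric Z)"
    and \<nu>: "finite_measure \<nu>" "sets \<nu> = sets (borel_of_metric Z)"
    and A: "A \<in> sets (borel_of_metric Z)"
  shows "approximable Z \<mu> \<nu> A"
proof (rule sigma_sets_induct_disjoint[of "{U. openin (mtopology_of Z) U}" "mspace Z" A])
  show "Int_stable {U. openin (mtopology_of Z) U}" by (auto simp: Int_stable_def)
  show "{U. openin (mtopology_of Z) U} \<subseteq> Pow (mspace Z)" by (auto dest: openin_subset_mspace)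
  show "A \<in> sigma_sets (mspace Z) {U. openin (mtopology_of Z) U}" using A by (simp add: sets_borel_of_metric)
  show "approximable Z \<mu> \<nu> U" if "U \<in> {U. openin (mtopology_of Z) U}" for U
    using that by (intro approximable_openin[OF \<mu> \<nu>]) simp
  show "approximable Z \<mu> \<nu> {}" by (intro approximable_openin[OF \<mu> \<nu>]) simp
  show "approximable Z \<mu> \<nu> (mspace Z - B)" if "approximable Z \<mu> \<nu> B" for B
    by (rule approximable_compl[OF space_eq_mspace[OF \<mu>(2)] space_eq_mspace[OF \<nu>(2)] that])
  show "approximable Z \<mu> \<nu> (\<Union>i. B i)"
    if "disjoint_family B" "range B \<subseteq> sigma_sets (mspace Z) {U. openin (mtopology_of Z) U}"
      "\<And>i. approximable Z \<mu> \<nu> (B i)" for B :: "nat \<Rightarrow> 'a set"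
    using that(2) by (intro approximable_UN[OF \<mu> \<nu> that(1) _ that(3)]) (auto simp: sets_borel_of_metric)
qed

section \<open>The mass measure\<close>

lemma test_formsD:
  assumes "(f, \<pi>) \<in> test_forms m Z"
  shows "lipschitz_fun Z f" "bounded (f ` mspace Z)" "length \<pi> = m"
    "\<And>p. p \<in> set \<pi> \<Longrightarrow> lipschitz_fun Z p"
  using assms by (auto simp: test_forms_def)

lemma test_forms_change_fun:
  assumes "(f, \<pi>) \<in> test_forms m Z" "lipschitz_fun Z g" "bounded (g ` mspace Z)"
  shows "(g, \<pi>) \<in> test_forms m Z"
  using assms by (auto simp: test_forms_def)

lemma test_forms_unit_mult:
  assumes "(f, \<pi>) \<in> test_forms m Z" "unit_lipschitz Z \<eta>"
  shows "(\<lambda>x. \<eta> x * f x, \<pi>) \<in> test_forms m Z"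
proof (rule test_forms_change_fun[OF assms(1)])
  note f = test_formsD(1,2)[OF assms(1)]
  show "lipschitz_fun Z (\<lambda>x. \<eta> x * f x)"
    using f assms(2) unit_lipschitz_bounded[OF assms(2)]
    by (intro lipschitz_fun_mult) (auto simp: unit_lipschitz_def)
  obtain B where B: "0 \<le> B" "\<forall>x\<in>mspace Z. \<bar>f x\<bar> \<le> B" using f by (auto simp: bounded_image_iff)
  have "\<bar>\<eta> x * f x\<bar> \<le> 1 * B" if "x \<in> mspace Z" for x
    unfolding abs_mult using B that assms(2) by (intro mult_mono) (auto simp: unit_lipschitz_def)
  then show "bounded ((\<lambda>x. \<eta> x * f x) ` mspace Z)"
    using B(1) unfolding bounded_image_iff by (intro exI[of _ B]) auto
qed

lemma prod_list_nonneg: "(\<And>x. x \<in> set xs \<Longrightarrow> (0::real) \<le> x) \<Longrightarrow> 0 \<le> prod_list xs"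
  by (induction xs) auto

lemma prod_lip_nonneg: "(f, \<pi>) \<in> test_forms m Z \<Longrightarrow> 0 \<le> prod_list (map (lip Z) \<pi>)"
  by (rule prod_list_nonneg) (auto simp: test_forms_def lip_nonneg)

lemma mass_boundD:
  assumes "mass_bound m Z T \<mu>"
  shows "finite_measure \<mu>" "sets \<mu> = sets (borel_of_metric Z)" "space \<mu> = mspace Z"
    "\<And>f \<pi>. (f, \<pi>) \<in> test_forms m Z \<Longrightarrow> \<bar>T f \<pi>\<bar> \<le> prod_list (map (lip Z) \<pi>) * (LINT x|\<mu>. \<bar>f x\<bar>)"
proof -
  show "sets \<mu> = sets (borel_of_metric Z)" using assms by (simp add: mass_bound_def)
  then show "space \<mu> = mspace Z" by (rule space_eq_mspace)
  show "finite_measure \<mu>" using assms by (simp add: mass_bound_def)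
  fix f \<pi> assume "(f, \<pi>) \<in> test_forms m Z"
  then show "\<bar>T f \<pi>\<bar> \<le> prod_list (map (lip Z) \<pi>) * (LINT x|\<mu>. \<bar>f x\<bar>)"
    using assms unfolding mass_bound_def by fast
qed

lemma mass_boundI:
  assumes "finite_measure \<mu>" "sets \<mu> = sets (borel_of_metric Z)"
    "\<And>f \<pi>. (f, \<pi>) \<in> test_forms m Z \<Longrightarrow> \<bar>T f \<pi>\<bar> \<le> prod_list (map (lip Z) \<pi>) * (LINT x|\<mu>. \<bar>f x\<bar>)"
  shows "mass_bound m Z T \<mu>"
  using assms by (auto simp: mass_bound_def)

text \<open>
  The only consequence of linearity that the theory of the mass measure uses. It is isolated because
  it holds for a parametrised piece \<open>param_current\<close> directly, even where the integrand fails to be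
  integrable and the integral takes its default value \<open>0\<close>.
\<close>

definition splittable :: "nat \<Rightarrow> 'a metric \<Rightarrow> 'a functional \<Rightarrow> bool" where
  "splittable m Z T \<longleftrightarrow> (\<forall>f \<pi> \<eta>. (f, \<pi>) \<in> test_forms m Z \<longrightarrow> unit_lipschitz Z \<eta> \<longrightarrow>
     \<bar>T f \<pi>\<bar> \<le> \<bar>T (\<lambda>x. \<eta> x * f x) \<pi>\<bar> + \<bar>T (\<lambda>x. (1 - \<eta> x) * f x) \<pi>\<bar>)"

lemma multilinear_fun:
  "multilinear m Z T \<Longrightarrow> (f, \<pi>) \<in> test_forms m Z \<Longrightarrow> (g, \<pi>) \<in> test_forms m Z \<Longrightarrow>
     T (\<lambda>x. a * f x + b * g x) \<pi> = a * T f \<pi> + b * T g \<pi>"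
  unfolding multilinear_def by simp

lemma multilinear_splittable:
  assumes "multilinear m Z T"
  shows "splittable m Z T"
  unfolding splittable_def
proof (intro allI impI)
  fix f \<pi> \<eta> assume f: "(f, \<pi>) \<in> test_forms m Z" and \<eta>: "unit_lipschitz Z \<eta>"
  have "T (\<lambda>x. 1 * (\<eta> x * f x) + 1 * ((1 - \<eta> x) * f x)) \<pi> =
      1 * T (\<lambda>x. \<eta> x * f x) \<pi> + 1 * T (\<lambda>x. (1 - \<eta> x) * f x) \<pi>"
    by (rule multilinear_fun[OF assms]) (intro test_forms_unit_mult[OF f] \<eta> unit_lipschitz_compl)+
  then have "T f \<pi> = T (\<lambda>x. \<eta> x * f x) \<pi> + T (\<lambda>x. (1 - \<eta> x) * f x) \<pi>"
    by (simp add: algebra_simps)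
  then show "\<bar>T f \<pi>\<bar> \<le> \<bar>T (\<lambda>x. \<eta> x * f x) \<pi>\<bar> + \<bar>T (\<lambda>x. (1 - \<eta> x) * f x) \<pi>\<bar>" by simp
qed

text \<open>
  Choose a Lipschitz \<open>\<eta>\<close> that approximates the indicator of \<open>A\<close> for both measures, and estimate the form
  \<open>\<eta> * f\<close> with \<open>\<mu>\<close> and the form \<open>(1 - \<eta>) * f\<close> with \<open>\<nu>\<close>.
\<close>

lemma mass_bound_split:
  assumes split: "splittable m Z T" and \<mu>: "mass_bound m Z T \<mu>" and \<nu>: "mass_bound m Z T \<nu>"
    and A: "A \<in> sets (borel_of_metric Z)" and f: "(f, \<pi>) \<in> test_forms m Z"
  shows "\<bar>T f \<pi>\<bar> \<le> prod_list (map (lip Z) \<pi>) *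
    ((LINT x|\<mu>. \<bar>f x\<bar> * indicator A x) + (LINT x|\<nu>. \<bar>f x\<bar> * indicator (mspace Z - A) x))"
    (is "_ \<le> ?\<Lambda> * (?I + ?J)")
proof (rule field_le_epsilon)
  fix e :: real assume e: "e > 0"
  have \<Lambda>: "0 \<le> ?\<Lambda>" using f by (rule prod_lip_nonneg)
  obtain B where B: "0 \<le> B" "\<And>x. x \<in> mspace Z \<Longrightarrow> \<bar>f x\<bar> \<le> B"
    using test_formsD(2)[OF f] by (auto simp: bounded_image_iff)
  define \<epsilon> where "\<epsilon> = e / (2 * ?\<Lambda> * B + 1)"
  have pos: "2 * ?\<Lambda> * B + 1 > 0" using \<Lambda> B(1) by (simp add: add_nonneg_pos)
  then have \<epsilon>: "\<epsilon> > 0" using e by (simp add: \<epsilon>_def)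
  obtain \<eta> where \<eta>: "unit_lipschitz Z \<eta>" "l1_gap \<mu> \<eta> A < \<epsilon>" "l1_gap \<nu> \<eta> A < \<epsilon>"
    using approximable_borel[OF mass_boundD(1,2)[OF \<mu>] mass_boundD(1,2)[OF \<nu>] A] \<epsilon>
    unfolding approximable_def by auto
  have main: "(LINT x|\<kappa>. \<bar>\<psi> x * f x\<bar>) \<le> (LINT x|\<kappa>. \<bar>f x\<bar> * indicator C x) + B * \<epsilon>"
    if \<kappa>: "mass_bound m Z T \<kappa>" and \<psi>: "unit_lipschitz Z \<psi>" and C: "C \<in> sets (borel_of_metric Z)"
      and le: "l1_gap \<kappa> \<psi> C < \<epsilon>" for \<kappa> \<psi> C
  proof -
    note \<kappa>' = mass_boundD[OF \<kappa>]
    interpret finite_measure \<kappa> by (rule \<kappa>'(1))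
    have i\<psi>: "integrable \<kappa> \<psi>" using \<psi> unit_lipschitz_bounded[OF \<psi>]
      by (intro bounded_lipschitz_integrable[OF \<kappa>'(1,2)]) (auto simp: unit_lipschitz_def)
    have iC: "integrable \<kappa> (indicator C :: _ \<Rightarrow> real)"
      using C \<kappa>'(2) by (intro integrable_real_indicator) (auto simp: emeasure_finite top.not_eq_extremum[symmetric])
    have if': "integrable \<kappa> f"
      by (rule bounded_lipschitz_integrable[OF \<kappa>'(1,2) test_formsD(1,2)[OF f]])
    have i1: "integrable \<kappa> (\<lambda>x. \<bar>f x\<bar> * indicator C x)"
      using C \<kappa>'(2) if' by (intro integrable_real_mult_indicator integrable_abs) auto
    have i2: "integrable \<kappa> (\<lambda>x. B * \<bar>\<psi> x - indicator C x\<bar>)"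
      using i\<psi> iC by (intro integrable_mult_right integrable_abs Bochner_Integration.integrable_diff)
    have i3: "integrable \<kappa> (\<lambda>x. \<bar>\<psi> x * f x\<bar>)"
      using test_formsD(1,2)[OF test_forms_unit_mult[OF f \<psi>]]
      by (intro integrable_abs bounded_lipschitz_integrable[OF \<kappa>'(1,2)]) auto
    have "(LINT x|\<kappa>. \<bar>\<psi> x * f x\<bar>) \<le> (LINT x|\<kappa>. \<bar>f x\<bar> * indicator C x + B * \<bar>\<psi> x - indicator C x\<bar>)"
    proof (rule integral_mono[OF i3])
      show "integrable \<kappa> (\<lambda>x. \<bar>f x\<bar> * indicator C x + B * \<bar>\<psi> x - indicator C x\<bar>)"
        using i1 i2 by (rule Bochner_Integration.integrable_add)
      fix x assume "x \<in> space \<kappa>"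
      then have x: "\<bar>f x\<bar> \<le> B" using B(2) \<kappa>'(3) by simp
      have "\<bar>\<psi> x * f x\<bar> = \<bar>f x\<bar> * indicator C x + \<bar>f x\<bar> * (\<psi> x - indicator C x)"
        using \<psi> by (auto simp: unit_lipschitz_def abs_mult algebra_simps)
      also have "\<bar>f x\<bar> * (\<psi> x - indicator C x) \<le> \<bar>f x\<bar> * \<bar>\<psi> x - indicator C x\<bar>"
        by (intro mult_left_mono) auto
      also have "\<dots> \<le> B * \<bar>\<psi> x - indicator C x\<bar>" using x by (intro mult_right_mono) auto
      finally show "\<bar>\<psi> x * f x\<bar> \<le> \<bar>f x\<bar> * indicator C x + B * \<bar>\<psi> x - indicator C x\<bar>" by simp
    qed
    also have "\<dots> = (LINT x|\<kappa>. \<bar>f x\<bar> * indicator C x) + B * l1_gap \<kappa> \<psi> C"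
      using i1 i2 by (simp add: l1_gap_def)
    also have "\<dots> \<le> (LINT x|\<kappa>. \<bar>f x\<bar> * indicator C x) + B * \<epsilon>"
      using le B(1) by (intro add_left_mono mult_left_mono) auto
    finally show ?thesis .
  qed
  have eq: "l1_gap \<nu> (\<lambda>x. 1 - \<eta> x) (mspace Z - A) = l1_gap \<nu> \<eta> A"
    unfolding l1_gap_def using mass_boundD(3)[OF \<nu>] by (intro Bochner_Integration.integral_cong) (auto simp: indicator_def)
  have Ac: "mspace Z - A \<in> sets (borel_of_metric Z)"
    using A sets.compl_sets[of A "borel_of_metric Z"] by simp
  have "\<bar>T f \<pi>\<bar> \<le> \<bar>T (\<lambda>x. \<eta> x * f x) \<pi>\<bar> + \<bar>T (\<lambda>x. (1 - \<eta> x) * f x) \<pi>\<bar>"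
    using split f \<eta>(1) by (simp add: splittable_def)
  also have "\<dots> \<le> ?\<Lambda> * (LINT x|\<mu>. \<bar>\<eta> x * f x\<bar>) + ?\<Lambda> * (LINT x|\<nu>. \<bar>(1 - \<eta> x) * f x\<bar>)"
    by (intro add_mono mass_boundD(4)[OF \<mu>] mass_boundD(4)[OF \<nu>] test_forms_unit_mult[OF f]
        unit_lipschitz_compl \<eta>(1))
  also have "\<dots> \<le> ?\<Lambda> * (?I + B * \<epsilon>) + ?\<Lambda> * (?J + B * \<epsilon>)"
    using main[OF \<mu> \<eta>(1) A \<eta>(2)] main[OF \<nu> unit_lipschitz_compl[OF \<eta>(1)] Ac] \<eta>(3) \<Lambda>
    by (intro add_mono mult_left_mono) (auto simp: eq)
  also have "\<dots> = ?\<Lambda> * (?I + ?J) + (2 * ?\<Lambda> * B) * \<epsilon>" by (simp add: algebra_simps)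
  also have "(2 * ?\<Lambda> * B) * \<epsilon> \<le> (2 * ?\<Lambda> * B + 1) * \<epsilon>" using \<epsilon> by (intro mult_right_mono) auto
  also have "\<dots> = e" using pos by (simp add: \<epsilon>_def)
  finally show "\<bar>T f \<pi>\<bar> \<le> ?\<Lambda> * (?I + ?J) + e" by simp
qed

text \<open>
  Fix one mass bound \<open>\<mu>\<close> and consider the densities \<open>h\<close> for which \<open>h\<mu>\<close> is a mass bound. By
  \<open>mass_bound_split\<close>, applied to the set where one density is below another, they are closed under
  minima, and by dominated convergence under decreasing limits. A minimising sequence for the total
  mass thus has a limit \<open>l\<close>, and the minimum of \<open>l\<close> with any further density cannot have smaller
  total mass. An arbitrary mass bound \<open>\<nu>\<close> is compared with \<open>l\<mu>\<close> through the minimum of \<open>\<mu>\<close> and \<open>\<nu>\<close>,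
  which has a density by the theorems of Hahn and Radon-Nikodym.
\<close>

theorem least_mass_bound_exists:
  assumes split: "splittable m Z T" and \<mu>: "mass_bound m Z T \<mu>"
  shows "\<exists>\<kappa>. mass_bound m Z T \<kappa> \<and>
    (\<forall>\<nu>. mass_bound m Z T \<nu> \<longrightarrow> (\<forall>B\<in>sets (borel_of_metric Z). emeasure \<kappa> B \<le> emeasure \<nu> B))"
proof -
  interpret \<mu>: finite_measure \<mu> by (rule mass_boundD(1)[OF \<mu>])
  note sets\<mu> = mass_boundD(2)[OF \<mu>] and space\<mu> = mass_boundD(3)[OF \<mu>]
  define H where "H = {h :: 'a \<Rightarrow> real. h \<in> borel_measurable \<mu> \<and> (\<forall>x. 0 \<le> h x) \<and> integrable \<mu> h \<and>
    (\<forall>f \<pi>. (f, \<pi>) \<in> test_forms m Z \<longrightarrow>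
       \<bar>T f \<pi>\<bar> \<le> prod_list (map (lip Z) \<pi>) * (LINT x|\<mu>. h x * \<bar>f x\<bar>))}"
  have HD: "h \<in> borel_measurable \<mu>" "\<And>x. 0 \<le> h x" "integrable \<mu> h"
    "\<And>f \<pi>. (f, \<pi>) \<in> test_forms m Z \<Longrightarrow> \<bar>T f \<pi>\<bar> \<le> prod_list (map (lip Z) \<pi>) * (LINT x|\<mu>. h x * \<bar>f x\<bar>)"
    if "h \<in> H" for h using that by (auto simp: H_def)
  have fmeas: "f \<in> borel_measurable \<mu>" if "(f, \<pi>) \<in> test_forms m Z" for f \<pi>
    using lipschitz_measurable_sets[OF sets\<mu> test_formsD(1)[OF that]] .
  have ih: "integrable \<mu> (\<lambda>x. h x * \<bar>f x\<bar>)" if hh: "h \<in> borel_measurable \<mu>" "\<And>x. 0 \<le> h x" "integrable \<mu> h"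
    "(f, \<pi>) \<in> test_forms m Z" for h f \<pi>
  proof -
    obtain B where B: "0 \<le> B" "\<And>x. x \<in> mspace Z \<Longrightarrow> \<bar>f x\<bar> \<le> B"
      using test_formsD(2)[OF hh(4)] by (auto simp: bounded_image_iff)
    show ?thesis
    proof (rule Bochner_Integration.integrable_bound)
      show "integrable \<mu> (\<lambda>x. B * h x)" using hh by simp
      show "(\<lambda>x. h x * \<bar>f x\<bar>) \<in> borel_measurable \<mu>" using hh fmeas[OF hh(4)] by auto
      show "AE x in \<mu>. norm (h x * \<bar>f x\<bar>) \<le> norm (B * h x)"
        using B hh(2) by (intro AE_I2) (auto simp: space\<mu> abs_mult mult.commute[of B] intro!: mult_left_mono)
    qed
  qed
  have density_bound: "mass_bound m Z T (density \<mu> h)" if "h \<in> H" for h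
  proof (rule mass_boundI)
    note h = HD[OF that]
    show "finite_measure (density \<mu> h)"
    proof (rule finite_measureI)
      have "emeasure (density \<mu> h) (space (density \<mu> h)) = (\<integral>\<^sup>+x. ennreal (h x) \<partial>\<mu>)"
        using h(1) by (simp add: emeasure_density cong: nn_integral_cong)
      also have "\<dots> < \<infinity>"
        using h by (simp add: nn_integral_eq_integral)
      finally show "emeasure (density \<mu> h) (space (density \<mu> h)) \<noteq> \<infinity>" by simp
    qed
    show "sets (density \<mu> h) = sets (borel_of_metric Z)" by (simp add: sets\<mu>)
    fix f \<pi> assume f: "(f, \<pi>) \<in> test_forms m Z"
    have "(LINT x|density \<mu> h. \<bar>f x\<bar>) = (LINT x|\<mu>. h x * \<bar>f x\<bar>)"
      using h fmeas[OF f] by (subst integral_density) auto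
    then show "\<bar>T f \<pi>\<bar> \<le> prod_list (map (lip Z) \<pi>) * (LINT x|density \<mu> h. \<bar>f x\<bar>)"
      using h(4)[OF f] by simp
  qed
  have one: "(\<lambda>_. 1) \<in> H" using mass_boundD(4)[OF \<mu>] by (simp add: H_def)
  have minH: "(\<lambda>x. min (g x) (h x)) \<in> H" if g: "g \<in> H" and h: "h \<in> H" for g h
  proof -
    note g' = HD[OF g] and h' = HD[OF h]
    let ?A = "{x \<in> space \<mu>. g x \<le> h x}"
    have A\<mu>: "?A \<in> sets \<mu>" using g'(1) h'(1) by measurable
    have A: "?A \<in> sets (borel_of_metric Z)" using A\<mu> sets\<mu> by simp
    have "\<bar>T f \<pi>\<bar> \<le> prod_list (map (lip Z) \<pi>) * (LINT x|\<mu>. min (g x) (h x) * \<bar>f x\<bar>)"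
      if f: "(f, \<pi>) \<in> test_forms m Z" for f \<pi>
    proof -
      have 1: "(LINT x|density \<mu> g. \<bar>f x\<bar> * indicator ?A x) = (LINT x|\<mu>. g x * \<bar>f x\<bar> * indicator ?A x)"
        using g' fmeas[OF f] A\<mu> by (subst integral_density) (auto simp: mult.assoc)
      have 2: "(LINT x|density \<mu> h. \<bar>f x\<bar> * indicator (mspace Z - ?A) x) =
          (LINT x|\<mu>. h x * \<bar>f x\<bar> * indicator (mspace Z - ?A) x)"
        using h' fmeas[OF f] A\<mu> space\<mu>[symmetric] by (subst integral_density) (auto simp: mult.assoc)
      have "(LINT x|\<mu>. g x * \<bar>f x\<bar> * indicator ?A x) + (LINT x|\<mu>. h x * \<bar>f x\<bar> * indicator (mspace Z - ?A) x)
        = (LINT x|\<mu>. g x * \<bar>f x\<bar> * indicator ?A x + h x * \<bar>f x\<bar> * indicator (mspace Z - ?A) x)"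
        using A\<mu> space\<mu>[symmetric] ih[OF g'(1-3) f] ih[OF h'(1-3) f]
        by (intro Bochner_Integration.integral_add[symmetric] integrable_real_mult_indicator) auto
      also have "\<dots> = (LINT x|\<mu>. min (g x) (h x) * \<bar>f x\<bar>)"
        by (intro Bochner_Integration.integral_cong) (auto simp: space\<mu> indicator_def min_def)
      finally show ?thesis
        using mass_bound_split[OF split density_bound[OF g] density_bound[OF h] A f] 1 2 by simp
    qed
    then show ?thesis using g' h' by (auto simp: H_def)
  qed
  define c where "c = Inf ((\<lambda>h. LINT x|\<mu>. h x) ` H)"
  have bdd: "bdd_below ((\<lambda>h. LINT x|\<mu>. h x) ` H)"
  proof (rule bdd_belowI2[where m=0])
    fix h assume "h \<in> H"
    from HD(2)[OF this] show "0 \<le> (LINT x|\<mu>. h x)" by (rule Bochner_Integration.integral_nonneg)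
  qed
  have c_le: "c \<le> (LINT x|\<mu>. h x)" if "h \<in> H" for h
    unfolding c_def using bdd that by (intro cINF_lower)
  have "\<exists>h\<in>H. (LINT x|\<mu>. h x) < c + 1 / real (Suc n)" for n
  proof -
    have "c < c + 1 / real (Suc n)" by simp
    then show ?thesis
      unfolding c_def using one bdd by (subst (asm) cINF_less_iff) auto
  qed
  then obtain h where h: "\<And>n. h n \<in> H" "\<And>n. (LINT x|\<mu>. h n x) < c + 1 / real (Suc n)"
    by metis
  define k where "k = rec_nat (h 0) (\<lambda>n g x. min (g x) (h (Suc n) x))"
  have k0: "k 0 = h 0" and kS: "k (Suc n) = (\<lambda>x. min (k n x) (h (Suc n) x))" for n
    by (simp_all add: k_def)
  have kH: "k n \<in> H" for n by (induction n) (auto simp: k0 kS intro: minH h)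
  have dec: "decseq (\<lambda>n. k n x)" for x by (rule decseq_SucI) (simp add: kS)
  have kh: "k n x \<le> h n x" for n x by (cases n) (auto simp: k0 kS)
  have "convergent (\<lambda>n. k n x)" for x
    using decseq_convergent[OF dec[of x], of 0] HD(2)[OF kH] by (metis convergent_def)
  then obtain l where l: "\<And>x. (\<lambda>n. k n x) \<longlonglongrightarrow> l x"
    unfolding convergent_def by metis
  have l0: "0 \<le> l x" for x by (rule LIMSEQ_le_const[OF l]) (auto intro: HD(2)[OF kH])
  have lk: "l x \<le> k n x" for n x using decseq_ge[OF dec l] .
  have lm: "l \<in> borel_measurable \<mu>" by (rule borel_measurable_LIMSEQ_real[OF l]) (rule HD(1)[OF kH])
  have li: "integrable \<mu> l"
    using HD(2)[OF kH[of 0]] l0 lk[of _ 0]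
    by (intro Bochner_Integration.integrable_bound[OF HD(3)[OF kH[of 0]] lm] AE_I2) auto
  have "\<bar>T f \<pi>\<bar> \<le> prod_list (map (lip Z) \<pi>) * (LINT x|\<mu>. l x * \<bar>f x\<bar>)"
    if f: "(f, \<pi>) \<in> test_forms m Z" for f \<pi>
  proof -
    have "(\<lambda>n. LINT x|\<mu>. k n x * \<bar>f x\<bar>) \<longlonglongrightarrow> (LINT x|\<mu>. l x * \<bar>f x\<bar>)"
    proof (rule integral_dominated_convergence[where w="\<lambda>x. k 0 x * \<bar>f x\<bar>"])
      show "integrable \<mu> (\<lambda>x. k 0 x * \<bar>f x\<bar>)" by (rule ih[OF HD(1-3)[OF kH] f])
      show "(\<lambda>x. l x * \<bar>f x\<bar>) \<in> borel_measurable \<mu>" using lm fmeas[OF f] by auto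
      show "(\<lambda>x. k n x * \<bar>f x\<bar>) \<in> borel_measurable \<mu>" for n using HD(1)[OF kH[of n]] fmeas[OF f] by auto
      show "AE x in \<mu>. (\<lambda>n. k n x * \<bar>f x\<bar>) \<longlonglongrightarrow> l x * \<bar>f x\<bar>"
        by (intro AE_I2 tendsto_mult l tendsto_const)
      show "AE x in \<mu>. norm (k n x * \<bar>f x\<bar>) \<le> k 0 x * \<bar>f x\<bar>" for n
        using HD(2)[OF kH[of n]] decseqD[OF dec, of 0 n]
        by (intro AE_I2) (auto simp: abs_mult intro!: mult_right_mono)
    qed
    then have "(\<lambda>n. prod_list (map (lip Z) \<pi>) * (LINT x|\<mu>. k n x * \<bar>f x\<bar>)) \<longlonglongrightarrow>
        prod_list (map (lip Z) \<pi>) * (LINT x|\<mu>. l x * \<bar>f x\<bar>)"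
      by (intro tendsto_mult tendsto_const)
    then show ?thesis
      by (rule LIMSEQ_le_const) (auto intro: HD(4)[OF kH f])
  qed
  then have lH: "l \<in> H" using lm li l0 by (auto simp: H_def)
  have lc: "(LINT x|\<mu>. l x) \<le> c"
  proof (rule LIMSEQ_le_const)
    show "(\<lambda>n. c + 1 / real (Suc n)) \<longlonglongrightarrow> c"
      using tendsto_add[OF tendsto_const lim_1_over_n[THEN LIMSEQ_Suc], of c] by simp
    have "(LINT x|\<mu>. l x) \<le> c + 1 / real (Suc n)" for n
    proof -
      have "(LINT x|\<mu>. l x) \<le> (LINT x|\<mu>. h n x)"
        using order_trans[OF lk kh] by (intro integral_mono li HD(3)[OF h(1)])
      then show ?thesis using h(2)[of n] by simp
    qed
    then show "\<exists>N. \<forall>n\<ge>N. (LINT x|\<mu>. l x) \<le> c + 1 / real (Suc n)" by blast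
  qed
  have least: "emeasure (density \<mu> l) B \<le> emeasure \<nu> B"
    if \<nu>: "mass_bound m Z T \<nu>" and B: "B \<in> sets (borel_of_metric Z)" for \<nu> B
  proof -
    interpret \<nu>: finite_measure \<nu> by (rule mass_boundD(1)[OF \<nu>])
    note sets\<nu> = mass_boundD(2)[OF \<nu>] and space\<nu> = mass_boundD(3)[OF \<nu>]
    have fmeas\<nu>: "f \<in> borel_measurable \<nu>" if "(f, \<pi>) \<in> test_forms m Z" for f \<pi>
      using lipschitz_measurable_sets[OF sets\<nu> test_formsD(1)[OF that]] .
    (* Y is where \<nu> is the smaller of the two measures, so the minimum of \<mu> and \<nu> is \<nu> on Y
       and \<mu> elsewhere; its density with respect to \<mu> is the function h' below. *)
    obtain Y where Y: "Y \<in> sets \<mu>" and Y1: "\<And>X. X \<in> sets \<mu> \<Longrightarrow> X \<subseteq> Y \<Longrightarrow> \<nu> X \<le> \<mu> X"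
      and Y2: "\<And>X. X \<in> sets \<mu> \<Longrightarrow> X \<inter> Y = {} \<Longrightarrow> \<mu> X \<le> \<nu> X"
      using finite_unsigned_Hahn_decomposition[OF mass_boundD(1)[OF \<mu>] mass_boundD(1)[OF \<nu>]] sets\<mu> sets\<nu>
      by auto
    have Y\<nu>: "Y \<in> sets \<nu>" using Y sets\<mu> sets\<nu> by simp
    let ?N = "density \<nu> (indicator Y :: 'a \<Rightarrow> ennreal)"
    have N: "emeasure ?N X = emeasure \<nu> (X \<inter> Y)" if "X \<in> sets \<mu>" for X
      using that Y\<nu> sets\<mu> sets\<nu>
      by (subst emeasure_density) (auto simp: Int_commute simp flip: indicator_inter_arith)
    have ac: "absolutely_continuous \<mu> ?N"
      unfolding absolutely_continuous_def
    proof
      fix X assume X: "X \<in> null_sets \<mu>"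
      then have "emeasure \<nu> (X \<inter> Y) \<le> emeasure \<mu> (X \<inter> Y)" using Y by (intro Y1) auto
      also have "\<dots> \<le> emeasure \<mu> X" using X by (intro emeasure_mono) auto
      finally show "X \<in> null_sets ?N" using X N[of X] sets\<mu> sets\<nu> by (auto simp: null_sets_def)
    qed
    have setsN: "sets ?N = sets \<mu>" using sets\<mu> sets\<nu> by simp
    have finN: "finite_measure ?N"
    proof (rule finite_measureI)
      show "emeasure ?N (space ?N) \<noteq> \<infinity>"
        using N[OF sets.top] \<nu>.emeasure_finite by (simp add: space\<mu> space\<nu>)
    qed
    obtain D where D: "D \<in> borel_measurable \<mu>" "AE x in \<mu>. RN_deriv \<mu> ?N x = ennreal (D x)" "\<And>x. 0 \<le> D x"
      using \<mu>.real_RN_deriv[OF finN ac setsN] by metis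
    have ND: "density \<mu> (\<lambda>x. ennreal (D x)) = ?N"
    proof -
      have "density \<mu> (\<lambda>x. ennreal (D x)) = density \<mu> (RN_deriv \<mu> ?N)"
        using D by (intro density_cong) auto
      then show ?thesis using \<mu>.density_RN_deriv[OF ac setsN] by simp
    qed
    define h' where "h' x = (if x \<in> Y then D x else 1)" for x
    have h'0: "0 \<le> h' x" for x using D(3) by (simp add: h'_def)
    have h'm: "h' \<in> borel_measurable \<mu>" unfolding h'_def using D(1) Y by measurable
    have Di: "integrable \<mu> D"
    proof (rule integrableI_nonneg[OF D(1)])
      show "AE x in \<mu>. 0 \<le> D x" using D(3) by simp
      have "(\<integral>\<^sup>+x. ennreal (D x) \<partial>\<mu>) = emeasure (density \<mu> (\<lambda>x. ennreal (D x))) (space \<mu>)"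
        using D(1) by (subst emeasure_density) (auto intro!: nn_integral_cong)
      also have "\<dots> < \<infinity>" using N[OF sets.top] by (simp add: ND \<nu>.emeasure_finite less_top[symmetric])
      finally show "(\<integral>\<^sup>+x. ennreal (D x) \<partial>\<mu>) < \<infinity>" .
    qed
    have h'i: "integrable \<mu> h'"
    proof (rule Bochner_Integration.integrable_bound[OF _ h'm])
      show "integrable \<mu> (\<lambda>x. D x + 1)" using Di by simp
      show "AE x in \<mu>. norm (h' x) \<le> norm (D x + 1)" using D(3) by (auto simp: h'_def)
    qed
    have "\<bar>T f \<pi>\<bar> \<le> prod_list (map (lip Z) \<pi>) * (LINT x|\<mu>. h' x * \<bar>f x\<bar>)"
      if f: "(f, \<pi>) \<in> test_forms m Z" for f \<pi>
    proof -
      have "(LINT x|\<nu>. \<bar>f x\<bar> * indicator Y x) = (LINT x|density \<nu> (\<lambda>x. ennreal (indicator Y x)). \<bar>f x\<bar> * indicator Y x)"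
        using fmeas\<nu>[OF f] Y\<nu> by (subst integral_density) (auto simp: indicator_def intro!: Bochner_Integration.integral_cong)
      also have "density \<nu> (\<lambda>x. ennreal (indicator Y x)) = density \<mu> (\<lambda>x. ennreal (D x))"
        by (simp add: ND ennreal_indicator)
      also have "(LINT x|density \<mu> (\<lambda>x. ennreal (D x)). \<bar>f x\<bar> * indicator Y x) = (LINT x|\<mu>. D x * \<bar>f x\<bar> * indicator Y x)"
        using D fmeas[OF f] Y by (subst integral_density) (auto simp: mult.assoc)
      finally have "(LINT x|\<nu>. \<bar>f x\<bar> * indicator Y x) + (LINT x|\<mu>. \<bar>f x\<bar> * indicator (mspace Z - Y) x) =
          (LINT x|\<mu>. D x * \<bar>f x\<bar> * indicator Y x) + (LINT x|\<mu>. 1 * \<bar>f x\<bar> * indicator (mspace Z - Y) x)"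
        by simp
      also have "\<dots> = (LINT x|\<mu>. D x * \<bar>f x\<bar> * indicator Y x + 1 * \<bar>f x\<bar> * indicator (mspace Z - Y) x)"
        using Y space\<mu>[symmetric] ih[OF D(1,3) Di f] ih[OF HD(1-3)[OF one] f]
        by (intro Bochner_Integration.integral_add[symmetric] integrable_real_mult_indicator) auto
      also have "\<dots> = (LINT x|\<mu>. h' x * \<bar>f x\<bar>)"
        by (intro Bochner_Integration.integral_cong) (auto simp: space\<mu> indicator_def h'_def)
      finally show ?thesis
        using mass_bound_split[OF split \<nu> \<mu> _ f, of Y] Y sets\<mu> by simp
    qed
    then have h'H: "h' \<in> H" using h'0 h'm h'i by (auto simp: H_def)
    (* The minimum of l and h' is again admissible, so it cannot lower the total mass below c. *)
    have "(LINT x|\<mu>. l x - min (l x) (h' x)) = (LINT x|\<mu>. l x) - (LINT x|\<mu>. min (l x) (h' x))"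
      using HD(3)[OF minH[OF lH h'H]] li by simp
    also have "\<dots> \<le> 0" using lc c_le[OF minH[OF lH h'H]] by simp
    finally have "(LINT x|\<mu>. l x - min (l x) (h' x)) = 0"
      by (intro antisym Bochner_Integration.integral_nonneg) auto
    then have "AE x in \<mu>. l x - min (l x) (h' x) = 0"
      using HD(3)[OF minH[OF lH h'H]] li by (subst (asm) integral_nonneg_eq_0_iff_AE) auto
    then have lh': "AE x in \<mu>. l x \<le> h' x" by eventually_elim auto
    have B\<mu>: "B \<in> sets \<mu>" and B\<nu>: "B \<in> sets \<nu>" using B sets\<mu> sets\<nu> by auto
    have "emeasure (density \<mu> l) B = (\<integral>\<^sup>+x. ennreal (l x) * indicator B x \<partial>\<mu>)"
      using lm B\<mu> by (simp add: emeasure_density)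
    also have "\<dots> \<le> (\<integral>\<^sup>+x. ennreal (h' x) * indicator B x \<partial>\<mu>)"
      using lh' by (intro nn_integral_mono_AE) (auto elim!: eventually_mono intro!: mult_right_mono ennreal_leI)
    also have "\<dots> = (\<integral>\<^sup>+x. ennreal (D x) * indicator (B \<inter> Y) x + indicator (B - Y) x \<partial>\<mu>)"
      by (intro nn_integral_cong) (auto simp: h'_def indicator_def)
    also have "\<dots> = (\<integral>\<^sup>+x. ennreal (D x) * indicator (B \<inter> Y) x \<partial>\<mu>) + emeasure \<mu> (B - Y)"
      using D(1) B\<mu> Y by (subst nn_integral_add) auto
    also have "(\<integral>\<^sup>+x. ennreal (D x) * indicator (B \<inter> Y) x \<partial>\<mu>) = emeasure ?N (B \<inter> Y)"
      unfolding ND[symmetric] using D(1) B\<mu> Y by (subst emeasure_density) auto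
    also have "\<dots> = emeasure \<nu> (B \<inter> Y)" using N[of "B \<inter> Y"] B\<mu> Y by auto
    also have "emeasure \<nu> (B \<inter> Y) + emeasure \<mu> (B - Y) \<le> emeasure \<nu> (B \<inter> Y) + emeasure \<nu> (B - Y)"
      using B\<mu> Y by (intro add_left_mono Y2) auto
    also have "\<dots> = emeasure \<nu> B"
      using B\<nu> Y\<nu> by (subst plus_emeasure) (auto intro: arg_cong[where f="emeasure \<nu>"])
    finally show ?thesis .
  qed
  show ?thesis
    using density_bound[OF lH] least by blast
qed

lemma mass_measure_least:
  assumes "splittable m Z T" "has_finite_mass m Z T"
  shows "mass_bound m Z T (mass_measure m Z T)"
    "\<And>\<nu> B. mass_bound m Z T \<nu> \<Longrightarrow> B \<in> sets (borel_of_metric Z) \<Longrightarrow>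
       emeasure (mass_measure m Z T) B \<le> emeasure \<nu> B"
proof -
  let ?P = "\<lambda>\<kappa>. mass_bound m Z T \<kappa> \<and>
    (\<forall>\<nu>. mass_bound m Z T \<nu> \<longrightarrow> (\<forall>B\<in>sets (borel_of_metric Z). emeasure \<kappa> B \<le> emeasure \<nu> B))"
  obtain \<kappa> where \<kappa>: "?P \<kappa>"
    using assms least_mass_bound_exists unfolding has_finite_mass_def by blast
  have "\<kappa>' = \<kappa>" if \<kappa>': "?P \<kappa>'" for \<kappa>'
  proof (rule measure_eqI)
    show "sets \<kappa>' = sets \<kappa>" using \<kappa> \<kappa>' by (simp add: mass_bound_def)
    fix B assume "B \<in> sets \<kappa>'"
    then have "B \<in> sets (borel_of_metric Z)" using \<kappa>' by (simp add: mass_bound_def)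
    then show "emeasure \<kappa>' B = emeasure \<kappa> B" using \<kappa> \<kappa>' by (intro antisym) blast+
  qed
  then have "?P (mass_measure m Z T)"
    unfolding mass_measure_def using theI[of ?P, OF \<kappa>] by blast
  then show "mass_bound m Z T (mass_measure m Z T)"
    "\<And>\<nu> B. mass_bound m Z T \<nu> \<Longrightarrow> B \<in> sets (borel_of_metric Z) \<Longrightarrow>
       emeasure (mass_measure m Z T) B \<le> emeasure \<nu> B" by blast+
qed

lemma mass_le:
  assumes "splittable m Z T" "mass_bound m Z T \<nu>"
  shows "mass m Z T \<le> emeasure \<nu> (mspace Z)"
proof -
  have "has_finite_mass m Z T" using assms(2) by (auto simp: has_finite_mass_def)
  then show ?thesis
    using mass_measure_least(2)[OF assms(1) _ assms(2), of "mspace Z"]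
      sets.top[of "borel_of_metric Z"] by (simp add: mass_def)
qed

lemma mass_estimate:
  assumes "splittable m Z T" "has_finite_mass m Z T" "(f, \<pi>) \<in> test_forms m Z"
    "0 \<le> B" "\<And>x. x \<in> mspace Z \<Longrightarrow> \<bar>f x\<bar> \<le> B"
  shows "mass m Z T \<noteq> \<infinity>"
    and "\<bar>T f \<pi>\<bar> \<le> prod_list (map (lip Z) \<pi>) * (B * enn2real (mass m Z T))"
proof -
  note \<mu> = mass_measure_least(1)[OF assms(1,2)]
  interpret finite_measure "mass_measure m Z T" by (rule mass_boundD(1)[OF \<mu>])
  show "mass m Z T \<noteq> \<infinity>" using emeasure_finite assms(2) by (simp add: mass_def)
  have "(LINT x|mass_measure m Z T. \<bar>f x\<bar>) \<le> (LINT x|mass_measure m Z T. B)"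
    using assms(5) mass_boundD(3)[OF \<mu>]
    by (intro integral_mono integrable_abs integrable_const
        bounded_lipschitz_integrable[OF mass_boundD(1,2)[OF \<mu>]] test_formsD(1,2)[OF assms(3)]) auto
  also have "\<dots> = B * enn2real (mass m Z T)"
    using assms(2) mass_boundD(3)[OF \<mu>] by (simp add: mass_def measure_def mult.commute)
  finally have "(LINT x|mass_measure m Z T. \<bar>f x\<bar>) \<le> B * enn2real (mass m Z T)" .
  then show "\<bar>T f \<pi>\<bar> \<le> prod_list (map (lip Z) \<pi>) * (B * enn2real (mass m Z T))"
    using mass_boundD(4)[OF \<mu> assms(3)] mult_left_mono[OF _ prod_lip_nonneg[OF assms(3)]]
    by (meson order_trans)
qed

section \<open>Transporting functionals along partial isometries\<close>

definition isometric_on :: "'a metric \<Rightarrow> 'a set \<Rightarrow> 'b metric \<Rightarrow> ('a \<Rightarrow> 'b) \<Rightarrow> bool" where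
  "isometric_on Z Y W F \<longleftrightarrow> Y \<subseteq> mspace Z \<and> (\<forall>y\<in>Y. F y \<in> mspace W) \<and>
     (\<forall>x\<in>Y. \<forall>y\<in>Y. mdist W (F x) (F y) = mdist Z x y)"

lemma isometric_onD:
  assumes "isometric_on Z Y W F"
  shows "Y \<subseteq> mspace Z" "\<And>y. y \<in> Y \<Longrightarrow> F y \<in> mspace W"
    "\<And>x y. x \<in> Y \<Longrightarrow> y \<in> Y \<Longrightarrow> mdist W (F x) (F y) = mdist Z x y"
  using assms by (auto simp: isometric_on_def)

lemma isometric_on_inj:
  assumes "isometric_on Z Y W F"
  shows "inj_on F Y"
proof (rule inj_onI)
  fix x y assume xy: "x \<in> Y" "y \<in> Y" "F x = F y"
  then have "mdist Z x y = 0"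
    using isometric_onD(3)[OF assms, of x y] isometric_onD(2)[OF assms, of y] by simp
  then show "x = y" using xy isometric_onD(1)[OF assms] by (meson mdist_zero subsetD)
qed

lemma isometric_on_inverse:
  assumes "isometric_on Z Y W F"
  shows "isometric_on W (F ` Y) Z (inv_into Y F)"
  using isometric_onD[OF assms] isometric_on_inj[OF assms]
  unfolding isometric_on_def by (auto simp: inv_into_f_f)

definition forms_agree :: "'a set \<Rightarrow> ('a \<Rightarrow> 'b) \<Rightarrow> ('a \<Rightarrow> real) \<Rightarrow> ('a \<Rightarrow> real) list \<Rightarrow>
    ('b \<Rightarrow> real) \<Rightarrow> ('b \<Rightarrow> real) list \<Rightarrow> bool" where
  "forms_agree Y F f' \<pi>' f \<pi> \<longleftrightarrow>
     (\<forall>y\<in>Y. f' y = f (F y)) \<and> list_all2 (\<lambda>p' p. \<forall>y\<in>Y. p' y = p (F y)) \<pi>' \<pi>"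

text \<open>
  \<open>T'\<close> is the image of \<open>T\<close> under the partial map \<open>F\<close>, which has no push-forward in general because
  \<open>f \<circ> F\<close> makes sense on \<open>Y\<close> only. With \<open>Z = W\<close>, \<open>F = id\<close> and \<open>T = T'\<close> it says that \<open>T\<close> is determined
  by the restrictions of test forms to \<open>Y\<close>.
\<close>

definition corresponds :: "nat \<Rightarrow> 'a metric \<Rightarrow> 'a set \<Rightarrow> 'a functional \<Rightarrow>
    'b metric \<Rightarrow> ('a \<Rightarrow> 'b) \<Rightarrow> 'b functional \<Rightarrow> bool" where
  "corresponds m Z Y T W F T' \<longleftrightarrow> (\<forall>f' \<pi>' f \<pi>. (f', \<pi>') \<in> test_forms m Z \<longrightarrow>
     (f, \<pi>) \<in> test_forms m W \<longrightarrow> forms_agree Y F f' \<pi>' f \<pi> \<longrightarrow> T' f \<pi> = T f' \<pi>')"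

lemma correspondsD:
  "corresponds m Z Y T W F T' \<Longrightarrow> (f', \<pi>') \<in> test_forms m Z \<Longrightarrow> (f, \<pi>) \<in> test_forms m W \<Longrightarrow>
     forms_agree Y F f' \<pi>' f \<pi> \<Longrightarrow> T' f \<pi> = T f' \<pi>'"
  by (auto simp: corresponds_def)

lemma corresponds_inverse:
  assumes F: "isometric_on Z Y W F" and T: "corresponds m Z Y T W F T'"
  shows "corresponds m W (F ` Y) T' Z (inv_into Y F) T"
  unfolding corresponds_def
proof (intro allI impI)
  fix f' \<pi>' f \<pi>
  assume *: "(f', \<pi>') \<in> test_forms m W" "(f, \<pi>) \<in> test_forms m Z"
    "forms_agree (F ` Y) (inv_into Y F) f' \<pi>' f \<pi>"
  have "forms_agree Y F f \<pi> f' \<pi>'"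
    using *(3) isometric_on_inj[OF F] unfolding forms_agree_def
    by (auto simp: inv_into_f_f list_all2_conv_all_nth)
  then show "T f \<pi> = T' f' \<pi>'" using correspondsD[OF T *(2,1)] by simp
qed

lemma lip_le_pull_back:
  "isometric_on Z Y W F \<Longrightarrow> lip_le W (mspace W) L f \<Longrightarrow> lip_le Z Y L (\<lambda>y. f (F y))"
  unfolding lip_le_def isometric_on_def by metis

lemma pull_back_slot:
  assumes F: "isometric_on Z Y W F" and p: "lipschitz_fun W p"
  obtains q where "lipschitz_fun Z q" "\<And>y. y \<in> Y \<Longrightarrow> q y = p (F y)" "lip Z q \<le> lip W p"
proof -
  obtain q where "lip_le Z (mspace Z) (lip W p) q" "\<And>y. y \<in> Y \<Longrightarrow> q y = p (F y)"
    using lipschitz_extension[OF lip_le_pull_back[OF F lip_le_lip[OF p]] isometric_onD(1)[OF F]] by metis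
  then show thesis using that lipschitz_funI lip_le_imp_lip_le by metis
qed

text \<open>
  The extensions keep the Lipschitz constants of the \<open>\<pi>\<close> and the bound of \<open>f\<close>, so that mass bounds can
  be carried over without loss.
\<close>

lemma pull_back_form:
  assumes F: "isometric_on Z Y W F" and f: "(f, \<pi>) \<in> test_forms m W"
  obtains f' \<pi>' where "(f', \<pi>') \<in> test_forms m Z" "forms_agree Y F f' \<pi>' f \<pi>"
    "list_all2 (\<lambda>p' p. lip Z p' \<le> lip W p) \<pi>' \<pi>"
proof -
  obtain B where B: "0 \<le> B" "\<forall>x\<in>mspace W. \<bar>f x\<bar> \<le> B"
    using test_formsD(2)[OF f] by (auto simp: bounded_image_iff)
  have bnd: "\<bar>f (F y)\<bar> \<le> B" if "y \<in> Y" for y using B(2) isometric_onD(2)[OF F that] by simp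
  obtain f' where f': "lip_le Z (mspace Z) (lip W f) f'" "\<And>y. y \<in> Y \<Longrightarrow> f' y = f (F y)" "\<And>x. \<bar>f' x\<bar> \<le> B"
    using lipschitz_extension_bounded[OF lip_le_pull_back[OF F lip_le_lip[OF test_formsD(1)[OF f]]]
        isometric_onD(1)[OF F] B(1) bnd] by metis
  have "\<forall>p\<in>set \<pi>. \<exists>q. lipschitz_fun Z q \<and> (\<forall>y\<in>Y. q y = p (F y)) \<and> lip Z q \<le> lip W p"
    using pull_back_slot[OF F test_formsD(4)[OF f]] by metis
  then obtain E where E: "\<And>p. p \<in> set \<pi> \<Longrightarrow> lipschitz_fun Z (E p) \<and> (\<forall>y\<in>Y. E p y = p (F y)) \<and> lip Z (E p) \<le> lip W p"
    by (auto dest!: bchoice)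
  show thesis
  proof (rule that)
    show "(f', map E \<pi>) \<in> test_forms m Z"
      using f'(1,3) E test_formsD(3)[OF f] B(1)
      by (auto simp: test_forms_def bounded_image_iff intro: lipschitz_funI)
    show "forms_agree Y F f' (map E \<pi>) f \<pi>"
      using f'(2) E by (auto simp: forms_agree_def list_all2_conv_all_nth)
    show "list_all2 (\<lambda>p' p. lip Z p' \<le> lip W p) (map E \<pi>) \<pi>"
      using E by (auto simp: list_all2_conv_all_nth)
  qed
qed

lemma prod_list_mono:
  "list_all2 (\<lambda>x y. (0::real) \<le> x \<and> x \<le> y) xs ys \<Longrightarrow> prod_list xs \<le> prod_list ys \<and> 0 \<le> prod_list xs"
  by (induction rule: list_all2_induct) (auto intro!: mult_mono)

lemma prod_lip_mono:
  assumes "(f', \<pi>') \<in> test_forms m Z" "list_all2 (\<lambda>p' p. lip Z p' \<le> lip W p) \<pi>' \<pi>"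
  shows "prod_list (map (lip Z) \<pi>') \<le> prod_list (map (lip W) \<pi>)"
proof -
  have "list_all2 (\<lambda>x y. 0 \<le> x \<and> x \<le> y) (map (lip Z) \<pi>') (map (lip W) \<pi>)"
    using assms(2) by (auto simp: list_all2_conv_all_nth intro!: lip_nonneg test_formsD(4)[OF assms(1)])
  then show ?thesis using prod_list_mono by blast
qed

lemma isometric_on_borel_measurable:
  assumes F: "isometric_on Z Y W F" and Y: "Y \<in> sets (borel_of_metric Z)"
    and \<mu>: "sets \<mu> = sets (borel_of_metric Z)"
  shows "F \<in> measurable (restrict_space \<mu> Y) (borel_of_metric W)"
  unfolding borel_of_metric_def
proof (rule measurable_measure_of)
  show "{U. openin (mtopology_of W) U} \<subseteq> Pow (mspace W)" by (auto dest: openin_subset_mspace)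
  have sp: "space (restrict_space \<mu> Y) = Y"
    using isometric_onD(1)[OF F] space_eq_mspace[OF \<mu>] by (auto simp: space_restrict_space)
  then show "F \<in> space (restrict_space \<mu> Y) \<rightarrow> mspace W" using isometric_onD(2)[OF F] by auto
  fix U assume "U \<in> {U. openin (mtopology_of W) U}"
  then have U: "openin (mtopology_of W) U" by simp
  have "Lipschitz_continuous_map (submetric Z Y) W F"
    using isometric_onD[OF F] by (auto simp: Lipschitz_continuous_map_def intro!: exI[of _ 1])
  then have "continuous_map (subtopology (mtopology_of Z) Y) (mtopology_of W) F"
    using Lipschitz_continuous_imp_continuous_map by (metis mtopology_of_submetric)
  from openin_continuous_map_preimage[OF this U]
  have "openin (subtopology (mtopology_of Z) Y) (F -` U \<inter> Y)"
    using isometric_onD(1)[OF F] by (simp add: vimage_def Int_def conj_commute subset_eq cong: conj_cong)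
  then obtain V where "openin (mtopology_of Z) V" "F -` U \<inter> Y = V \<inter> Y"
    unfolding openin_subtopology by auto
  then show "F -` U \<inter> space (restrict_space \<mu> Y) \<in> sets (restrict_space \<mu> Y)"
    using openin_borel[of Z V] \<mu> unfolding sp sets_restrict_space by auto
qed

text \<open>
  Restrict \<open>\<mu>\<close> to \<open>Y\<close> and push it forward by \<open>F\<close>. The restriction is harmless: replacing \<open>f'\<close> by its
  product with a cut-off function of \<open>Y\<close> leaves the values on \<open>Y\<close> unchanged, hence also the value
  of \<open>T\<close>, while the integrals converge to the integral over \<open>Y\<close>.
\<close>

lemma mass_bound_transport:
  assumes F: "isometric_on Z Y W F" and Y: "closedin (mtopology_of Z) Y"
    and T: "corresponds m Z Y T W F T'" and \<mu>: "mass_bound m Z T \<mu>"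
  obtains \<nu> where "mass_bound m W T' \<nu>" "emeasure \<nu> (mspace W) = emeasure \<mu> Y"
proof -
  note \<mu>' = mass_boundD[OF \<mu>]
  interpret finite_measure \<mu> by (rule \<mu>'(1))
  note YZ = isometric_onD(1)[OF F]
  have Yb: "Y \<in> sets (borel_of_metric Z)" using Y by (rule closedin_borel)
  then have Y\<mu>: "Y \<in> sets \<mu>" using \<mu>'(2) by simp
  have sp: "space (restrict_space \<mu> Y) = Y"
    using YZ \<mu>'(3) by (auto simp: space_restrict_space)
  note Fm = isometric_on_borel_measurable[OF F Yb \<mu>'(2)]
  define \<nu> where "\<nu> = distr (restrict_space \<mu> Y) (borel_of_metric W) F"
  have total: "emeasure \<nu> (mspace W) = emeasure \<mu> Y"
  proof -
    have "emeasure \<nu> (mspace W) = emeasure (restrict_space \<mu> Y) (F -` mspace W \<inter> space (restrict_space \<mu> Y))"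
      unfolding \<nu>_def using sets.top[of "borel_of_metric W"] by (intro emeasure_distr Fm) simp
    also have "F -` mspace W \<inter> space (restrict_space \<mu> Y) = Y"
      using isometric_onD(2)[OF F] by (auto simp: sp)
    finally show ?thesis using Y\<mu> by (simp add: emeasure_restrict_space)
  qed
  show thesis
  proof (rule that)
    show "emeasure \<nu> (mspace W) = emeasure \<mu> Y" by (fact total)
    show "mass_bound m W T' \<nu>"
    proof (rule mass_boundI)
      show "sets \<nu> = sets (borel_of_metric W)" by (simp add: \<nu>_def)
      show "finite_measure \<nu>"
        using total emeasure_finite[of Y] by (intro finite_measureI) (simp add: \<nu>_def)
      fix f \<pi> assume f: "(f, \<pi>) \<in> test_forms m W"
      obtain f' \<pi>' where f': "(f', \<pi>') \<in> test_forms m Z" and ag: "forms_agree Y F f' \<pi>' f \<pi>"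
        and le: "list_all2 (\<lambda>p' p. lip Z p' \<le> lip W p) \<pi>' \<pi>"
        using pull_back_form[OF F f] .
      let ?\<Lambda> = "prod_list (map (lip Z) \<pi>')"
      have "\<bar>T' f \<pi>\<bar> \<le> ?\<Lambda> * (LINT x|\<mu>. \<bar>f' x\<bar> * indicator Y x)"
      proof (cases "Y = {}")
        case True
        have f0: "((\<lambda>_. 0), \<pi>') \<in> test_forms m Z"
          by (rule test_forms_change_fun[OF f']) (auto simp: bounded_image_iff lipschitz_fun_iff_lip_le)
        have "T' f \<pi> = T (\<lambda>_. 0) \<pi>'"
          using ag by (intro correspondsD[OF T f0 f]) (auto simp: forms_agree_def True)
        then show ?thesis using \<mu>'(4)[OF f0] by (simp add: True)
      next
        case False
        have u: "unit_lipschitz Z (cutoff Z Y n)" for n by (rule unit_lipschitz_cutoff[OF YZ])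
        obtain B where B: "0 \<le> B" "\<forall>x\<in>mspace Z. \<bar>f' x\<bar> \<le> B"
          using test_formsD(2)[OF f'] by (auto simp: bounded_image_iff)
        have "(\<lambda>n. LINT x|\<mu>. \<bar>f' x\<bar> * cutoff Z Y n x) \<longlonglongrightarrow> (LINT x|\<mu>. \<bar>f' x\<bar> * indicator Y x)"
        proof (rule LINT_tendsto_indicator[OF \<mu>'(1,2) Yb _ _ u])
          show "(\<lambda>x. \<bar>f' x\<bar>) \<in> borel_measurable \<mu>"
            using lipschitz_measurable_sets[OF \<mu>'(2) test_formsD(1)[OF f']] by simp
          show "\<bar>\<bar>f' x\<bar>\<bar> \<le> B" if "x \<in> mspace Z" for x using B that by simp
          show "(\<lambda>n. cutoff Z Y n x) \<longlonglongrightarrow> indicator Y x" if "x \<in> mspace Z" for x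
            by (rule cutoff_tendsto[OF Y False that])
        qed
        then have "(\<lambda>n. ?\<Lambda> * (LINT x|\<mu>. \<bar>f' x\<bar> * cutoff Z Y n x)) \<longlonglongrightarrow> ?\<Lambda> * (LINT x|\<mu>. \<bar>f' x\<bar> * indicator Y x)"
          by (intro tendsto_mult tendsto_const)
        moreover have "\<bar>T' f \<pi>\<bar> \<le> ?\<Lambda> * (LINT x|\<mu>. \<bar>f' x\<bar> * cutoff Z Y n x)" for n
        proof -
          note fn = test_forms_unit_mult[OF f' u[of n]]
          have "T' f \<pi> = T (\<lambda>x. cutoff Z Y n x * f' x) \<pi>'"
            using ag cutoff_eq_1[OF YZ] by (intro correspondsD[OF T fn f]) (auto simp: forms_agree_def)
          moreover have "(LINT x|\<mu>. \<bar>cutoff Z Y n x * f' x\<bar>) = (LINT x|\<mu>. \<bar>f' x\<bar> * cutoff Z Y n x)"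
            using u[of n] by (simp add: unit_lipschitz_def abs_mult mult.commute)
          ultimately show ?thesis using \<mu>'(4)[OF fn] by simp
        qed
        ultimately show ?thesis by (intro LIMSEQ_le_const) auto
      qed
      also have "\<dots> \<le> prod_list (map (lip W) \<pi>) * (LINT x|\<mu>. \<bar>f' x\<bar> * indicator Y x)"
        by (intro mult_right_mono prod_lip_mono[OF f' le] Bochner_Integration.integral_nonneg) auto
      also have "(LINT x|\<mu>. \<bar>f' x\<bar> * indicator Y x) = (LINT x|\<mu>. indicator Y x *\<^sub>R \<bar>f (F x)\<bar>)"
        using ag by (intro Bochner_Integration.integral_cong) (auto simp: forms_agree_def indicator_def)
      also have "\<dots> = (LINT x|restrict_space \<mu> Y. \<bar>f (F x)\<bar>)"
        using Y\<mu> by (subst integral_restrict_space) auto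
      also have "\<dots> = (LINT w|\<nu>. \<bar>f w\<bar>)"
        unfolding \<nu>_def using lipschitz_borel_measurable[OF test_formsD(1)[OF f]]
        by (subst integral_distr[OF Fm]) auto
      finally show "\<bar>T' f \<pi>\<bar> \<le> prod_list (map (lip W) \<pi>) * (LINT w|\<nu>. \<bar>f w\<bar>)" .
    qed
  qed
qed

lemma has_finite_mass_transport:
  assumes "isometric_on Z Y W F" "closedin (mtopology_of Z) Y" "corresponds m Z Y T W F T'" "has_finite_mass m Z T"
  shows "has_finite_mass m W T'"
  using mass_bound_transport[OF assms(1-3)] assms(4) unfolding has_finite_mass_def by metis

lemma mass_transport_le:
  assumes F: "isometric_on Z Y W F" and Y: "closedin (mtopology_of Z) Y"
    and T: "corresponds m Z Y T W F T'" and s: "splittable m Z T" "splittable m W T'"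
  shows "mass m W T' \<le> mass m Z T"
proof (cases "has_finite_mass m Z T")
  case True
  note \<mu> = mass_measure_least(1)[OF s(1) True]
  obtain \<nu> where \<nu>: "mass_bound m W T' \<nu>" "emeasure \<nu> (mspace W) = emeasure (mass_measure m Z T) Y"
    using mass_bound_transport[OF F Y T \<mu>] .
  have "mass m W T' \<le> emeasure (mass_measure m Z T) Y" using mass_le[OF s(2) \<nu>(1)] \<nu>(2) by simp
  also have "\<dots> \<le> mass m Z T"
    using emeasure_space[of "mass_measure m Z T" Y] mass_boundD(3)[OF \<mu>] True by (simp add: mass_def)
  finally show ?thesis .
qed (simp add: mass_def)

lemma mass_transport_eq:
  assumes F: "isometric_on Z Y W F" and Y: "closedin (mtopology_of Z) Y" "closedin (mtopology_of W) (F ` Y)"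
    and T: "corresponds m Z Y T W F T'" and s: "splittable m Z T" "splittable m W T'"
  shows "mass m W T' = mass m Z T"
  using mass_transport_le[OF F Y(1) T s]
    mass_transport_le[OF isometric_on_inverse[OF F] Y(2) corresponds_inverse[OF F T] s(2,1)]
  by (rule antisym)

section \<open>Transport of currents\<close>

lemma multilinear_slot:
  "multilinear m Z T \<Longrightarrow> (f, \<pi>) \<in> test_forms m Z \<Longrightarrow> i < m \<Longrightarrow> lipschitz_fun Z p \<Longrightarrow> lipschitz_fun Z q \<Longrightarrow>
     T f (\<pi>[i := (\<lambda>x. a * p x + b * q x)]) = a * T f (\<pi>[i := p]) + b * T f (\<pi>[i := q])"
  unfolding multilinear_def by blast

lemma test_forms_update:
  "(f, \<pi>) \<in> test_forms m Z \<Longrightarrow> lipschitz_fun Z p \<Longrightarrow> (f, \<pi>[i := p]) \<in> test_forms m Z"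
  by (auto simp: test_forms_def dest!: set_update_subset_insert[THEN subsetD])

text \<open>
  Scale the coordinate functions one after the other: \<open>?\<pi> k\<close> is the list with the first \<open>k\<close> entries
  scaled.
\<close>

lemma multilinear_scale:
  assumes T: "multilinear m Z T" and f: "(f, \<pi>) \<in> test_forms m Z"
  shows "T f (map (\<lambda>p x. c * p x) \<pi>) = c ^ m * T f \<pi>"
proof -
  have len: "length \<pi> = m" using f by (rule test_formsD)
  have lip: "lipschitz_fun Z (\<pi> ! i)" if "i < m" for i using test_formsD(4)[OF f] that len by auto
  let ?\<pi> = "\<lambda>k. map (\<lambda>p x. c * p x) (take k \<pi>) @ drop k \<pi>"
  have "T f (?\<pi> k) = c ^ k * T f \<pi> \<and> (f, ?\<pi> k) \<in> test_forms m Z" if "k \<le> m" for k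
    using that
  proof (induction k)
    case 0
    then show ?case using f by simp
  next
    case (Suc k)
    then have k: "k < m" and IH: "T f (?\<pi> k) = c ^ k * T f \<pi>" "(f, ?\<pi> k) \<in> test_forms m Z" by auto
    have upd: "?\<pi> (Suc k) = (?\<pi> k)[k := (\<lambda>x. c * (\<pi> ! k) x + 0 * (\<pi> ! k) x)]"
      using k len by (intro nth_equalityI) (auto simp: nth_append nth_list_update less_Suc_eq)
    have same: "(?\<pi> k)[k := \<pi> ! k] = ?\<pi> k"
      using k len by (intro nth_equalityI) (auto simp: nth_append nth_list_update)
    have "T f (?\<pi> (Suc k)) = c * T f (?\<pi> k) + 0 * T f (?\<pi> k)"
      unfolding upd multilinear_slot[OF T IH(2) k lip[OF k] lip[OF k]] same ..
    moreover have "(f, ?\<pi> (Suc k)) \<in> test_forms m Z"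
      unfolding upd by (intro test_forms_update[OF IH(2)] lipschitz_fun_combination lip k)
    ultimately show ?case using IH(1) by simp
  qed
  from this[of m] show ?thesis using len by simp
qed

text \<open>
  The continuity axiom is formulated for Lipschitz constants at most \<open>1\<close>. An arbitrary common bound
  \<open>L\<close> is reduced to this case by scaling with \<open>1 / (L + 1)\<close>.
\<close>

lemma current_tendsto:
  assumes T: "multilinear m Z T" "continuous_functional m Z T" and f: "(f, \<pi>) \<in> test_forms m Z"
    and P: "\<And>j. (f, P j) \<in> test_forms m Z" "\<And>j p. p \<in> set (P j) \<Longrightarrow> lip_le Z (mspace Z) L p" and L: "0 \<le> L"
    and lim: "\<And>i x. i < m \<Longrightarrow> x \<in> mspace Z \<Longrightarrow> (\<lambda>j. (P j ! i) x) \<longlonglongrightarrow> (\<pi> ! i) x"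
  shows "(\<lambda>j. T f (P j)) \<longlonglongrightarrow> T f \<pi>"
proof -
  define c where "c = 1 / (L + 1)"
  have c: "c > 0" "c * L \<le> 1" using L by (auto simp: c_def field_simps)
  let ?s = "map (\<lambda>p x. c * p x)"
  have tf: "(f, ?s \<rho>) \<in> test_forms m Z" if "(f, \<rho>) \<in> test_forms m Z" for \<rho>
    using that lipschitz_fun_scale by (auto simp: test_forms_def)
  have "(\<lambda>j. T f (?s (P j))) \<longlonglongrightarrow> T f (?s \<pi>)"
  proof (rule T(2)[unfolded continuous_functional_def, rule_format, OF tf[OF f]], intro conjI)
    show "(f, ?s (P j)) \<in> test_forms m Z" for j by (rule tf[OF P(1)])
    show "\<forall>p\<in>set (?s (P j)). lip Z p \<le> 1" for j
    proof
      fix p assume "p \<in> set (?s (P j))"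
      then obtain q where q: "q \<in> set (P j)" "p = (\<lambda>x. c * q x)" by auto
      have "lip Z p \<le> \<bar>c\<bar> * L"
        unfolding q(2) by (intro lip_le_imp_lip_le lip_le_cmult P(2)[OF q(1)])
      then show "lip Z p \<le> 1" using c by simp
    qed
    fix i x assume "i < m" "x \<in> mspace Z"
    then show "(\<lambda>j. (?s (P j) ! i) x) \<longlonglongrightarrow> (?s \<pi> ! i) x"
      using lim[of i x] test_formsD(3)[OF f] test_formsD(3)[OF P(1)]
      by (auto intro: tendsto_mult)
  qed
  then have "(\<lambda>j. c ^ m * T f (P j)) \<longlonglongrightarrow> c ^ m * T f \<pi>"
    using multilinear_scale[OF T(1)] f P(1) by simp
  then show ?thesis using c(1) by (simp add: tendsto_mult_left_iff)
qed

text \<open>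
  McShane's extension is not continuous under pointwise convergence in general, as the infimum may be
  taken at points that escape. For nonnegative functions tending to zero it is: the extension of
  zero is a lower bound, and evaluating at a single well chosen \<open>y\<close> bounds the limit from above.
\<close>

lemma mcshane_tendsto:
  assumes Y: "Y \<subseteq> mspace Z" and x: "x \<in> mspace Z"
    and e: "\<And>j. lip_le Z Y L (e j)" "\<And>j y. y \<in> Y \<Longrightarrow> 0 \<le> e j y"
    and lim: "\<And>y. y \<in> Y \<Longrightarrow> (\<lambda>j. e j y) \<longlonglongrightarrow> 0"
  shows "(\<lambda>j::nat. mcshane Z Y L (e j) x) \<longlonglongrightarrow> mcshane Z Y L (\<lambda>_. 0) x"
proof (cases "Y = {}")
  case True
  then show ?thesis by (simp add: mcshane_def)
next
  case False
  have L: "lip_le Z Y L (\<lambda>_. 0)" using lip_le_nonneg[OF e(1)] by simp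
  have lower: "mcshane Z Y L (\<lambda>_. 0) x \<le> mcshane Z Y L (e j) x" for j
  proof (rule mcshane_greatest[OF False])
    fix y assume "y \<in> Y"
    then show "mcshane Z Y L (\<lambda>_. 0) x \<le> e j y + L * mdist Z x y"
      using mcshane_lower[OF L Y x, of y] e(2)[of y j] by simp
  qed
  show ?thesis
  proof (rule order_tendstoI)
    fix a assume "a < mcshane Z Y L (\<lambda>_. 0) x"
    then show "eventually (\<lambda>j. a < mcshane Z Y L (e j) x) sequentially"
      using lower by (intro always_eventually allI) (auto intro: less_le_trans)
  next
    fix a assume a: "mcshane Z Y L (\<lambda>_. 0) x < a"
    obtain y where y: "y \<in> Y" "L * mdist Z x y < a"
      using mcshane_greatest[OF False, of a "\<lambda>_. 0" L Z x] a by fastforce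
    have "eventually (\<lambda>j. e j y < a - L * mdist Z x y) sequentially"
      using lim[OF y(1)] y(2) by (intro order_tendstoD(2)) auto
    then show "eventually (\<lambda>j. mcshane Z Y L (e j) x < a) sequentially"
    proof eventually_elim
      case (elim j)
      then show ?case using mcshane_lower[OF e(1) Y x y(1), of j] by simp
    qed
  qed
qed

text \<open>
  The extensions of the positive and the negative part converge to the same limit, \<open>L\<close> times the
  distance to \<open>Y\<close>, which vanishes on \<open>Y\<close>. Their difference therefore extends \<open>e\<close> and tends to \<open>0\<close>
  everywhere, even far away from \<open>Y\<close>.
\<close>

lemma vanishing_extension:
  assumes Y: "Y \<subseteq> mspace Z" and e: "\<And>j. lip_le Z Y L (e j)"
    and lim: "\<And>y. y \<in> Y \<Longrightarrow> (\<lambda>j::nat. e j y) \<longlonglongrightarrow> 0"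
  obtains r where "\<And>j. lip_le Z (mspace Z) (4 * L) (r j)" "\<And>j y. y \<in> Y \<Longrightarrow> r j y = e j y"
    "\<And>x. x \<in> mspace Z \<Longrightarrow> (\<lambda>j. r j x) \<longlonglongrightarrow> 0"
proof
  let ?p = "\<lambda>j y. max 0 (e j y)" and ?n = "\<lambda>j y. max 0 (- e j y)"
  let ?E = "mcshane Z Y L"
  define r where "r j x = (?E (?p j) x - ?E (\<lambda>_. 0) x) - (?E (?n j) x - ?E (\<lambda>_. 0) x)" for j x
  have L: "lip_le Z Y L (\<lambda>_. 0)" using lip_le_nonneg[OF e] by simp
  have p: "lip_le Z Y L (?p j)" for j by (rule lip_le_contract[OF e]) auto
  have n: "lip_le Z Y L (?n j)" for j by (rule lip_le_contract[OF e]) auto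
  show "lip_le Z (mspace Z) (4 * L) (r j)" for j
  proof -
    have "lip_le Z (mspace Z) ((L + L) + (L + L)) (r j)"
      unfolding r_def by (intro lip_le_diff lip_le_mcshane p n L Y)
    then show ?thesis by simp
  qed
  show "r j y = e j y" if "y \<in> Y" for j y
    using that by (simp add: r_def mcshane_eq[OF p Y] mcshane_eq[OF n Y] mcshane_eq[OF L Y])
  fix x assume x: "x \<in> mspace Z"
  have "(\<lambda>j. ?p j y) \<longlonglongrightarrow> 0" if "y \<in> Y" for y
    using tendsto_max[OF tendsto_const lim[OF that], of 0] by simp
  moreover have "(\<lambda>j. ?n j y) \<longlonglongrightarrow> 0" if "y \<in> Y" for y
    using tendsto_max[OF tendsto_const tendsto_minus[OF lim[OF that]], of 0] by simp
  ultimately have "(\<lambda>j. ?E (?p j) x) \<longlonglongrightarrow> ?E (\<lambda>_. 0) x" "(\<lambda>j. ?E (?n j) x) \<longlonglongrightarrow> ?E (\<lambda>_. 0) x"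
    by (intro mcshane_tendsto Y x p n; simp)+
  then have "(\<lambda>j. r j x) \<longlonglongrightarrow> (?E (\<lambda>_. 0) x - ?E (\<lambda>_. 0) x) - (?E (\<lambda>_. 0) x - ?E (\<lambda>_. 0) x)"
    unfolding r_def by (intro tendsto_diff tendsto_const)
  then show "(\<lambda>j. r j x) \<longlonglongrightarrow> 0" by simp
qed

lemma common_lip_bound:
  assumes "(f, \<pi>) \<in> test_forms m Z"
  shows "\<exists>K\<ge>0. \<forall>p\<in>set \<pi>. lip_le Z (mspace Z) K p"
proof -
  have "\<forall>p\<in>set \<pi>. lipschitz_fun Z p" using test_formsD(4)[OF assms] by blast
  then show ?thesis
  proof (induction \<pi>)
    case (Cons p \<pi>)
    then obtain K where K: "0 \<le> K" "\<forall>p\<in>set \<pi>. lip_le Z (mspace Z) K p" by auto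
    have "lip_le Z (mspace Z) (lip Z p) p" using Cons.prems by (intro lip_le_lip) simp
    then have "lip_le Z (mspace Z) (max (lip Z p) K) p" by (rule lip_le_mono) simp
    moreover have "\<forall>p'\<in>set \<pi>. lip_le Z (mspace Z) (max (lip Z p) K) p'"
      using K(2) lip_le_mono by (meson max.cobounded2)
    ultimately show ?case using K(1) by (intro exI[of _ "max (lip Z p) K"]) auto
  qed auto
qed

lemma forms_agree_update:
  "forms_agree Y F f' \<pi>' f \<pi> \<Longrightarrow> (\<And>y. y \<in> Y \<Longrightarrow> p' y = p (F y)) \<Longrightarrow> forms_agree Y F f' (\<pi>'[i := p']) f (\<pi>[i := p])"
  by (auto simp: forms_agree_def intro: list_all2_update_cong)

lemma forms_agree_fun:
  "forms_agree Y F f' \<pi>' f \<pi> \<Longrightarrow> (\<And>y. y \<in> Y \<Longrightarrow> g' y = g (F y)) \<Longrightarrow> forms_agree Y F g' \<pi>' g \<pi>"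
  by (auto simp: forms_agree_def)

lemma forms_agree_slot:
  "forms_agree Y F f' \<pi>' f \<pi> \<Longrightarrow> i < length \<pi> \<Longrightarrow> y \<in> Y \<Longrightarrow> (\<pi>' ! i) y = (\<pi> ! i) (F y)"
  by (auto simp: forms_agree_def list_all2_conv_all_nth)

lemma test_forms_combination:
  assumes "(f, \<pi>) \<in> test_forms m Z" "(g, \<pi>') \<in> test_forms m Z"
  shows "(\<lambda>x. a * f x + b * g x, \<pi>) \<in> test_forms m Z"
proof (rule test_forms_change_fun[OF assms(1)])
  show "lipschitz_fun Z (\<lambda>x. a * f x + b * g x)"
    by (intro lipschitz_fun_combination test_formsD(1)[OF assms(1)] test_formsD(1)[OF assms(2)])
  obtain B C where B: "0 \<le> B" "\<forall>x\<in>mspace Z. \<bar>f x\<bar> \<le> B" and C: "0 \<le> C" "\<forall>x\<in>mspace Z. \<bar>g x\<bar> \<le> C"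
    using test_formsD(2)[OF assms(1)] test_formsD(2)[OF assms(2)] by (auto simp: bounded_image_iff)
  have "\<bar>a * f x + b * g x\<bar> \<le> \<bar>a\<bar> * B + \<bar>b\<bar> * C" if "x \<in> mspace Z" for x
    using B(2) C(2) that
    by (intro order_trans[OF abs_triangle_ineq] add_mono) (auto simp: abs_mult intro!: mult_left_mono)
  then show "bounded ((\<lambda>x. a * f x + b * g x) ` mspace Z)"
    using B(1) C(1) unfolding bounded_image_iff by (intro exI[of _ "\<bar>a\<bar> * B + \<bar>b\<bar> * C"]) auto
qed

lemma multilinear_transport:
  assumes F: "isometric_on Z Y W F" and c: "corresponds m Z Y T W F T'" and T: "multilinear m Z T"
  shows "multilinear m W T'"
  unfolding multilinear_def
proof (intro conjI allI impI)
  fix f g \<pi> a b assume f: "(f, \<pi>) \<in> test_forms m W" and g: "(g, \<pi>) \<in> test_forms m W"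
  obtain f' \<pi>' where f': "(f', \<pi>') \<in> test_forms m Z" "forms_agree Y F f' \<pi>' f \<pi>"
    using pull_back_form[OF F f] by metis
  obtain g' \<rho> where g'\<rho>: "(g', \<rho>) \<in> test_forms m Z" "forms_agree Y F g' \<rho> g \<pi>"
    using pull_back_form[OF F g] by metis
  have g': "(g', \<pi>') \<in> test_forms m Z"
    by (rule test_forms_change_fun[OF f'(1) test_formsD(1,2)[OF g'\<rho>(1)]])
  have ag: "forms_agree Y F g' \<pi>' g \<pi>"
    using f'(2) g'\<rho>(2) by (auto simp: forms_agree_def)
  have "T' (\<lambda>x. a * f x + b * g x) \<pi> = T (\<lambda>x. a * f' x + b * g' x) \<pi>'"
    using f'(2) ag by (intro correspondsD[OF c test_forms_combination[OF f'(1) g'] test_forms_combination[OF f g]])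
      (auto simp: forms_agree_def)
  also have "\<dots> = a * T f' \<pi>' + b * T g' \<pi>'" by (rule multilinear_fun[OF T f'(1) g'])
  finally show "T' (\<lambda>x. a * f x + b * g x) \<pi> = a * T' f \<pi> + b * T' g \<pi>"
    using correspondsD[OF c f'(1) f f'(2)] correspondsD[OF c g' g ag] by simp
next
  fix f \<pi> i p q a b
  assume f: "(f, \<pi>) \<in> test_forms m W" and i: "i < m" and p: "lipschitz_fun W p" and q: "lipschitz_fun W q"
  obtain f' \<pi>' where f': "(f', \<pi>') \<in> test_forms m Z" "forms_agree Y F f' \<pi>' f \<pi>"
    using pull_back_form[OF F f] by metis
  obtain p' where p': "lipschitz_fun Z p'" "\<And>y. y \<in> Y \<Longrightarrow> p' y = p (F y)"
    using pull_back_slot[OF F p] by metis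
  obtain q' where q': "lipschitz_fun Z q'" "\<And>y. y \<in> Y \<Longrightarrow> q' y = q (F y)"
    using pull_back_slot[OF F q] by metis
  have eq: "T' f (\<pi>[i := s]) = T f' (\<pi>'[i := s'])"
    if "lipschitz_fun W s" "lipschitz_fun Z s'" "\<And>y. y \<in> Y \<Longrightarrow> s' y = s (F y)" for s s'
    using that by (intro correspondsD[OF c test_forms_update[OF f'(1)] test_forms_update[OF f] forms_agree_update[OF f'(2)]]) auto
  have "T' f (\<pi>[i := \<lambda>x. a * p x + b * q x]) = T f' (\<pi>'[i := \<lambda>x. a * p' x + b * q' x])"
    using p q p' q' by (intro eq lipschitz_fun_combination) auto
  also have "\<dots> = a * T f' (\<pi>'[i := p']) + b * T f' (\<pi>'[i := q'])"
    by (rule multilinear_slot[OF T f'(1) i p'(1) q'(1)])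
  finally show "T' f (\<pi>[i := \<lambda>x. a * p x + b * q x]) = a * T' f (\<pi>[i := p]) + b * T' f (\<pi>[i := q])"
    using eq[OF p p'(1) p'(2)] eq[OF q q'(1) q'(2)] by simp
qed

text \<open>
  Extend the limit form once and add to it extensions of the differences \<open>P j - \<pi>\<close> that vanish in the
  limit on all of \<open>Z\<close>. Then the continuity of \<open>T\<close> applies.
\<close>

lemma continuous_transport:
  assumes F: "isometric_on Z Y W F" and c: "corresponds m Z Y T W F T'"
    and T: "multilinear m Z T" "continuous_functional m Z T"
  shows "continuous_functional m W T'"
  unfolding continuous_functional_def
proof (intro allI impI)
  fix f \<pi> and P :: "nat \<Rightarrow> ('b \<Rightarrow> real) list"
  assume f: "(f, \<pi>) \<in> test_forms m W" and P: "\<forall>j. (f, P j) \<in> test_forms m W \<and> (\<forall>p\<in>set (P j). lip W p \<le> 1)"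
    and lim: "\<forall>i<m. \<forall>x\<in>mspace W. (\<lambda>j. (P j ! i) x) \<longlonglongrightarrow> (\<pi> ! i) x"
  note YZ = isometric_onD(1)[OF F]
  have len: "length \<pi> = m" "length (P j) = m" for j using f P by (auto simp: test_forms_def)
  have P1: "lip_le W (mspace W) 1 (P j ! i)" if "i < m" for i j
  proof -
    have "P j ! i \<in> set (P j)" using that len by simp
    then have "lipschitz_fun W (P j ! i)" "lip W (P j ! i) \<le> 1"
      using P test_formsD(4)[of f "P j" m W] by auto
    then show ?thesis using lip_le_mono[OF lip_le_lip] by blast
  qed
  obtain f' \<pi>' where f': "(f', \<pi>') \<in> test_forms m Z" and ag: "forms_agree Y F f' \<pi>' f \<pi>"
    using pull_back_form[OF F f] by metis
  have len': "length \<pi>' = m" using f' by (rule test_formsD)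
  obtain L where L: "0 \<le> L" "\<And>i. i < m \<Longrightarrow> lip_le W (mspace W) L (\<pi> ! i)"
    using common_lip_bound[OF f] len by auto
  obtain L' where L': "0 \<le> L'" "\<And>i. i < m \<Longrightarrow> lip_le Z (mspace Z) L' (\<pi>' ! i)"
    using common_lip_bound[OF f'] len' by auto
  have "\<exists>r. (\<forall>j. lip_le Z (mspace Z) (4 * (1 + L)) (r j)) \<and> (\<forall>j. \<forall>y\<in>Y. r j y = (P j ! i) (F y) - (\<pi> ! i) (F y)) \<and>
      (\<forall>x\<in>mspace Z. (\<lambda>j. r j x) \<longlonglongrightarrow> 0)" if i: "i < m" for i
  proof -
    have e: "lip_le Z Y (1 + L) (\<lambda>y. (P j ! i) (F y) - (\<pi> ! i) (F y))" for j
      by (intro lip_le_diff lip_le_pull_back[OF F] P1[OF i] L(2)[OF i])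
    have l: "(\<lambda>j. (P j ! i) (F y) - (\<pi> ! i) (F y)) \<longlonglongrightarrow> 0" if "y \<in> Y" for y
      using lim i isometric_onD(2)[OF F that] by (intro LIM_zero) auto
    from vanishing_extension[OF YZ e l] show ?thesis by metis
  qed
  then obtain r where r: "\<And>i j. i < m \<Longrightarrow> lip_le Z (mspace Z) (4 * (1 + L)) (r i j)"
      "\<And>i j y. i < m \<Longrightarrow> y \<in> Y \<Longrightarrow> r i j y = (P j ! i) (F y) - (\<pi> ! i) (F y)"
      "\<And>i x. i < m \<Longrightarrow> x \<in> mspace Z \<Longrightarrow> (\<lambda>j. r i j x) \<longlonglongrightarrow> 0"
    by metis
  define Q where "Q j = map (\<lambda>i x. (\<pi>' ! i) x + r i j x) [0..<m]" for j
  have Qlip: "lip_le Z (mspace Z) (L' + 4 * (1 + L)) (\<lambda>x. (\<pi>' ! i) x + r i j x)" if "i < m" for i j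
    by (intro lip_le_add L'(2) r(1) that)
  have Q: "(f', Q j) \<in> test_forms m Z" for j
    using f' lipschitz_funI[OF Qlip] by (auto simp: test_forms_def Q_def)
  have "forms_agree Y F f' (Q j) f (P j)" for j
    using ag len len' r(2) by (auto simp: forms_agree_def Q_def list_all2_conv_all_nth)
  then have eq: "T' f (P j) = T f' (Q j)" for j
    using P by (intro correspondsD[OF c Q]) auto
  have "(\<lambda>j. T f' (Q j)) \<longlonglongrightarrow> T f' \<pi>'"
  proof (rule current_tendsto[OF T f' Q])
    show "lip_le Z (mspace Z) (L' + 4 * (1 + L)) p" if "p \<in> set (Q j)" for p j
      using that Qlip by (auto simp: Q_def)
    show "0 \<le> L' + 4 * (1 + L)" using L(1) L'(1) by simp
    show "(\<lambda>j. (Q j ! i) x) \<longlonglongrightarrow> (\<pi>' ! i) x" if "i < m" "x \<in> mspace Z" for i x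
      using tendsto_add[OF tendsto_const r(3)[OF that], of "(\<pi>' ! i) x"] that by (simp add: Q_def)
  qed
  then show "(\<lambda>j. T' f (P j)) \<longlonglongrightarrow> T' f \<pi>"
    using correspondsD[OF c f' f ag] eq by simp
qed

text \<open>
  The coordinate \<open>\<pi> ! i\<close> has the constant value \<open>a\<close> on an open subset of \<open>W\<close> outside which \<open>f\<close> vanishes, but its
  extension \<open>g\<close> need not be constant on any open subset of \<open>Z\<close>. Flatten \<open>g\<close> to \<open>q n\<close>, which equals \<open>a\<close> wherever
  \<open>g\<close> is within \<open>e n\<close> of \<open>a\<close>, and multiply \<open>f'\<close> by a cut-off function \<open>\<eta>\<close> of \<open>g\<close> that is supported there.
  On \<open>Y\<close> this leaves \<open>f'\<close> unchanged, so locality of \<open>T\<close> gives \<open>0\<close> for the flattened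
  coordinate. Finally \<open>q n\<close> tends to \<open>g\<close>.
\<close>

lemma local_transport:
  assumes F: "isometric_on Z Y W F" and c: "corresponds m Z Y T W F T'"
    and T: "multilinear m Z T" "local_functional m Z T" "continuous_functional m Z T"
  shows "local_functional m W T'"
  unfolding local_functional_def
proof (intro allI impI)
  fix f \<pi> assume f: "(f, \<pi>) \<in> test_forms m W"
  assume "\<exists>i<m. \<exists>U a. openin (mtopology_of W) U \<and> {x \<in> mspace W. f x \<noteq> 0} \<subseteq> U \<and> (\<forall>x\<in>U. (\<pi> ! i) x = a)"
  then obtain i U a where i: "i < m" and U: "{x \<in> mspace W. f x \<noteq> 0} \<subseteq> U" "\<And>x. x \<in> U \<Longrightarrow> (\<pi> ! i) x = a"
    by auto
  have len: "length \<pi> = m" using f by (rule test_formsD)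
  obtain f' \<pi>' where f': "(f', \<pi>') \<in> test_forms m Z" and ag: "forms_agree Y F f' \<pi>' f \<pi>"
    using pull_back_form[OF F f] by metis
  have len': "length \<pi>' = m" using f' by (rule test_formsD)
  let ?g = "\<pi>' ! i"
  have g: "lipschitz_fun Z ?g" and \<pi>i: "lipschitz_fun W (\<pi> ! i)"
    using test_formsD(4)[OF f'] test_formsD(4)[OF f] i len len' by auto
  define e where "e n = 1 / real (Suc n)" for n
  have e: "e n > 0" for n by (simp add: e_def)
  define soft where "soft n t = a + ((t - a) - max (- e n) (min (e n) (t - a)))" for n t
  have soft1: "\<bar>soft n s - soft n t\<bar> \<le> \<bar>s - t\<bar>" for n s t
    using e[of n] by (auto simp: soft_def max_def min_def)
  have soft_lip: "lip_le V (mspace V) (lip V p) (\<lambda>x. soft n (p x))" if "lipschitz_fun V p" for V :: "'x metric" and p n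
    by (rule lip_le_contract[OF lip_le_lip[OF that] soft1])
  define q where "q n = (\<lambda>x. soft n (?g x))" for n
  have qlip: "lip_le Z (mspace Z) (lip Z ?g) (q n)" for n
    unfolding q_def by (rule lip_le_contract[OF lip_le_lip[OF g] soft1])
  have zero: "T f' (\<pi>'[i := q n]) = 0" for n
  proof -
    define \<eta> where "\<eta> x = max 0 (1 - (1 / e n) * \<bar>?g x - a\<bar>)" for x
    have "lip_le Z (mspace Z) (\<bar>1 / e n\<bar> * (lip Z ?g + 0)) (\<lambda>x. (1 / e n) * (?g x - a))"
      by (intro lip_le_cmult lip_le_diff lip_le_lip[OF g]) simp
    then have "lip_le Z (mspace Z) (\<bar>1 / e n\<bar> * (lip Z ?g + 0)) (\<lambda>x. max 0 (1 - \<bar>(1 / e n) * (?g x - a)\<bar>))"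
      by (rule lip_le_contract) auto
    moreover have "\<eta> = (\<lambda>x. max 0 (1 - \<bar>(1 / e n) * (?g x - a)\<bar>))"
      using e[of n] by (simp add: \<eta>_def[abs_def] abs_mult)
    ultimately have \<eta>: "unit_lipschitz Z \<eta>"
      using e[of n] by (auto simp: unit_lipschitz_def \<eta>_def intro: lipschitz_funI)
    have q: "lipschitz_fun Z (q n)" using qlip by (rule lipschitz_funI)
    have qW: "lipschitz_fun W (\<lambda>x. soft n ((\<pi> ! i) x))"
      by (rule lipschitz_funI[OF lip_le_contract[OF lip_le_lip[OF \<pi>i] soft1]])
    have gi: "?g y = (\<pi> ! i) (F y)" if "y \<in> Y" for y using forms_agree_slot[OF ag _ that] i len by simp
    have ag1: "forms_agree Y F f' (\<pi>'[i := q n]) f (\<pi>[i := \<lambda>x. soft n ((\<pi> ! i) x)])"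
      by (rule forms_agree_update[OF ag]) (simp add: q_def gi)
    have ag2: "forms_agree Y F (\<lambda>x. \<eta> x * f' x) (\<pi>'[i := q n]) f (\<pi>[i := \<lambda>x. soft n ((\<pi> ! i) x)])"
    proof (rule forms_agree_fun[OF ag1])
      fix y assume y: "y \<in> Y"
      have f'y: "f' y = f (F y)" using ag y by (simp add: forms_agree_def)
      show "\<eta> y * f' y = f (F y)"
      proof (cases "f (F y) = 0")
        case True
        then show ?thesis using f'y by simp
      next
        case False
        then have "(\<pi> ! i) (F y) = a" using U isometric_onD(2)[OF F y] by auto
        then show ?thesis using gi[OF y] f'y by (simp add: \<eta>_def)
      qed
    qed
    note f1 = test_forms_update[OF f' q, of i] and fW = test_forms_update[OF f qW, of i]
    have "T f' (\<pi>'[i := q n]) = T (\<lambda>x. \<eta> x * f' x) (\<pi>'[i := q n])"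
      using correspondsD[OF c f1 fW ag1] correspondsD[OF c test_forms_unit_mult[OF f1 \<eta>] fW ag2] by simp
    also have "\<dots> = 0"
    proof (rule T(2)[unfolded local_functional_def, rule_format, OF test_forms_unit_mult[OF f1 \<eta>]])
      let ?V = "{x \<in> mspace Z. ?g x \<in> {a - e n<..<a + e n}}"
      have "openin (mtopology_of Z) ?V" by (rule openin_preimage_lipschitz[OF g]) simp
      moreover have "{x \<in> mspace Z. \<eta> x * f' x \<noteq> 0} \<subseteq> ?V"
        using e[of n] by (auto simp: \<eta>_def max_def field_simps abs_if split: if_splits)
      moreover have "\<forall>x\<in>?V. (\<pi>'[i := q n] ! i) x = a"
        using i len' by (auto simp: q_def soft_def)
      ultimately show "\<exists>i'<m. \<exists>U c. openin (mtopology_of Z) U \<and> {x \<in> mspace Z. \<eta> x * f' x \<noteq> 0} \<subseteq> U \<and>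
          (\<forall>x\<in>U. (\<pi>'[i := q n] ! i') x = c)"
        using i by blast
    qed
    finally show ?thesis .
  qed
  obtain K where K: "0 \<le> K" "\<And>p. p \<in> set \<pi>' \<Longrightarrow> lip_le Z (mspace Z) K p"
    using common_lip_bound[OF f'] by auto
  have "(\<lambda>n. T f' (\<pi>'[i := q n])) \<longlonglongrightarrow> T f' \<pi>'"
  proof (rule current_tendsto[OF T(1,3) f' test_forms_update[OF f' lipschitz_funI[OF qlip]]])
    show "0 \<le> K" by (fact K(1))
    show "lip_le Z (mspace Z) K p" if "p \<in> set (\<pi>'[i := q n])" for p n
    proof -
      have "p = q n \<or> p \<in> set \<pi>'" using set_update_subset_insert that by fast
      then show ?thesis
      proof
        assume "p = q n"
        then show ?thesis
          using lip_le_mono[OF qlip lip_le_imp_lip_le[OF K(2)]] i len' by simp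
      qed (rule K(2))
    qed
    show "(\<lambda>n. (\<pi>'[i := q n] ! k) x) \<longlonglongrightarrow> (\<pi>' ! k) x" if "k < m" "x \<in> mspace Z" for k x
    proof (cases "k = i")
      case True
      have e0: "(\<lambda>n. e n) \<longlonglongrightarrow> 0" unfolding e_def using lim_1_over_n[THEN LIMSEQ_Suc] by simp
      have le: "norm (q n x - ?g x) \<le> e n" for n
      proof -
        have "q n x - ?g x = - max (- e n) (min (e n) (?g x - a))" by (simp add: q_def soft_def)
        moreover have "\<bar>- max (- e n) (min (e n) (?g x - a))\<bar> \<le> e n"
          using e[of n] by (auto simp: max_def min_def abs_le_iff)
        ultimately show ?thesis by simp
      qed
      have "(\<lambda>n. q n x - ?g x) \<longlonglongrightarrow> 0"
        by (rule Lim_null_comparison[OF always_eventually[OF allI[OF le]] e0])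
      then show ?thesis using True i len' by (simp add: LIM_zero_iff)
    qed simp
  qed
  then have "T f' \<pi>' = 0" by (simp add: zero LIMSEQ_const_iff)
  then show "T' f \<pi> = 0" using correspondsD[OF c f' f ag] by simp
qed

lemma current_transport:
  assumes "isometric_on Z Y W F" "closedin (mtopology_of Z) Y" "corresponds m Z Y T W F T'" "current m Z T"
  shows "current m W T'"
  using assms multilinear_transport[OF assms(1,3)] continuous_transport[OF assms(1,3)]
    local_transport[OF assms(1,3)] has_finite_mass_transport[OF assms(1-3)]
  by (simp add: current_def)

section \<open>Separable subsets\<close>

text \<open>
  The dense set may leave \<open>S\<close>. In this form separability obviously passes to subsets and to countable unions;
  \<open>separable_in_dense_subset\<close> moves the dense set into \<open>S\<close>.
\<close>

definition separable_in :: "'a metric \<Rightarrow> 'a set \<Rightarrow> bool" where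
  "separable_in Z S \<longleftrightarrow> (\<exists>C. countable C \<and> C \<subseteq> mspace Z \<and> (\<forall>x\<in>S. \<forall>e>0. \<exists>c\<in>C. mdist Z x c < e))"

lemma separable_inI:
  "countable C \<Longrightarrow> C \<subseteq> mspace Z \<Longrightarrow> (\<And>x e. x \<in> S \<Longrightarrow> e > 0 \<Longrightarrow> \<exists>c\<in>C. mdist Z x c < e) \<Longrightarrow> separable_in Z S"
  unfolding separable_in_def by blast

lemma separable_in_mono: "separable_in Z S \<Longrightarrow> R \<subseteq> S \<Longrightarrow> separable_in Z R"
  unfolding separable_in_def by (meson subsetD)

lemma separable_in_UN:
  assumes "\<And>i::nat. separable_in Z (S i)"
  shows "separable_in Z (\<Union>i. S i)"
proof -
  have "\<forall>i. \<exists>C. countable C \<and> C \<subseteq> mspace Z \<and> (\<forall>x\<in>S i. \<forall>e>0. \<exists>c\<in>C. mdist Z x c < e)"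
    using assms by (simp add: separable_in_def)
  from choice[OF this] obtain C where
    C: "\<forall>i. countable (C i) \<and> C i \<subseteq> mspace Z \<and> (\<forall>x\<in>S i. \<forall>e>0. \<exists>c\<in>C i. mdist Z x c < e)" ..
  show ?thesis
  proof (rule separable_inI)
    show "countable (\<Union>i. C i)" using C by auto
    show "(\<Union>i. C i) \<subseteq> mspace Z" using C by auto
    fix x and e :: real assume "x \<in> (\<Union>i. S i)" "e > 0"
    then obtain i where "x \<in> S i" by auto
    have "\<forall>x\<in>S i. \<forall>e>0. \<exists>c\<in>C i. mdist Z x c < e" using spec[OF C, of i] by simp
    then have "\<exists>c\<in>C i. mdist Z x c < e" using \<open>x \<in> S i\<close> \<open>e > 0\<close> by simp
    then show "\<exists>c\<in>\<Union>i. C i. mdist Z x c < e" by auto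
  qed
qed

lemma separable_in_Un:
  assumes "separable_in Z R" "separable_in Z S"
  shows "separable_in Z (R \<union> S)"
proof (rule separable_in_mono)
  show "separable_in Z (\<Union>i::nat. if i = 0 then R else S)"
    using assms by (intro separable_in_UN) simp
  show "R \<union> S \<subseteq> (\<Union>i::nat. if i = 0 then R else S)"
  proof
    fix x assume "x \<in> R \<union> S"
    then have "x \<in> (if (0::nat) = 0 then R else S) \<or> x \<in> (if (1::nat) = 0 then R else S)" by simp
    then show "x \<in> (\<Union>i::nat. if i = 0 then R else S)" by blast
  qed
qed

lemma in_closure_of_metric:
  "x \<in> mtopology_of Z closure_of S \<longleftrightarrow> x \<in> mspace Z \<and> (\<forall>e>0. \<exists>y\<in>S. y \<in> mspace Z \<and> mdist Z x y < e)"
proof -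
  interpret Metric_space "mspace Z" "mdist Z" by simp
  show ?thesis unfolding mtopology_of_def metric_closure_of by auto
qed

lemma separable_in_closure:
  assumes "separable_in Z S"
  shows "separable_in Z (mtopology_of Z closure_of S)"
proof -
  obtain C where C: "countable C" "C \<subseteq> mspace Z" "\<And>x e. x \<in> S \<Longrightarrow> e > 0 \<Longrightarrow> \<exists>c\<in>C. mdist Z x c < e"
    using assms unfolding separable_in_def by auto
  show ?thesis
  proof (rule separable_inI[OF C(1,2)])
    fix x and e :: real assume x: "x \<in> mtopology_of Z closure_of S" and e: "e > 0"
    then obtain y where y: "y \<in> S" "y \<in> mspace Z" "mdist Z x y < e / 2"
      unfolding in_closure_of_metric by (metis half_gt_zero)
    obtain c where c: "c \<in> C" "mdist Z y c < e / 2" using C(3)[OF y(1), of "e / 2"] e by auto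
    have "mdist Z x c \<le> mdist Z x y + mdist Z y c"
      using x y c C(2) by (intro mdist_triangle) (auto simp: in_closure_of_metric)
    then show "\<exists>c\<in>C. mdist Z x c < e" using c y by (intro bexI[of _ c]) auto
  qed
qed

text \<open>
  For every point \<open>d\<close> of the given set and every \<open>n\<close> choose a point of \<open>S\<close> within \<open>1 / (n + 1)\<close> of \<open>d\<close>.
  The intersection with \<open>S\<close> discards the choices for pairs \<open>(d, n)\<close> that have no such point.
\<close>

lemma separable_in_dense_subset:
  assumes "separable_in Z S" "S \<subseteq> mspace Z"
  obtains C where "countable C" "C \<subseteq> S" "\<And>x e. x \<in> S \<Longrightarrow> e > 0 \<Longrightarrow> \<exists>c\<in>C. mdist Z x c < e"
proof -
  obtain D where D: "countable D" "D \<subseteq> mspace Z" "\<And>x e. x \<in> S \<Longrightarrow> e > 0 \<Longrightarrow> \<exists>c\<in>D. mdist Z x c < e"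
    using assms unfolding separable_in_def by auto
  define pick where "pick = (\<lambda>(d, n::nat). SOME s. s \<in> S \<and> mdist Z s d < 1 / real (Suc n))"
  define C where "C = pick ` (D \<times> UNIV) \<inter> S"
  show thesis
  proof (rule that)
    show "countable C" unfolding C_def using D(1) by (intro countable_Int1) auto
    show "C \<subseteq> S" by (simp add: C_def)
    fix x and e :: real assume x: "x \<in> S" and e: "e > 0"
    obtain n where n: "1 / real (Suc n) < e / 2"
      using reals_Archimedean[of "e / 2"] e by (auto simp: inverse_eq_divide)
    obtain d where d: "d \<in> D" "mdist Z x d < 1 / real (Suc n)" using D(3)[OF x, of "1 / real (Suc n)"] by auto
    define s where "s = pick (d, n)"
    have s_eq: "s = (SOME s. s \<in> S \<and> mdist Z s d < 1 / real (Suc n))" by (simp add: s_def pick_def)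
    have s: "s \<in> S \<and> mdist Z s d < 1 / real (Suc n)"
      unfolding s_eq by (rule someI[of _ x]) (use x d(2) in simp)
    have "mdist Z x s \<le> mdist Z x d + mdist Z d s"
      using x s d(1) D(2) assms(2) by (intro mdist_triangle) auto
    also have "\<dots> < e" using d(2) s n by (simp add: mdist_commute)
    finally have "mdist Z x s < e" .
    moreover have "s \<in> C" using s d(1) by (auto simp: C_def s_def)
    ultimately show "\<exists>c\<in>C. mdist Z x c < e" by blast
  qed
qed

lemma separable_in_lipschitz_image:
  assumes S: "separable_in Z S" "S \<subseteq> mspace Z" and F: "\<And>x. x \<in> S \<Longrightarrow> F x \<in> mspace W"
    and L: "L > 0" "\<And>x y. x \<in> S \<Longrightarrow> y \<in> S \<Longrightarrow> mdist W (F x) (F y) \<le> L * mdist Z x y"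
  shows "separable_in W (F ` S)"
proof -
  obtain C where C: "countable C" "C \<subseteq> S" "\<And>x e. x \<in> S \<Longrightarrow> e > 0 \<Longrightarrow> \<exists>c\<in>C. mdist Z x c < e"
    using separable_in_dense_subset[OF S] by metis
  show ?thesis
  proof (rule separable_inI)
    show "countable (F ` C)" using C(1) by simp
    show "F ` C \<subseteq> mspace W" using C(2) F by auto
    fix z and e :: real assume "z \<in> F ` S" and e: "e > 0"
    then obtain x where x: "x \<in> S" "z = F x" by auto
    obtain c where c: "c \<in> C" "mdist Z x c < e / L" using C(3)[OF x(1), of "e / L"] e L(1) by auto
    have "mdist W (F x) (F c) \<le> L * mdist Z x c" using x c C(2) by (intro L(2)) auto
    also have "\<dots> < e" using c(2) L(1) by (simp add: field_simps)
    finally show "\<exists>w\<in>F ` C. mdist W z w < e" using c(1) x(2) by auto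
  qed
qed

lemma separable_in_rspace: "S \<subseteq> mspace (rspace m) \<Longrightarrow> separable_in (rspace m) S"
proof (rule separable_inI[where C="{..<m} \<rightarrow>\<^sub>E \<rat>"])
  show "countable ({..<m} \<rightarrow>\<^sub>E (\<rat> :: real set))" by (intro countable_PiE countable_rat) auto
  show "{..<m} \<rightarrow>\<^sub>E \<rat> \<subseteq> mspace (rspace m)" by (auto simp: PiE_iff)
  fix x :: "nat \<Rightarrow> real" and e :: real assume e: "e > 0"
  have "\<exists>q\<in>\<rat>. \<bar>x k - q\<bar> < e / (real m + 1)" for k
  proof -
    have "x k < x k + e / (real m + 1)" using e by (simp add: add_pos_nonneg)
    from Rats_dense_in_real[OF this] obtain r where "r \<in> \<rat>" "x k < r" "r < x k + e / (real m + 1)" by auto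
    then show ?thesis by (intro bexI[of _ r]) auto
  qed
  then obtain q where q: "\<And>k. q k \<in> \<rat>" "\<And>k. \<bar>x k - q k\<bar> < e / (real m + 1)" by metis
  have "mdist (rspace m) x (restrict q {..<m}) \<le> (\<Sum>k<m. \<bar>x k - restrict q {..<m} k\<bar>)"
    unfolding mdist_rspace by (rule L2_set_le_sum_abs)
  also have "\<dots> \<le> real m * (e / (real m + 1))"
    using sum_bounded_above[of "{..<m}" "\<lambda>k. \<bar>x k - restrict q {..<m} k\<bar>" "e / (real m + 1)"] q(2)
    by (auto simp: less_imp_le)
  also have "\<dots> < e" using e by (simp add: field_simps)
  finally show "\<exists>c\<in>{..<m} \<rightarrow>\<^sub>E \<rat>. mdist (rspace m) x c < e"
    using q(1) by (intro bexI[of _ "restrict q {..<m}"]) auto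
qed

section \<open>Parametrised pieces\<close>

lemma jacobian_det_cong:
  assumes "x \<in> A" "length g = m" "length h = m" "\<And>i y. i < m \<Longrightarrow> y \<in> A \<Longrightarrow> (g ! i) y = (h ! i) y"
  shows "jacobian_det m A g x = jacobian_det m A h x"
proof -
  have "grad_within m A (g ! i) x = grad_within m A (h ! i) x" if "i < m" for i
    unfolding grad_within_def using assms(1) assms(4)[OF that] by (simp cong: ball_cong)
  then have "Matrix.mat m m (\<lambda>(i, k). grad_within m A (g ! i) x k) =
      Matrix.mat m m (\<lambda>(i, k). grad_within m A (h ! i) x k)"
    by (intro Matrix.cong_mat) auto
  then show ?thesis by (simp add: jacobian_det_def)
qed

text \<open>
  The gradient relative to \<open>A\<close> is a choice that depends only on the restriction to \<open>A\<close>, so functions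
  that agree on \<open>A\<close> have literally the same Jacobian determinant at every point of \<open>A\<close>.
\<close>

lemma param_current_corresponds:
  assumes "\<phi> ` A \<subseteq> Y"
  shows "corresponds m Z Y (param_current m A \<phi> \<theta>) W F (param_current m A (F \<circ> \<phi>) \<theta>)"
  unfolding corresponds_def
proof (intro allI impI)
  fix f' \<pi>' f \<pi> assume f': "(f', \<pi>') \<in> test_forms m Z" and f: "(f, \<pi>) \<in> test_forms m W"
    and ag: "forms_agree Y F f' \<pi>' f \<pi>"
  have len: "length \<pi> = m" "length \<pi>' = m" using f f' by (auto simp: test_forms_def)
  have \<phi>: "\<phi> x \<in> Y" if "x \<in> A" for x using that assms by auto
  have J: "jacobian_det m A (map (\<lambda>p. p \<circ> (F \<circ> \<phi>)) \<pi>) x = jacobian_det m A (map (\<lambda>p. p \<circ> \<phi>) \<pi>') x"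
    if "x \<in> A" for x
    using that len forms_agree_slot[OF ag] \<phi> by (intro jacobian_det_cong) auto
  show "param_current m A (F \<circ> \<phi>) \<theta> f \<pi> = param_current m A \<phi> \<theta> f' \<pi>'"
    unfolding param_current_def set_lebesgue_integral_def
    using ag \<phi> J by (intro Bochner_Integration.integral_cong) (auto simp: forms_agree_def indicator_def)
qed

lemma mdist_rspace_borel_measurable: "(\<lambda>x. mdist (rspace m) x c) \<in> borel_measurable (rborel m)"
proof -
  have comp: "(\<lambda>x. x k) \<in> borel_measurable (rborel m)" if "k \<in> {..<m}" for k
    using measurable_component_singleton[OF that, of "\<lambda>_. lborel"] by (simp add: rborel_def)
  show ?thesis
    unfolding mdist_rspace L2_set_def
    by (intro measurable_compose[OF _ borel_measurable_sqrt] borel_measurable_sum borel_measurable_power borel_measurable_diff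
        borel_measurable_const comp)
qed

text \<open>
  The set \<open>A\<close> may be replaced by a countable dense subset in McShane's formula, and a countable infimum of
  measurable functions is measurable.
\<close>

lemma lip_le_measurable_extension:
  assumes A: "A \<subseteq> mspace (rspace m)" and g: "lip_le (rspace m) A L g" "\<And>x. x \<in> A \<Longrightarrow> 0 \<le> g x"
  obtains h where "h \<in> borel_measurable (rborel m)" "\<And>x. x \<in> A \<Longrightarrow> h x = g x"
proof -
  obtain C where C: "countable C" "C \<subseteq> A" "\<And>x e. x \<in> A \<Longrightarrow> e > 0 \<Longrightarrow> \<exists>c\<in>C. mdist (rspace m) x c < e"
    using separable_in_dense_subset[OF separable_in_rspace[OF A] A] by metis
  have L: "0 \<le> L" using g(1) by (rule lip_le_nonneg)
  have gC: "lip_le (rspace m) C L g" using lip_le_subset[OF g(1) C(2)] .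
  have CZ: "C \<subseteq> mspace (rspace m)" using C(2) A by (rule order_trans)
  let ?h = "mcshane (rspace m) C L g"
  show thesis
  proof (rule that)
    show "?h \<in> borel_measurable (rborel m)"
      unfolding mcshane_def
    proof (rule borel_measurable_cINF[OF C(1)])
      show "(\<lambda>x. g c + L * mdist (rspace m) x c) \<in> borel_measurable (rborel m)" for c
        by (intro borel_measurable_add borel_measurable_times borel_measurable_const mdist_rspace_borel_measurable)
      show "bdd_below ((\<lambda>c. g c + L * mdist (rspace m) x c) ` C)" for x
        using g(2) C(2) L by (intro bdd_belowI2[where m=0] add_nonneg_nonneg mult_nonneg_nonneg) auto
    qed
    fix x assume x: "x \<in> A"
    have "\<bar>?h x - g x\<bar> \<le> 0 + e" if e: "e > 0" for e
    proof -
      obtain c where c: "c \<in> C" "mdist (rspace m) x c < e / (2 * L + 1)"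
        using C(3)[OF x, of "e / (2 * L + 1)"] e L by auto
      have xZ: "x \<in> mspace (rspace m)" and cZ: "c \<in> mspace (rspace m)" and cA: "c \<in> A"
        using x A c(1) CZ C(2) by auto
      have "\<bar>?h x - ?h c\<bar> \<le> L * mdist (rspace m) x c"
        by (rule lip_leD[OF lip_le_mcshane[OF gC CZ] xZ cZ])
      moreover have "?h c = g c" by (rule mcshane_eq[OF gC CZ c(1)])
      moreover have "\<bar>g x - g c\<bar> \<le> L * mdist (rspace m) x c" by (rule lip_leD[OF g(1) x cA])
      ultimately have "\<bar>?h x - g x\<bar> \<le> (2 * L) * mdist (rspace m) x c" by (simp add: algebra_simps abs_le_iff)
      also have "\<dots> \<le> (2 * L + 1) * (e / (2 * L + 1))" using L c(2) by (intro mult_mono) auto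
      finally show ?thesis using L by simp
    qed
    then have "\<bar>?h x - g x\<bar> \<le> 0" by (rule field_le_epsilon)
    then show "?h x = g x" by simp
  qed
qed

text \<open>
  Multiplying \<open>f\<close> by \<open>\<eta>\<close> multiplies the integrand \<open>w\<close> by a measurable function with values in \<open>[0, 1]\<close> on
  \<open>A\<close>. If \<open>w\<close> is integrable, then so are both parts and the values add up; otherwise the
  value for \<open>f\<close> is \<open>0\<close> by convention and there is nothing to prove.
\<close>

lemma param_current_splittable:
  assumes A: "A \<in> sets (rborel m)" and \<phi>: "bi_lipschitz_on m A Z \<phi>"
  shows "splittable m Z (param_current m A \<phi> \<theta>)"
  unfolding splittable_def
proof (intro allI impI)
  fix f \<pi> \<eta> assume f: "(f, \<pi>) \<in> test_forms m Z" and \<eta>: "unit_lipschitz Z \<eta>"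
  have AR: "A \<subseteq> mspace (rspace m)"
    using sets.sets_into_space[OF A] by (simp add: rborel_def space_PiM)
  obtain L where L: "lip_le Z (mspace Z) L \<eta>" using \<eta> by (auto simp: unit_lipschitz_def lipschitz_fun_iff_lip_le)
  obtain K where K: "K > 0" "\<And>x y. x \<in> A \<Longrightarrow> y \<in> A \<Longrightarrow> mdist Z (\<phi> x) (\<phi> y) \<le> K * mdist (rspace m) x y"
    using \<phi> unfolding bi_lipschitz_on_def by blast
  have \<phi>A: "\<phi> x \<in> mspace Z" if "x \<in> A" for x using \<phi> that by (auto simp: bi_lipschitz_on_def)
  have "lip_le (rspace m) A (L * K) (\<lambda>x. \<eta> (\<phi> x))"
    unfolding lip_le_def
  proof (intro conjI ballI)
    show "0 \<le> L * K" using lip_le_nonneg[OF L] K(1) by simp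
    fix x y assume xy: "x \<in> A" "y \<in> A"
    have "\<bar>\<eta> (\<phi> x) - \<eta> (\<phi> y)\<bar> \<le> L * mdist Z (\<phi> x) (\<phi> y)" by (intro lip_leD[OF L] \<phi>A xy)
    also have "\<dots> \<le> L * (K * mdist (rspace m) x y)" by (intro mult_left_mono K(2) xy lip_le_nonneg[OF L])
    finally show "\<bar>\<eta> (\<phi> x) - \<eta> (\<phi> y)\<bar> \<le> L * K * mdist (rspace m) x y" by (simp add: mult.assoc)
  qed
  then obtain E where E: "E \<in> borel_measurable (rborel m)" "\<And>x. x \<in> A \<Longrightarrow> E x = \<eta> (\<phi> x)"
    using lip_le_measurable_extension[OF AR, of "L * K" "\<lambda>x. \<eta> (\<phi> x)"] \<eta> unfolding unit_lipschitz_def by metis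
  have Em: "E \<in> borel_measurable (rlebesgue m)" unfolding rlebesgue_def using E(1) by (rule measurable_completion)
  define w where "w x = indicator A x * (real (\<theta> x) * f (\<phi> x) * jacobian_det m A (map (\<lambda>p. p \<circ> \<phi>) \<pi>) x)" for x
  have P: "param_current m A \<phi> \<theta> f \<pi> = (LINT x|rlebesgue m. w x)"
    by (simp add: param_current_def set_lebesgue_integral_def w_def)
  have P1: "param_current m A \<phi> \<theta> (\<lambda>x. \<eta> x * f x) \<pi> = (LINT x|rlebesgue m. E x * w x)"
    unfolding param_current_def set_lebesgue_integral_def
    using E(2) by (intro Bochner_Integration.integral_cong) (auto simp: w_def indicator_def)
  have P2: "param_current m A \<phi> \<theta> (\<lambda>x. (1 - \<eta> x) * f x) \<pi> = (LINT x|rlebesgue m. (1 - E x) * w x)"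
    unfolding param_current_def set_lebesgue_integral_def
    using E(2) by (intro Bochner_Integration.integral_cong) (auto simp: w_def indicator_def)
  show "\<bar>param_current m A \<phi> \<theta> f \<pi>\<bar> \<le> \<bar>param_current m A \<phi> \<theta> (\<lambda>x. \<eta> x * f x) \<pi>\<bar> +
      \<bar>param_current m A \<phi> \<theta> (\<lambda>x. (1 - \<eta> x) * f x) \<pi>\<bar>"
  proof (cases "integrable (rlebesgue m) w")
    case True
    have i: "integrable (rlebesgue m) (\<lambda>x. E x * w x)"
    proof (rule Bochner_Integration.integrable_bound[OF True])
      show "(\<lambda>x. E x * w x) \<in> borel_measurable (rlebesgue m)"
        using Em borel_measurable_integrable[OF True] by (rule borel_measurable_times)
      have "\<bar>E x * w x\<bar> \<le> \<bar>w x\<bar>" for x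
      proof (cases "x \<in> A")
        case True
        then have "\<bar>E x\<bar> \<le> 1" using E(2) \<eta> by (simp add: unit_lipschitz_def)
        then show ?thesis unfolding abs_mult by (intro mult_left_le_one_le) auto
      qed (simp add: w_def)
      then show "AE x in rlebesgue m. norm (E x * w x) \<le> norm (w x)" by simp
    qed
    have "integrable (rlebesgue m) (\<lambda>x. w x - E x * w x)" using True i by simp
    then have i2: "integrable (rlebesgue m) (\<lambda>x. (1 - E x) * w x)" by (simp add: algebra_simps)
    have "(LINT x|rlebesgue m. w x) = (LINT x|rlebesgue m. E x * w x + (1 - E x) * w x)"
      by (simp add: algebra_simps)
    also have "\<dots> = (LINT x|rlebesgue m. E x * w x) + (LINT x|rlebesgue m. (1 - E x) * w x)"
      using i i2 by simp
    finally show ?thesis unfolding P P1 P2 by simp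
  next
    case False
    then show ?thesis unfolding P by (simp add: not_integrable_integral_eq)
  qed
qed

section \<open>Integral currents\<close>

definition rectifiable_atlas :: "nat \<Rightarrow> 'a metric \<Rightarrow> 'a set \<Rightarrow> 'a functional \<Rightarrow> (nat \<Rightarrow> (nat \<Rightarrow> real) set) \<Rightarrow>
    (nat \<Rightarrow> (nat \<Rightarrow> real) \<Rightarrow> 'a) \<Rightarrow> (nat \<Rightarrow> (nat \<Rightarrow> real) \<Rightarrow> nat) \<Rightarrow> bool" where
  "rectifiable_atlas m Z Y T A \<phi> \<theta> \<longleftrightarrow>
     (\<forall>i. A i \<in> sets (rborel m) \<and>
        compactin (mtopology_of (rspace m)) (mtopology_of (rspace m) closure_of A i) \<and>
        bi_lipschitz_on m (A i) Z (\<phi> i) \<and>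
        (\<forall>x\<in>A i. \<theta> i x \<ge> 1) \<and> set_integrable (rlebesgue m) (A i) (\<lambda>x. real (\<theta> i x))) \<and>
     disjoint_family (\<lambda>i. \<phi> i ` A i) \<and>
     (\<forall>(f, \<pi>) \<in> test_forms m Z. (\<lambda>i. param_current m (A i) (\<phi> i) (\<theta> i) f \<pi>) sums T f \<pi>) \<and>
     mass m Z T = (\<Sum>i. mass m Z (param_current m (A i) (\<phi> i) (\<theta> i))) \<and>
     (\<forall>i. \<phi> i ` A i \<subseteq> Y)"

text \<open>
  Integer rectifiability that records a set \<open>Y\<close> containing all points or pieces, so that the current can be
  transported by a map that is isometric on \<open>Y\<close> only.
\<close>

definition rectifiable_within :: "nat \<Rightarrow> 'a metric \<Rightarrow> 'a set \<Rightarrow> 'a functional \<Rightarrow> bool" where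
  "rectifiable_within m Z Y T \<longleftrightarrow>
     (if m = 0 then
        \<exists>P (c :: 'a \<Rightarrow> int). finite P \<and> P \<subseteq> mspace Z \<and> P \<subseteq> Y \<and>
          (\<forall>(f, \<pi>) \<in> test_forms 0 Z. T f \<pi> = (\<Sum>p\<in>P. of_int (c p) * f p))
      else \<exists>A \<phi> \<theta>. rectifiable_atlas m Z Y T A \<phi> \<theta>)"

lemma rectifiable_within_imp:
  assumes "rectifiable_within m Z Y T"
  shows "integer_rectifiable m Z T"
proof (cases "m = 0")
  case True
  then show ?thesis
    using assms unfolding rectifiable_within_def integer_rectifiable_def by auto
next
  case False
  then obtain A \<phi> \<theta> where "rectifiable_atlas m Z Y T A \<phi> \<theta>"
    using assms unfolding rectifiable_within_def by auto
  then show ?thesis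
    unfolding integer_rectifiable_def rectifiable_atlas_def if_not_P[OF False]
    by (intro exI[of _ A] exI[of _ \<phi>] exI[of _ \<theta>]) simp
qed

lemma rectifiable_within_mono:
  assumes "rectifiable_within m Z Y T" "Y \<subseteq> X"
  shows "rectifiable_within m Z X T"
proof (cases "m = 0")
  case True
  then obtain P and c :: "'a \<Rightarrow> int" where "finite P \<and> P \<subseteq> mspace Z \<and> P \<subseteq> Y \<and>
      (\<forall>(f, \<pi>) \<in> test_forms 0 Z. T f \<pi> = (\<Sum>p\<in>P. of_int (c p) * f p))"
    using assms(1) unfolding rectifiable_within_def by auto
  then show ?thesis
    unfolding rectifiable_within_def if_P[OF True] using assms(2) by (intro exI[of _ P] exI[of _ c]) auto
next
  case False
  then obtain A \<phi> \<theta> where at: "rectifiable_atlas m Z Y T A \<phi> \<theta>"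
    using assms(1) unfolding rectifiable_within_def by auto
  then have "\<phi> i ` A i \<subseteq> X" for i
    using order_trans[OF _ assms(2)] by (simp add: rectifiable_atlas_def)
  then have "rectifiable_atlas m Z X T A \<phi> \<theta>" using at by (simp add: rectifiable_atlas_def)
  then show ?thesis unfolding rectifiable_within_def if_not_P[OF False] by blast
qed

lemma integer_rectifiable_atlas:
  assumes "integer_rectifiable m Z T" "m \<noteq> 0"
  shows "\<exists>A \<phi> \<theta>. rectifiable_atlas m Z (mspace Z) T A \<phi> \<theta>"
proof -
  have "\<phi> ` A \<subseteq> mspace Z" if "bi_lipschitz_on m A Z \<phi>" for A and \<phi> :: "(nat \<Rightarrow> real) \<Rightarrow> 'a"
    using that by (auto simp: bi_lipschitz_on_def)
  then show ?thesis
    using assms(1) unfolding integer_rectifiable_def rectifiable_atlas_def if_not_P[OF assms(2)]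
    by (elim exE, intro exI) (elim conjE, intro conjI, assumption+, simp)
qed

lemma integer_rectifiable_separable:
  assumes "integer_rectifiable m Z T"
  obtains Y where "Y \<subseteq> mspace Z" "separable_in Z Y" "rectifiable_within m Z Y T"
proof (cases "m = 0")
  case True
  then obtain P and c :: "'a \<Rightarrow> int" where P: "finite P" "P \<subseteq> mspace Z"
      "\<forall>(f, \<pi>) \<in> test_forms 0 Z. T f \<pi> = (\<Sum>p\<in>P. of_int (c p) * f p)"
    using assms unfolding integer_rectifiable_def by auto
  show thesis
  proof (rule that[OF P(2)])
    show "separable_in Z P"
    proof (rule separable_inI[OF countable_finite[OF P(1)] P(2)])
      fix x and e :: real assume "x \<in> P" "e > 0"
      then show "\<exists>c\<in>P. mdist Z x c < e" using P(2) by (intro bexI[of _ x]) auto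
    qed
    show "rectifiable_within m Z P T"
      unfolding rectifiable_within_def using True P by (simp, blast)
  qed
next
  case False
  then obtain A \<phi> \<theta> where at: "rectifiable_atlas m Z (mspace Z) T A \<phi> \<theta>"
    using integer_rectifiable_atlas[OF assms] by metis
  let ?Y = "\<Union>i. \<phi> i ` A i"
  have piece: "\<phi> i ` A i \<subseteq> mspace Z" for i using at by (simp add: rectifiable_atlas_def)
  then have sub: "?Y \<subseteq> mspace Z" by blast
  have bi: "bi_lipschitz_on m (A i) Z (\<phi> i)" "A i \<in> sets (rborel m)" for i
    using at by (auto simp: rectifiable_atlas_def)
  show thesis
  proof (rule that[OF sub])
    show "separable_in Z ?Y"
    proof (rule separable_in_UN)
      fix i
      have AR: "A i \<subseteq> mspace (rspace m)"
        using sets.sets_into_space[OF bi(2)[of i]] by (simp add: rborel_def space_PiM)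
      obtain C where "C > 0" "\<And>x y. x \<in> A i \<Longrightarrow> y \<in> A i \<Longrightarrow> mdist Z (\<phi> i x) (\<phi> i y) \<le> C * mdist (rspace m) x y"
        using bi(1)[of i] unfolding bi_lipschitz_on_def by blast
      then show "separable_in Z (\<phi> i ` A i)"
        using piece[of i] by (intro separable_in_lipschitz_image[OF separable_in_rspace[OF AR] AR]) auto
    qed
    have "rectifiable_atlas m Z ?Y T A \<phi> \<theta>" using at by (auto simp: rectifiable_atlas_def)
    then show "rectifiable_within m Z ?Y T" using False by (auto simp: rectifiable_within_def)
  qed
qed

lemma rectifiable_within_determined:
  assumes T: "rectifiable_within m Z Y T"
  shows "corresponds m Z Y T Z id T"
  unfolding corresponds_def
proof (intro allI impI)
  fix f' \<pi>' f \<pi> assume f': "(f', \<pi>') \<in> test_forms m Z" and f: "(f, \<pi>) \<in> test_forms m Z"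
    and ag: "forms_agree Y id f' \<pi>' f \<pi>"
  show "T f \<pi> = T f' \<pi>'"
  proof (cases "m = 0")
    case True
    then obtain P and c :: "'a \<Rightarrow> int" where P: "P \<subseteq> Y"
        "\<forall>(f, \<pi>) \<in> test_forms m Z. T f \<pi> = (\<Sum>p\<in>P. of_int (c p) * f p)"
      using T unfolding rectifiable_within_def by auto
    have Tf: "T f \<pi> = (\<Sum>p\<in>P. of_int (c p) * f p)" if "(f, \<pi>) \<in> test_forms m Z" for f \<pi>
      using P(2) that by fast
    show ?thesis
      unfolding Tf[OF f] Tf[OF f'] using P(1) ag by (intro sum.cong) (auto simp: forms_agree_def)
  next
    case False
    then obtain A \<phi> \<theta> where at: "rectifiable_atlas m Z Y T A \<phi> \<theta>"
      using T unfolding rectifiable_within_def by auto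
    have s: "(\<lambda>i. param_current m (A i) (\<phi> i) (\<theta> i) g \<rho>) sums T g \<rho>" if "(g, \<rho>) \<in> test_forms m Z" for g \<rho>
      using at that unfolding rectifiable_atlas_def by fast
    have "param_current m (A i) (id \<circ> \<phi> i) (\<theta> i) f \<pi> = param_current m (A i) (\<phi> i) (\<theta> i) f' \<pi>'" for i
      using at by (intro correspondsD[OF param_current_corresponds f' f ag]) (auto simp: rectifiable_atlas_def)
    then show ?thesis using s[OF f] s[OF f'] sums_unique2 by (simp add: id_def o_def)
  qed
qed

text \<open>
  Composing the parametrisations with \<open>F\<close> keeps them bi-Lipschitz with disjoint images. The mass of the
  current and the masses of all pieces are preserved, hence so is their additivity.
\<close>

lemma rectifiable_within_transport:
  assumes F: "isometric_on Z Y W F" and Y: "closedin (mtopology_of Z) Y" "closedin (mtopology_of W) (F ` Y)"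
    and c: "corresponds m Z Y T W F T'" and s: "splittable m Z T" "splittable m W T'"
    and T: "rectifiable_within m Z Y T"
  shows "rectifiable_within m W (F ` Y) T'"
proof (cases "m = 0")
  case True
  then obtain P and k :: "'a \<Rightarrow> int" where P: "finite P" "P \<subseteq> Y"
      "\<forall>(f, \<pi>) \<in> test_forms m Z. T f \<pi> = (\<Sum>p\<in>P. of_int (k p) * f p)"
    using T unfolding rectifiable_within_def by auto
  have Tf: "T f \<pi> = (\<Sum>p\<in>P. of_int (k p) * f p)" if "(f, \<pi>) \<in> test_forms m Z" for f \<pi>
    using P(3) that by fast
  have inj: "inj_on F P" using isometric_on_inj[OF F] P(2) by (rule inj_on_subset)
  have "T' f \<pi> = (\<Sum>q\<in>F ` P. of_int (k (inv_into Y F q)) * f q)" if f: "(f, \<pi>) \<in> test_forms m W" for f \<pi>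
  proof -
    obtain f' \<pi>' where f': "(f', \<pi>') \<in> test_forms m Z" "forms_agree Y F f' \<pi>' f \<pi>"
      using pull_back_form[OF F f] by metis
    have "T' f \<pi> = (\<Sum>p\<in>P. of_int (k p) * f' p)"
      using correspondsD[OF c f'(1) f f'(2)] Tf[OF f'(1)] by simp
    also have "\<dots> = (\<Sum>p\<in>P. of_int (k (inv_into Y F (F p))) * f (F p))"
      using P(2) f'(2) isometric_on_inj[OF F] by (intro sum.cong) (auto simp: forms_agree_def subset_iff)
    also have "\<dots> = (\<Sum>q\<in>F ` P. of_int (k (inv_into Y F q)) * f q)"
      by (simp add: sum.reindex[OF inj])
    finally show ?thesis .
  qed
  then show ?thesis
    unfolding rectifiable_within_def using True P isometric_onD(2)[OF F]
    by (simp, intro exI[of _ "F ` P"] conjI exI[of _ "\<lambda>q. k (inv_into Y F q)"]) auto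
next
  case False
  then obtain A \<phi> \<theta> where at: "rectifiable_atlas m Z Y T A \<phi> \<theta>"
    using T unfolding rectifiable_within_def by auto
  have A: "A i \<in> sets (rborel m)" "bi_lipschitz_on m (A i) Z (\<phi> i)" "\<phi> i ` A i \<subseteq> Y" for i
    using at by (auto simp: rectifiable_atlas_def)
  have AY: "\<phi> i x \<in> Y" if "x \<in> A i" for i x using A(3) that by auto
  note pc = param_current_corresponds[OF A(3), of m Z _ _ W F]
  have bi: "bi_lipschitz_on m (A i) W (F \<circ> \<phi> i)" for i
    using A(2)[of i] isometric_onD(2,3)[OF F] AY[of _ i]
    unfolding bi_lipschitz_on_def by (auto simp: Pi_iff)
  have ps: "splittable m Z (param_current m (A i) (\<phi> i) (\<theta> i))"
    "splittable m W (param_current m (A i) (F \<circ> \<phi> i) (\<theta> i))" for i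
    by (rule param_current_splittable[OF A(1,2)]) (rule param_current_splittable[OF A(1) bi])
  have "rectifiable_atlas m W (F ` Y) T' A (\<lambda>i. F \<circ> \<phi> i) \<theta>"
    unfolding rectifiable_atlas_def
  proof (intro conjI allI)
    fix i
    show "A i \<in> sets (rborel m)" by (rule A(1))
    show "compactin (mtopology_of (rspace m)) (mtopology_of (rspace m) closure_of A i)"
      "\<forall>x\<in>A i. \<theta> i x \<ge> 1" "set_integrable (rlebesgue m) (A i) (\<lambda>x. real (\<theta> i x))"
      using at by (auto simp: rectifiable_atlas_def)
    show "bi_lipschitz_on m (A i) W (F \<circ> \<phi> i)" by (rule bi)
    show "(F \<circ> \<phi> i) ` A i \<subseteq> F ` Y" using A(3)[of i] by (auto simp: image_comp[symmetric])
  next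
    have "disjoint_family (\<lambda>i. \<phi> i ` A i)" using at by (simp add: rectifiable_atlas_def)
    then show "disjoint_family (\<lambda>i. (F \<circ> \<phi> i) ` A i)"
      unfolding disjoint_family_on_def image_comp[symmetric]
      using inj_on_image_Int[OF isometric_on_inj[OF F] A(3) A(3)] by (metis image_empty)
  next
    show "\<forall>(f, \<pi>)\<in>test_forms m W. (\<lambda>i. param_current m (A i) (F \<circ> \<phi> i) (\<theta> i) f \<pi>) sums T' f \<pi>"
    proof (intro ballI, clarify)
      fix f \<pi> assume f: "(f, \<pi>) \<in> test_forms m W"
      obtain f' \<pi>' where f': "(f', \<pi>') \<in> test_forms m Z" "forms_agree Y F f' \<pi>' f \<pi>"
        using pull_back_form[OF F f] by metis
      have "(\<lambda>i. param_current m (A i) (\<phi> i) (\<theta> i) f' \<pi>') sums T f' \<pi>'"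
        using at f'(1) unfolding rectifiable_atlas_def by fast
      then show "(\<lambda>i. param_current m (A i) (F \<circ> \<phi> i) (\<theta> i) f \<pi>) sums T' f \<pi>"
        using correspondsD[OF c f'(1) f f'(2)] correspondsD[OF pc f'(1) f f'(2)] by simp
    qed
  next
    have "mass m W T' = mass m Z T" by (rule mass_transport_eq[OF F Y c s])
    also have "\<dots> = (\<Sum>i. mass m Z (param_current m (A i) (\<phi> i) (\<theta> i)))"
      using at by (simp add: rectifiable_atlas_def)
    also have "\<dots> = (\<Sum>i. mass m W (param_current m (A i) (F \<circ> \<phi> i) (\<theta> i)))"
      by (intro suminf_cong mass_transport_eq[OF F Y pc ps, symmetric])
    finally show "mass m W T' = (\<Sum>i. mass m W (param_current m (A i) (F \<circ> \<phi> i) (\<theta> i)))" .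
  qed
  then show ?thesis using False by (auto simp: rectifiable_within_def)
qed

lemma corresponds_boundary:
  assumes c: "corresponds (Suc n) Z Y T W F T'"
  shows "corresponds n Z Y (boundary T) W F (boundary T')"
  unfolding corresponds_def
proof (intro allI impI)
  fix f' \<pi>' f \<pi> assume f': "(f', \<pi>') \<in> test_forms n Z" and f: "(f, \<pi>) \<in> test_forms n W"
    and ag: "forms_agree Y F f' \<pi>' f \<pi>"
  have "(\<lambda>_. 1, f' # \<pi>') \<in> test_forms (Suc n) Z" "(\<lambda>_. 1, f # \<pi>) \<in> test_forms (Suc n) W"
    using f f' by (auto simp: test_forms_def bounded_image_iff lipschitz_fun_iff_lip_le intro: exI[of _ 0] exI[of _ 1])
  from correspondsD[OF c this] ag show "boundary T' f \<pi> = boundary T f' \<pi>'"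
    by (auto simp: boundary_def forms_agree_def)
qed

lemma integral_current_transport:
  assumes F: "isometric_on Z Y W F" and Y: "closedin (mtopology_of Z) Y" "closedin (mtopology_of W) (F ` Y)"
    and c: "corresponds m Z Y T W F T'" and T: "integral_current m Z T" "rectifiable_within m Z Y T"
  shows "integral_current m W T'"
proof -
  have cur: "current m Z T" using T(1) by (simp add: integral_current_def)
  have cur': "current m W T'" by (rule current_transport[OF F Y(1) c cur])
  have s: "splittable m Z T" "splittable m W T'"
    using cur cur' by (auto simp: current_def intro: multilinear_splittable)
  have "has_finite_mass (m - 1) W (boundary T')" if "m \<ge> 1"
  proof -
    have "corresponds (Suc (m - 1)) Z Y T W F T'" using c that by simp
    then show ?thesis
      using has_finite_mass_transport[OF F Y(1) corresponds_boundary] T(1) that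
      by (auto simp: integral_current_def)
  qed
  then show ?thesis
    using cur' rectifiable_within_imp[OF rectifiable_within_transport[OF F Y c s T(2)]]
    by (simp add: integral_current_def)
qed

text \<open>
  Transporting the mass measure by the identity shows that it is concentrated on \<open>Y\<close>, since it is the least
  mass bound. A point off \<open>Y\<close> has small balls of measure \<open>0\<close>, hence density \<open>0\<close>.
\<close>

lemma canonical_set_subset:
  assumes T: "splittable m Z T" "has_finite_mass m Z T" and Y: "closedin (mtopology_of Z) Y"
    and c: "corresponds m Z Y T Z id T"
  shows "canonical_set m Z T \<subseteq> Y"
proof
  fix p assume "p \<in> canonical_set m Z T"
  then have p: "p \<in> mspace Z" and pos: "Liminf (at_right 0) (\<lambda>r. ereal (measure (mass_measure m Z T) (mball_of Z p r) /
       (unit_ball_vol (real m) * r ^ m))) > 0" by (auto simp: canonical_set_def)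
  let ?\<mu> = "mass_measure m Z T"
  note \<mu> = mass_measure_least[OF T]
  note \<mu>' = mass_boundD[OF \<mu>(1)]
  interpret finite_measure ?\<mu> by (rule \<mu>'(1))
  have YZ: "Y \<subseteq> mspace Z" using closedin_subset[OF Y] by simp
  have iso: "isometric_on Z Y Z id" using YZ by (auto simp: isometric_on_def)
  obtain \<nu> where \<nu>: "mass_bound m Z T \<nu>" "emeasure \<nu> (mspace Z) = emeasure ?\<mu> Y"
    using mass_bound_transport[OF iso Y c \<mu>(1)] .
  have "emeasure ?\<mu> (mspace Z) \<le> emeasure ?\<mu> Y"
    using \<mu>(2)[OF \<nu>(1) sets.top] \<nu>(2) by simp
  then have le: "measure ?\<mu> (space ?\<mu>) \<le> measure ?\<mu> Y" by (simp add: \<mu>'(3) emeasure_eq_measure)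
  have Y\<mu>: "Y \<in> sets ?\<mu>" using closedin_borel[OF Y] \<mu>'(2) by simp
  have null: "measure ?\<mu> (space ?\<mu> - Y) = 0"
    using finite_measure_compl[OF Y\<mu>] le measure_nonneg[of ?\<mu> "space ?\<mu> - Y"] by linarith
  show "p \<in> Y"
  proof (rule ccontr)
    assume "p \<notin> Y"
    interpret M: Metric_space "mspace Z" "mdist Z" by simp
    obtain r where r: "r > 0" "disjnt Y (mball_of Z p r)"
      using Y p \<open>p \<notin> Y\<close> unfolding mtopology_of_def mball_of_def M.closedin_metric by blast
    have "measure ?\<mu> (mball_of Z p t) = 0" if "t < r" for t
    proof -
      have "mball_of Z p t \<subseteq> space ?\<mu> - Y"
        using r(2) that by (auto simp: disjnt_iff \<mu>'(3))
      then have "measure ?\<mu> (mball_of Z p t) \<le> measure ?\<mu> (space ?\<mu> - Y)"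
        using Y\<mu> by (intro finite_measure_mono) auto
      then show ?thesis using null measure_nonneg[of ?\<mu> "mball_of Z p t"] by linarith
    qed
    moreover have "eventually (\<lambda>t. t < r) (at_right 0)"
      using r(1) by (auto simp: eventually_at_right_field)
    ultimately have "eventually (\<lambda>t. ereal (measure ?\<mu> (mball_of Z p t) / (unit_ball_vol (real m) * t ^ m)) = 0) (at_right 0)"
      by (auto elim!: eventually_mono simp: zero_ereal_def)
    then have "Liminf (at_right 0) (\<lambda>t. ereal (measure ?\<mu> (mball_of Z p t) / (unit_ball_vol (real m) * t ^ m))) =
        Liminf (at_right (0::real)) (\<lambda>_. 0)" by (rule Liminf_eq)
    also have "\<dots> = 0" by (rule Liminf_const) simp
    finally show False using pos by simp
  qed
qed

section \<open>Gluing separable spaces inside the space of bounded sequences\<close>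

abbreviation linf :: "(nat \<Rightarrow> real) metric" where
  "linf \<equiv> funspace UNIV euclidean_metric"

lemma mspace_linf_iff: "x \<in> mspace linf \<longleftrightarrow> (\<exists>B. \<forall>n. \<bar>x n\<bar> \<le> B)"
proof -
  have "x \<in> mspace linf \<longleftrightarrow> Met_TC.mbounded (range x)"
    by (simp add: Metric_space.fspace_def[OF Met_TC.Metric_space_axioms])
  also have "\<dots> \<longleftrightarrow> bounded (range x)" by simp
  also have "\<dots> \<longleftrightarrow> (\<exists>B. \<forall>n. \<bar>x n\<bar> \<le> B)" by (auto simp: bounded_iff)
  finally show ?thesis .
qed

lemma mdist_linf_le:
  assumes "x \<in> mspace linf" "y \<in> mspace linf"
  shows "mdist linf x y \<le> a \<longleftrightarrow> (\<forall>n. \<bar>x n - y n\<bar> \<le> a)"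
  using funspace_mdist_le[OF assms] by (simp add: dist_real_def)

lemma mcomplete_linf: "mcomplete_of linf"
  using Met_TC.mcomplete_funspace[where ?'a=real, of UNIV] Met_TC.Self_def[where ?'a=real]
  by (simp add: euclidean_metric_def complete_UNIV mcomplete_iff_complete)

text \<open>
  The principle of the Kuratowski embedding: coordinates that are \<open>1\<close>-Lipschitz cannot increase distances,
  and the distances to a dense set of points recover them.
\<close>

lemma isometric_on_linf:
  assumes S: "S \<subseteq> mspace N" and a: "a \<in> S" "f a = (\<lambda>_. 0)"
    and lip: "\<And>x y n. x \<in> S \<Longrightarrow> y \<in> S \<Longrightarrow> \<bar>f x n - f y n\<bar> \<le> mdist N x y"
    and C: "\<And>x e. x \<in> S \<Longrightarrow> e > 0 \<Longrightarrow> \<exists>c\<in>C. mdist N x c < e" "C \<subseteq> mspace N"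
    and coord: "\<And>c. c \<in> C \<Longrightarrow> \<exists>n k. \<forall>x\<in>S. f x n = mdist N x c - k"
  shows "isometric_on N S linf f"
  unfolding isometric_on_def
proof (intro conjI ballI S)
  have lin: "f x \<in> mspace linf" if "x \<in> S" for x
    unfolding mspace_linf_iff using lip[OF that a(1)] a(2) by auto
  show "f x \<in> mspace linf" if "x \<in> S" for x by (rule lin[OF that])
  fix x y assume xy: "x \<in> S" "y \<in> S"
  show "mdist linf (f x) (f y) = mdist N x y"
  proof (rule antisym)
    show "mdist linf (f x) (f y) \<le> mdist N x y"
      unfolding mdist_linf_le[OF lin[OF xy(1)] lin[OF xy(2)]] using lip[OF xy] by simp
    show "mdist N x y \<le> mdist linf (f x) (f y)"
    proof (rule field_le_epsilon)
      fix e :: real assume "e > 0"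
      then obtain c where c: "c \<in> C" "mdist N y c < e / 2" using C(1)[OF xy(2), of "e / 2"] by auto
      obtain n k where nk: "\<forall>x\<in>S. f x n = mdist N x c - k" using coord[OF c(1)] by auto
      have "mdist N x c - mdist N y c \<le> \<bar>f x n - f y n\<bar>" using nk xy by simp
      also have "\<dots> \<le> mdist linf (f x) (f y)"
        using mdist_linf_le[OF lin[OF xy(1)] lin[OF xy(2)], of "mdist linf (f x) (f y)"] by simp
      finally have "mdist N x c \<le> mdist linf (f x) (f y) + e / 2" using c(2) by simp
      moreover have "mdist N x y \<le> mdist N x c + mdist N c y"
        using xy S c(1) C(2) by (intro mdist_triangle) auto
      ultimately show "mdist N x y \<le> mdist linf (f x) (f y) + e"
        using c(2) by (simp add: mdist_commute)
    qed
  qed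
qed

lemma dense_sequence:
  fixes N :: "'a metric"
  assumes "separable_in N S" "S \<subseteq> mspace N" "S \<noteq> {}"
  obtains q :: "nat \<Rightarrow> 'a" where "\<And>n. q n \<in> S" "\<And>x e. x \<in> S \<Longrightarrow> e > 0 \<Longrightarrow> \<exists>n. mdist N x (q n) < e"
proof -
  obtain C where C: "countable C" "C \<subseteq> S" "\<And>x e. x \<in> S \<Longrightarrow> e > 0 \<Longrightarrow> \<exists>c\<in>C. mdist N x c < e"
    using separable_in_dense_subset[OF assms(1,2)] by metis
  have "C \<noteq> {}" using C(3)[of _ 1] assms(3) by fastforce
  then have r: "range (from_nat_into C) = C" using C(1) by (rule range_from_nat_into)
  show thesis
  proof (rule that)
    show "from_nat_into C n \<in> S" for n using r C(2) by auto
    fix x and e :: real assume "x \<in> S" "e > 0"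
    then show "\<exists>n. mdist N x (from_nat_into C n) < e" using C(3)[of x e] r by (metis imageE)
  qed
qed

lemma lip_le_mdist: "c \<in> mspace N \<Longrightarrow> S \<subseteq> mspace N \<Longrightarrow> lip_le N S 1 (\<lambda>x. mdist N x c)"
proof (rule lip_leI)
  fix x y assume "c \<in> mspace N" "S \<subseteq> mspace N" "x \<in> S" "y \<in> S"
  then show "mdist N x c - mdist N y c \<le> 1 * mdist N x y"
    using mdist_triangle[of x N y c] by (auto simp: subset_iff)
qed simp

lemma kuratowski_embedding:
  fixes N :: "'a metric"
  assumes "separable_in N S" "S \<subseteq> mspace N"
  shows "\<exists>f. isometric_on N S linf f"
proof (cases "S = {}")
  case True
  then show ?thesis by (auto simp: isometric_on_def)
next
  case False
  then obtain a where a: "a \<in> S" by auto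
  obtain q :: "nat \<Rightarrow> 'a" where q: "\<And>n. q n \<in> S" "\<And>x e. x \<in> S \<Longrightarrow> e > 0 \<Longrightarrow> \<exists>n. mdist N x (q n) < e"
    using dense_sequence[OF assms False] by metis
  have "isometric_on N S linf (\<lambda>x n. mdist N x (q n) - mdist N a (q n))"
  proof (rule isometric_on_linf[where C="range q", OF assms(2) a])
    fix x y n assume "x \<in> S" "y \<in> S"
    then show "\<bar>(mdist N x (q n) - mdist N a (q n)) - (mdist N y (q n) - mdist N a (q n))\<bar> \<le> mdist N x y"
      using lip_leD[OF lip_le_mdist[OF _ assms(2)], of "q n" x y] q(1)[of n] assms(2) by auto
  next
    show "range q \<subseteq> mspace N" using q(1) assms(2) by auto
  next
    fix c assume "c \<in> range q"
    then show "\<exists>n k. \<forall>x\<in>S. mdist N x (q n) - mdist N a (q n) = mdist N x c - k" by auto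
  qed (use q(2) in auto)
  then show ?thesis by blast
qed

text \<open>
  The \<open>S j\<close> are glued along the copies \<open>\<iota> j\<close> of \<open>X\<close>. A coordinate belongs to a pair \<open>(i, n)\<close>, where \<open>q i n\<close> is
  the \<open>n\<close>th point of a dense sequence of \<open>S i\<close>. On \<open>S i\<close> itself it is the distance to \<open>q i n\<close>; on every
  other \<open>S j\<close> it is a \<open>1\<close>-Lipschitz extension of the function that this distance induces on the copy of
  \<open>X\<close>, so all the coordinates are consistent along \<open>X\<close>. Subtracting the value at a base point \<open>b0\<close> of \<open>X\<close> makes
  the sequences bounded. If \<open>X\<close> is empty, there is no condition to satisfy.
\<close>

lemma common_embedding:
  fixes N :: "nat \<Rightarrow> 'a metric" and X :: "'b metric" and \<iota> :: "nat \<Rightarrow> 'b \<Rightarrow> 'a"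
  assumes sep: "\<And>j. j \<in> J \<Longrightarrow> separable_in (N j) (S j)" and S: "\<And>j. j \<in> J \<Longrightarrow> S j \<subseteq> mspace (N j)"
    and \<iota>: "\<And>j a. j \<in> J \<Longrightarrow> a \<in> mspace X \<Longrightarrow> \<iota> j a \<in> S j"
    and iso: "\<And>j a b. j \<in> J \<Longrightarrow> a \<in> mspace X \<Longrightarrow> b \<in> mspace X \<Longrightarrow> mdist (N j) (\<iota> j a) (\<iota> j b) = mdist X a b"
  shows "\<exists>F. (\<forall>j\<in>J. isometric_on (N j) (S j) linf (F j)) \<and>
    (\<forall>i\<in>J. \<forall>j\<in>J. \<forall>a\<in>mspace X. F i (\<iota> i a) = F j (\<iota> j a))"
proof (cases "mspace X = {}")
  case True
  have "\<forall>j\<in>J. \<exists>f. isometric_on (N j) (S j) linf f" using kuratowski_embedding sep S by blast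
  then show ?thesis using True by (auto dest: bchoice)
next
  case False
  then obtain b0 where b0: "b0 \<in> mspace X" by auto
  have "\<forall>j\<in>J. \<exists>q :: nat \<Rightarrow> 'a. (\<forall>n. q n \<in> S j) \<and> (\<forall>x\<in>S j. \<forall>e>0. \<exists>n. mdist (N j) x (q n) < e)"
  proof
    fix j assume j: "j \<in> J"
    show "\<exists>q :: nat \<Rightarrow> 'a. (\<forall>n. q n \<in> S j) \<and> (\<forall>x\<in>S j. \<forall>e>0. \<exists>n. mdist (N j) x (q n) < e)"
      using dense_sequence[OF sep[OF j] S[OF j]] \<iota>[OF j b0] by (metis empty_iff)
  qed
  from bchoice[OF this] obtain q :: "nat \<Rightarrow> nat \<Rightarrow> 'a" where
    q: "\<forall>j\<in>J. (\<forall>n. q j n \<in> S j) \<and> (\<forall>x\<in>S j. \<forall>e>0. \<exists>n. mdist (N j) x (q j n) < e)" ..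
  have "\<exists>h. lip_le (N j) (mspace (N j)) 1 h \<and> (\<forall>a\<in>mspace X. h (\<iota> j a) = mdist (N i) (\<iota> i a) (q i n)) \<and>
      (i = j \<longrightarrow> (\<forall>z. h z = mdist (N j) z (q j n)))" if i: "i \<in> J" and j: "j \<in> J" for i j n
  proof (cases "i = j")
    case True
    have "q j n \<in> mspace (N j)" using q j S[OF j] by auto
    then have "lip_le (N j) (mspace (N j)) 1 (\<lambda>z. mdist (N j) z (q j n))" by (rule lip_le_mdist) simp
    then show ?thesis using True by auto
  next
    case False
    have qi: "q i n \<in> mspace (N i)" using q i S[OF i] by auto
    have inj: "inj_on (\<iota> j) (mspace X)"
    proof (rule inj_onI)
      fix a b assume ab: "a \<in> mspace X" "b \<in> mspace X" "\<iota> j a = \<iota> j b"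
      have "\<iota> j b \<in> mspace (N j)" using \<iota>[OF j ab(2)] S[OF j] by auto
      then have "mdist X a b = 0" using iso[OF j ab(1,2)] ab(3) by simp
      then show "a = b" using ab by simp
    qed
    define g where "g y = mdist (N i) (\<iota> i (inv_into (mspace X) (\<iota> j) y)) (q i n)" for y
    have g: "g (\<iota> j a) = mdist (N i) (\<iota> i a) (q i n)" if "a \<in> mspace X" for a
      by (simp add: g_def inv_into_f_f[OF inj that])
    have "lip_le (N j) (\<iota> j ` mspace X) 1 g"
    proof (rule lip_leI)
      fix x y assume "x \<in> \<iota> j ` mspace X" "y \<in> \<iota> j ` mspace X"
      then obtain a b where ab: "a \<in> mspace X" "b \<in> mspace X" "x = \<iota> j a" "y = \<iota> j b" by auto
      have "g x - g y \<le> mdist (N i) (\<iota> i a) (\<iota> i b)"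
        unfolding ab(3,4) g[OF ab(1)] g[OF ab(2)]
        using mdist_triangle[of "\<iota> i a" "N i" "\<iota> i b" "q i n"] \<iota>[OF i] S[OF i] ab qi by (auto simp: subset_iff)
      then show "g x - g y \<le> 1 * mdist (N j) x y"
        using iso[OF i ab(1,2)] iso[OF j ab(1,2)] ab(3,4) by simp
    qed simp
    moreover have "\<iota> j ` mspace X \<subseteq> mspace (N j)" using \<iota>[OF j] S[OF j] by auto
    ultimately obtain h where "lip_le (N j) (mspace (N j)) 1 h" "\<And>y. y \<in> \<iota> j ` mspace X \<Longrightarrow> h y = g y"
      using lipschitz_extension by metis
    then show ?thesis using False g by (intro exI[of _ h]) auto
  qed
  then obtain H where H: "\<And>i j n. i \<in> J \<Longrightarrow> j \<in> J \<Longrightarrow> lip_le (N j) (mspace (N j)) 1 (H i j n)"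
    "\<And>i j n a. i \<in> J \<Longrightarrow> j \<in> J \<Longrightarrow> a \<in> mspace X \<Longrightarrow> H i j n (\<iota> j a) = mdist (N i) (\<iota> i a) (q i n)"
    "\<And>j n z. j \<in> J \<Longrightarrow> H j j n z = mdist (N j) z (q j n)" by metis
  define F where "F j z k = (case prod_decode k of (i, n) \<Rightarrow>
      if i \<in> J then H i j n z - mdist (N i) (\<iota> i b0) (q i n) else 0)" for j z k
  have "isometric_on (N j) (S j) linf (F j)" if j: "j \<in> J" for j
  proof (rule isometric_on_linf[where C="range (q j)", OF S[OF j] \<iota>[OF j b0]])
    show "F j (\<iota> j b0) = (\<lambda>_. 0)"
      using H(2)[OF _ j b0] by (auto simp: F_def split: prod.splits)
    show "\<bar>F j x n - F j y n\<bar> \<le> mdist (N j) x y" if "x \<in> S j" "y \<in> S j" for x y n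
      using lip_leD[OF H(1)[OF _ j]] that S[OF j] by (auto simp: F_def subset_iff split: prod.splits)
    show "\<exists>c\<in>range (q j). mdist (N j) x c < e" if "x \<in> S j" "e > 0" for x e
      using q j that by auto
    show "range (q j) \<subseteq> mspace (N j)" using q j S[OF j] by auto
    fix c assume "c \<in> range (q j)"
    then obtain n where n: "c = q j n" by auto
    show "\<exists>n k. \<forall>x\<in>S j. F j x n = mdist (N j) x c - k"
      by (intro exI[of _ "prod_encode (j, n)"] exI[of _ "mdist (N j) (\<iota> j b0) (q j n)"])
        (simp add: F_def j H(3) n)
  qed
  moreover have "F i (\<iota> i a) = F j (\<iota> j a)" if "i \<in> J" "j \<in> J" "a \<in> mspace X" for i j a
    using that by (auto simp: F_def H(2) fun_eq_iff split: prod.splits)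
  ultimately show ?thesis by blast
qed

section \<open>Transporting fillings\<close>

text \<open>
  The value on any form that agrees with the given one through \<open>F\<close>; it is independent of that form
  when \<open>T\<close> is determined by the restrictions to \<open>Y\<close>.
\<close>

definition transport :: "nat \<Rightarrow> 'a metric \<Rightarrow> 'a set \<Rightarrow> 'a functional \<Rightarrow> ('a \<Rightarrow> 'b) \<Rightarrow> 'b functional" where
  "transport m Z Y T F f \<pi> =
     (SOME v. \<exists>f' \<pi>'. (f', \<pi>') \<in> test_forms m Z \<and> forms_agree Y F f' \<pi>' f \<pi> \<and> v = T f' \<pi>')"

lemma corresponds_transport:
  assumes T: "corresponds m Z Y T Z id T"
  shows "corresponds m Z Y T W F (transport m Z Y T F)"
  unfolding corresponds_def
proof (intro allI impI)
  fix f' \<pi>' f \<pi> assume f': "(f', \<pi>') \<in> test_forms m Z" and ag: "forms_agree Y F f' \<pi>' f \<pi>"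
  have "v = T f' \<pi>'"
    if ex: "\<exists>g \<rho>. (g, \<rho>) \<in> test_forms m Z \<and> forms_agree Y F g \<rho> f \<pi> \<and> v = T g \<rho>" for v
  proof -
    obtain g \<rho> where g: "(g, \<rho>) \<in> test_forms m Z" "forms_agree Y F g \<rho> f \<pi>" "v = T g \<rho>"
      using ex by auto
    have "forms_agree Y id g \<rho> f' \<pi>'"
      using g(2) ag by (auto simp: forms_agree_def list_all2_conv_all_nth)
    then show ?thesis using correspondsD[OF T g(1) f'] g(3) by simp
  qed
  then show "transport m Z Y T F f \<pi> = T f' \<pi>'"
    unfolding transport_def using f' ag by (intro some_equality) auto
qed

text \<open>
  A closed subset of a complete space is complete, and so is its isometric image.
\<close>

lemma closedin_isometric_image:
  assumes F: "isometric_on Z Y W F" and Z: "mcomplete_of Z" and Y: "closedin (mtopology_of Z) Y"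
  shows "closedin (mtopology_of W) (F ` Y)"
proof -
  interpret Z: Metric_space "mspace Z" "mdist Z" by simp
  interpret W: Metric_space "mspace W" "mdist W" by simp
  note F' = isometric_onD[OF F]
  have seq: "l \<in> F ` Y" if \<sigma>: "range \<sigma> \<subseteq> F ` Y" and l: "limitin W.mtopology \<sigma> l sequentially" for \<sigma> l
  proof -
    have "\<forall>n. \<exists>y. y \<in> Y \<and> F y = \<sigma> n"
    proof
      fix n
      have "\<sigma> n \<in> F ` Y" using \<sigma> by blast
      then show "\<exists>y. y \<in> Y \<and> F y = \<sigma> n" by auto
    qed
    from choice[OF this] obtain \<tau> where \<tau>: "\<And>n. \<tau> n \<in> Y" "\<And>n. F (\<tau> n) = \<sigma> n" by auto
    have "range \<sigma> \<subseteq> mspace W" using \<sigma> F'(2) by auto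
    then have W: "W.MCauchy \<sigma>" using W.convergent_imp_MCauchy l by blast
    have d\<tau>: "mdist W (\<sigma> n) (F y) = mdist Z (\<tau> n) y" if "y \<in> Y" for n y
      using F'(3)[OF \<tau>(1)[of n] that] by (simp add: \<tau>(2))
    have "Z.MCauchy \<tau>"
      unfolding Z.MCauchy_def
    proof (intro conjI allI impI)
      show "range \<tau> \<subseteq> mspace Z" using \<tau>(1) F'(1) by auto
      fix e :: real assume "e > 0"
      then obtain n0 where n0: "\<forall>n n'. n0 \<le> n \<longrightarrow> n0 \<le> n' \<longrightarrow> mdist W (\<sigma> n) (\<sigma> n') < e"
        using W unfolding W.MCauchy_def by auto
      have "mdist W (\<sigma> n) (\<sigma> n') = mdist Z (\<tau> n) (\<tau> n')" for n n'
        using d\<tau>[OF \<tau>(1)[of n'], of n] by (simp add: \<tau>(2))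
      then show "\<exists>n0. \<forall>n n'. n0 \<le> n \<longrightarrow> n0 \<le> n' \<longrightarrow> mdist Z (\<tau> n) (\<tau> n') < e"
        using n0 by auto
    qed
    then obtain y where y: "limitin Z.mtopology \<tau> y sequentially"
      using Z unfolding mcomplete_of_def Z.mcomplete_def by auto
    have yY: "y \<in> Y"
      using Y y \<tau>(1) unfolding mtopology_of_def Z.metric_closedin_iff_sequentially_closed by (metis image_subsetI)
    have "limitin W.mtopology \<sigma> (F y) sequentially"
      using y F'(2)[OF yY] F'(2)[OF \<tau>(1)]
      unfolding Z.limit_metric_sequentially W.limit_metric_sequentially d\<tau>[OF yY] \<tau>(2) by metis
    then have "l = F y" using W.limitin_metric_unique[OF l] by simp
    then show ?thesis using yY by simp
  qed
  have "F ` Y \<subseteq> mspace W" using F'(2) by auto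
  then show ?thesis
    unfolding mtopology_of_def W.metric_closedin_iff_sequentially_closed
    using seq by (intro conjI allI impI) (assumption, elim conjE)
qed

lemma isometric_embedding_iff: "isometric_embedding X W \<psi> \<longleftrightarrow> isometric_on X (mspace X) W \<psi>"
  by (auto simp: isometric_embedding_def isometric_on_def)

lemma test_forms_pull_back:
  assumes \<phi>: "isometric_embedding X Z \<phi>" and f: "(f, \<pi>) \<in> test_forms m Z"
  shows "(f \<circ> \<phi>, map (\<lambda>p. p \<circ> \<phi>) \<pi>) \<in> test_forms m X"
proof -
  have L: "lipschitz_fun X (p \<circ> \<phi>)" if "lipschitz_fun Z p" for p
    using lip_le_pull_back[OF \<phi>[unfolded isometric_embedding_iff] lip_le_lip[OF that]]
    by (auto simp: o_def intro: lipschitz_funI)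
  obtain B where "0 \<le> B" "\<forall>x\<in>mspace Z. \<bar>f x\<bar> \<le> B"
    using test_formsD(2)[OF f] by (auto simp: bounded_image_iff)
  then have "bounded ((f \<circ> \<phi>) ` mspace X)"
    unfolding bounded_image_iff using \<phi> by (intro exI[of _ B]) (auto simp: isometric_embedding_def)
  then show ?thesis using L f by (auto simp: test_forms_def)
qed

lemma push_forward_corresponds:
  assumes \<phi>: "isometric_embedding X Z \<phi>" and \<psi>: "isometric_embedding X W \<psi>"
    and Y: "\<phi> ` mspace X \<subseteq> Y" and F: "\<And>x. x \<in> mspace X \<Longrightarrow> \<psi> x = F (\<phi> x)"
    and T: "corresponds m X (mspace X) T X id T"
  shows "corresponds m Z Y (push_forward \<phi> T) W F (push_forward \<psi> T)"
  unfolding corresponds_def push_forward_def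
proof (intro allI impI)
  fix f' \<pi>' f \<pi> assume f': "(f', \<pi>') \<in> test_forms m Z" and f: "(f, \<pi>) \<in> test_forms m W"
    and ag: "forms_agree Y F f' \<pi>' f \<pi>"
  have Y': "\<phi> x \<in> Y" if "x \<in> mspace X" for x using Y that by auto
  show "T (f \<circ> \<psi>) (map (\<lambda>p. p \<circ> \<psi>) \<pi>) = T (f' \<circ> \<phi>) (map (\<lambda>p. p \<circ> \<phi>) \<pi>')"
  proof (rule correspondsD[OF T test_forms_pull_back[OF \<phi> f'] test_forms_pull_back[OF \<psi> f]])
    show "forms_agree (mspace X) id (f' \<circ> \<phi>) (map (\<lambda>p. p \<circ> \<phi>) \<pi>') (f \<circ> \<psi>) (map (\<lambda>p. p \<circ> \<psi>) \<pi>)"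
      using ag Y' F by (auto simp: forms_agree_def list_all2_conv_all_nth)
  qed
qed

lemma integral_current_splittable: "integral_current m Z T \<Longrightarrow> splittable m Z T"
  by (auto simp: integral_current_def current_def intro: multilinear_splittable)

lemma integral_current_finite_mass: "integral_current m Z T \<Longrightarrow> has_finite_mass m Z T"
  by (simp add: integral_current_def current_def)

text \<open>
  A filling in \<open>Z\<close> that is carried by \<open>Y\<close> is transported to a filling in \<open>W\<close> of no larger mass.
\<close>

lemma flat_distance_transport_le:
  assumes F: "isometric_on Z Y W F" and Z: "mcomplete_of Z" and Y: "closedin (mtopology_of Z) Y"
    and U: "integral_current m Z U" "rectifiable_within m Z Y U"
    and V: "integral_current (Suc m) Z V" "rectifiable_within (Suc m) Z Y V"
    and eq: "\<And>f \<pi>. (f, \<pi>) \<in> test_forms m Z \<Longrightarrow> S f \<pi> - T f \<pi> = U f \<pi> + boundary V f \<pi>"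
    and S: "corresponds m Z Y S W F S'" and T: "corresponds m Z Y T W F T'"
  shows "flat_distance m W S' T' \<le> mass m Z U + mass (Suc m) Z V"
proof -
  let ?U = "transport m Z Y U F" and ?V = "transport (Suc m) Z Y V F"
  note FY = closedin_isometric_image[OF F Z Y]
  have cU: "corresponds m Z Y U W F ?U"
    by (rule corresponds_transport[OF rectifiable_within_determined[OF U(2)]])
  have cV: "corresponds (Suc m) Z Y V W F ?V"
    by (rule corresponds_transport[OF rectifiable_within_determined[OF V(2)]])
  have iU: "integral_current m W ?U" by (rule integral_current_transport[OF F Y FY cU U])
  have iV: "integral_current (Suc m) W ?V" by (rule integral_current_transport[OF F Y FY cV V])
  have "S' f \<pi> - T' f \<pi> = ?U f \<pi> + boundary ?V f \<pi>" if f: "(f, \<pi>) \<in> test_forms m W" for f \<pi>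
  proof -
    obtain f' \<pi>' where f': "(f', \<pi>') \<in> test_forms m Z" "forms_agree Y F f' \<pi>' f \<pi>"
      using pull_back_form[OF F f] by metis
    note * = correspondsD[OF _ f'(1) f f'(2)]
    show ?thesis
      using eq[OF f'(1)] *[OF S] *[OF T] *[OF cU] *[OF corresponds_boundary[OF cV]] by simp
  qed
  then have "flat_distance m W S' T' \<le> mass m W ?U + mass (Suc m) W ?V"
    unfolding flat_distance_def using iU iV by (intro Inf_lower) blast
  also have "\<dots> \<le> mass m Z U + mass (Suc m) Z V"
    using U V iU iV
    by (intro add_mono mass_transport_le[OF F Y cU] mass_transport_le[OF F Y cV] integral_current_splittable)
  finally show ?thesis .
qed

section \<open>Flat convergence implies weak convergence\<close>

text \<open>
  For a filling \<open>U + \<partial>V\<close> of \<open>S - T\<close>, the term \<open>U f \<pi>\<close> is controlled by the bound of \<open>f\<close> and the mass of \<open>U\<close>, and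
  \<open>\<partial>V f \<pi> = V 1 (f, \<pi>)\<close> by the Lipschitz constant of \<open>f\<close> and the mass of \<open>V\<close>. The constant depends on the form
  only.
\<close>

lemma flat_distance_estimate:
  assumes f: "(f, \<pi>) \<in> test_forms m Z"
  obtains K where "0 \<le> K"
    "\<And>S T \<delta>. 0 < \<delta> \<Longrightarrow> flat_distance m Z S T < ennreal \<delta> \<Longrightarrow> \<bar>S f \<pi> - T f \<pi>\<bar> \<le> K * \<delta>"
proof -
  obtain B where B: "0 \<le> B" "\<And>x. x \<in> mspace Z \<Longrightarrow> \<bar>f x\<bar> \<le> B"
    using test_formsD(2)[OF f] by (auto simp: bounded_image_iff)
  let ?\<Lambda> = "prod_list (map (lip Z) \<pi>)"
  have \<Lambda>: "0 \<le> ?\<Lambda>" using f by (rule prod_lip_nonneg)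
  have lf: "0 \<le> lip Z f" using lip_nonneg test_formsD(1)[OF f] by blast
  have f1: "(\<lambda>_. 1, f # \<pi>) \<in> test_forms (Suc m) Z"
    using f by (auto simp: test_forms_def bounded_image_iff lipschitz_fun_iff_lip_le intro: exI[of _ 0] exI[of _ 1])
  define K where "K = ?\<Lambda> * B + lip Z f * ?\<Lambda>"
  show thesis
  proof (rule that)
    show "0 \<le> K" using \<Lambda> lf B by (simp add: K_def)
    fix S T :: "'a functional" and \<delta> :: real
    assume \<delta>: "0 < \<delta>" and "flat_distance m Z S T < ennreal \<delta>"
    then obtain U V where U: "integral_current m Z U" and V: "integral_current (Suc m) Z V"
      and eq: "\<forall>(f, \<pi>) \<in> test_forms m Z. S f \<pi> - T f \<pi> = U f \<pi> + boundary V f \<pi>"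
      and less: "mass m Z U + mass (Suc m) Z V < ennreal \<delta>"
      unfolding flat_distance_def Inf_less_iff by auto
    have "mass m Z U < ennreal \<delta>" "mass (Suc m) Z V < ennreal \<delta>"
      using less by (auto intro: le_less_trans[rotated])
    then have mU: "enn2real (mass m Z U) \<le> \<delta>" and mV: "enn2real (mass (Suc m) Z V) \<le> \<delta>"
      using \<delta> by (intro enn2real_leI less_imp_le[of _ "ennreal \<delta>"]; simp)+
    have "\<bar>U f \<pi>\<bar> \<le> ?\<Lambda> * (B * enn2real (mass m Z U))"
      by (rule mass_estimate(2)[OF integral_current_splittable[OF U] integral_current_finite_mass[OF U] f B])
    also have "\<dots> \<le> ?\<Lambda> * (B * \<delta>)" using \<Lambda> B(1) mU by (intro mult_left_mono) auto
    finally have 1: "\<bar>U f \<pi>\<bar> \<le> ?\<Lambda> * (B * \<delta>)" .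
    have "\<bar>V (\<lambda>_. 1) (f # \<pi>)\<bar> \<le> prod_list (map (lip Z) (f # \<pi>)) * (1 * enn2real (mass (Suc m) Z V))"
      by (rule mass_estimate(2)[OF integral_current_splittable[OF V] integral_current_finite_mass[OF V] f1]) auto
    also have "\<dots> \<le> lip Z f * ?\<Lambda> * \<delta>" using \<Lambda> lf mV by (simp add: mult_left_mono)
    finally have 2: "\<bar>boundary V f \<pi>\<bar> \<le> lip Z f * ?\<Lambda> * \<delta>" by (simp add: boundary_def)
    have "S f \<pi> - T f \<pi> = U f \<pi> + boundary V f \<pi>" using eq f by fast
    then show "\<bar>S f \<pi> - T f \<pi>\<bar> \<le> K * \<delta>" using 1 2 by (simp add: K_def algebra_simps)
  qed
qed

lemma flat_imp_weak_convergence: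
  assumes flat: "(\<lambda>j. flat_distance m Z (S j) T) \<longlonglongrightarrow> 0"
  shows "weakly_converges m Z S T"
  unfolding weakly_converges_def
proof clarify
  fix f \<pi> assume "(f, \<pi>) \<in> test_forms m Z"
  then obtain K where K: "0 \<le> K"
    "\<And>S T \<delta>. 0 < \<delta> \<Longrightarrow> flat_distance m Z S T < ennreal \<delta> \<Longrightarrow> \<bar>S f \<pi> - T f \<pi>\<bar> \<le> K * \<delta>"
    using flat_distance_estimate by metis
  show "(\<lambda>j. S j f \<pi>) \<longlonglongrightarrow> T f \<pi>"
  proof (rule metric_LIMSEQ_I)
    fix r :: real assume r: "0 < r"
    define \<delta> where "\<delta> = r / (K + 1)"
    have \<delta>: "0 < \<delta>" "K * \<delta> < r" using r K(1) by (auto simp: \<delta>_def field_simps)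
    have "eventually (\<lambda>j. flat_distance m Z (S j) T < ennreal \<delta>) sequentially"
      using flat \<delta>(1) by (intro order_tendstoD(2)) auto
    then have "eventually (\<lambda>j. dist (S j f \<pi>) (T f \<pi>) < r) sequentially"
      using K(2)[OF \<delta>(1)] \<delta>(2) by (auto elim!: eventually_mono simp: dist_real_def intro: le_less_trans)
    then show "\<exists>no. \<forall>n\<ge>no. dist (S n f \<pi>) (T f \<pi>) < r" by (simp add: eventually_sequentially)
  qed
qed

section \<open>Integral current spaces\<close>

lemma integral_current_space_determined:
  assumes M: "integral_current_space m M"
  shows "corresponds m (closure_metric M) (mspace (closure_metric M)) (structure_current M) (closure_metric M) id (structure_current M)"
proof -
  have "integer_rectifiable m (closure_metric M) (structure_current M)"
    using M by (simp add: integral_current_space_def integral_current_def)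
  then obtain Y where "Y \<subseteq> mspace (closure_metric M)" "rectifiable_within m (closure_metric M) Y (structure_current M)"
    using integer_rectifiable_separable by metis
  then show ?thesis using rectifiable_within_mono rectifiable_within_determined by blast
qed

text \<open>
  The points of the space are those of the canonical set, which lies in a separable closed set,
  and they are dense in the completion.
\<close>

lemma integral_current_space_separable:
  assumes M: "integral_current_space m M"
  shows "separable_in (closure_metric M) (mspace (closure_metric M))"
proof -
  let ?X = "closure_metric M" and ?T = "structure_current M"
  have T: "integral_current m ?X ?T" and pts: "canonical_set m ?X ?T = points M"
    and dense: "mtopology_of ?X closure_of points M = mspace ?X"
    using M by (auto simp: integral_current_space_def)
  have "integer_rectifiable m ?X ?T" using T by (simp add: integral_current_def)
  then obtain Y where Y: "Y \<subseteq> mspace ?X" "separable_in ?X Y" "rectifiable_within m ?X Y ?T"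
    using integer_rectifiable_separable by metis
  let ?C = "mtopology_of ?X closure_of Y"
  have "Y \<subseteq> ?C" using Y(1) by (simp add: closure_of_subset)
  then have "corresponds m ?X ?C ?T ?X id ?T"
    using rectifiable_within_determined[OF rectifiable_within_mono[OF Y(3)]] by simp
  then have "points M \<subseteq> ?C"
    using canonical_set_subset[OF integral_current_splittable[OF T] integral_current_finite_mass[OF T]
        closedin_closure_of] pts by blast
  then have "mtopology_of ?X closure_of points M \<subseteq> ?C"
    by (rule closure_of_minimal[OF _ closedin_closure_of])
  then show ?thesis
    using separable_in_mono[OF separable_in_closure[OF Y(2)]] dense by simp
qed

text \<open>
  Two isometric embeddings that agree on the dense subset \<open>points M\<close> agree everywhere.
\<close>

lemma extend_embedding_eq:
  assumes M: "integral_current_space m M" and \<phi>: "isometric_embedding (closure_metric M) W \<phi>"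
  shows "isometric_embedding (closure_metric M) W (extend_embedding M W \<phi>)"
    "\<And>x. x \<in> mspace (closure_metric M) \<Longrightarrow> extend_embedding M W \<phi> x = \<phi> x"
proof -
  let ?X = "closure_metric M" and ?\<psi> = "extend_embedding M W \<phi>"
  have "isometric_embedding ?X W ?\<psi> \<and> (\<forall>x\<in>points M. ?\<psi> x = \<phi> x)"
    unfolding extend_embedding_def by (rule someI[of _ \<phi>]) (use \<phi> in simp)
  then have \<psi>: "isometric_embedding ?X W ?\<psi>" and agree: "\<And>x. x \<in> points M \<Longrightarrow> ?\<psi> x = \<phi> x" by auto
  then show "isometric_embedding ?X W ?\<psi>" by simp
  fix x assume x: "x \<in> mspace ?X"
  have P: "points M \<subseteq> mspace ?X" "mtopology_of ?X closure_of points M = mspace ?X"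
    using M by (auto simp: integral_current_space_def)
  note \<phi>' = isometric_onD[OF \<phi>[unfolded isometric_embedding_iff]]
    and \<psi>' = isometric_onD[OF \<psi>[unfolded isometric_embedding_iff]]
  have "mdist W (?\<psi> x) (\<phi> x) \<le> 0 + e" if e: "e > 0" for e
  proof -
    have "x \<in> mtopology_of ?X closure_of points M" using x P(2) by simp
    then obtain p where p: "p \<in> points M" "p \<in> mspace ?X" "mdist ?X x p < e / 2"
      unfolding in_closure_of_metric using e by (metis half_gt_zero)
    have "mdist W (?\<psi> x) (\<phi> x) \<le> mdist W (?\<psi> x) (?\<psi> p) + mdist W (?\<psi> p) (\<phi> x)"
      using x p(2) \<phi>'(2) \<psi>'(2) by (intro mdist_triangle) auto
    also have "mdist W (?\<psi> p) (\<phi> x) = mdist ?X p x"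
      using agree[OF p(1)] \<phi>'(3)[OF p(2) x] by simp
    also have "mdist W (?\<psi> x) (?\<psi> p) = mdist ?X x p" using \<psi>'(3)[OF x p(2)] .
    finally show ?thesis using p(3) by (simp add: mdist_commute)
  qed
  then have "mdist W (?\<psi> x) (\<phi> x) \<le> 0" by (rule field_le_epsilon)
  then have "mdist W (?\<psi> x) (\<phi> x) = 0" by (simp add: antisym)
  then show "?\<psi> x = \<phi> x" using \<phi>'(2)[OF x] \<psi>'(2)[OF x] by simp
qed

section \<open>A common separable space\<close>

text \<open>
  A common space for two integral current spaces with a filling of mass less than \<open>e\<close>, together with a
  separable closed set \<open>Y\<close> that contains both spaces and the pieces of the filling. Gathering these data into one
  predicate allows choosing them for all \<open>j\<close> at once.
\<close>

definition flat_filling :: "nat \<Rightarrow> 'a current_space \<Rightarrow> 'a current_space \<Rightarrow> ennreal \<Rightarrow> 'z metric \<Rightarrow> 'z set \<Rightarrow>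
    ('a \<Rightarrow> 'z) \<Rightarrow> ('a \<Rightarrow> 'z) \<Rightarrow> 'z functional \<Rightarrow> 'z functional \<Rightarrow> bool" where
  "flat_filling m M N e Z Y \<phi> \<iota> U V \<longleftrightarrow> mcomplete_of Z \<and> closedin (mtopology_of Z) Y \<and> separable_in Z Y \<and>
     isometric_embedding (closure_metric M) Z \<phi> \<and> \<phi> ` mspace (closure_metric M) \<subseteq> Y \<and>
     isometric_embedding (closure_metric N) Z \<iota> \<and> \<iota> ` mspace (closure_metric N) \<subseteq> Y \<and>
     integral_current m Z U \<and> rectifiable_within m Z Y U \<and>
     integral_current (Suc m) Z V \<and> rectifiable_within (Suc m) Z Y V \<and>
     (\<forall>f \<pi>. (f, \<pi>) \<in> test_forms m Z \<longrightarrow> push_forward \<phi> (structure_current M) f \<pi> -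
        push_forward \<iota> (structure_current N) f \<pi> = U f \<pi> + boundary V f \<pi>) \<and>
     mass m Z U + mass (Suc m) Z V < e"

lemma flat_fillingD:
  assumes "flat_filling m M N e Z Y \<phi> \<iota> U V"
  shows "mcomplete_of Z" "closedin (mtopology_of Z) Y" "separable_in Z Y"
    "isometric_embedding (closure_metric M) Z \<phi>" "\<phi> ` mspace (closure_metric M) \<subseteq> Y"
    "isometric_embedding (closure_metric N) Z \<iota>" "\<iota> ` mspace (closure_metric N) \<subseteq> Y"
    "integral_current m Z U" "rectifiable_within m Z Y U"
    "integral_current (Suc m) Z V" "rectifiable_within (Suc m) Z Y V"
    "\<And>f \<pi>. (f, \<pi>) \<in> test_forms m Z \<Longrightarrow> push_forward \<phi> (structure_current M) f \<pi> -
        push_forward \<iota> (structure_current N) f \<pi> = U f \<pi> + boundary V f \<pi>"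
    "mass m Z U + mass (Suc m) Z V < e"
  using assms unfolding flat_filling_def by simp_all

lemma flat_filling_exists:
  assumes M: "integral_current_space m M" and N: "integral_current_space m N"
    and less: "intrinsic_flat_distance TYPE('z) m M N < e"
  shows "\<exists>(Z :: 'z metric) Y \<phi> \<iota> U V. flat_filling m M N e Z Y \<phi> \<iota> U V"
proof -
  obtain Z :: "'z metric" and \<phi> \<iota> where Z: "mcomplete_of Z"
    and \<phi>: "isometric_embedding (closure_metric M) Z \<phi>" and \<iota>: "isometric_embedding (closure_metric N) Z \<iota>"
    and fl: "flat_distance m Z (push_forward \<phi> (structure_current M)) (push_forward \<iota> (structure_current N)) < e"
    using less unfolding intrinsic_flat_distance_def Inf_less_iff by auto
  obtain U V where U: "integral_current m Z U" and V: "integral_current (Suc m) Z V"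
    and eq: "\<forall>(f, \<pi>) \<in> test_forms m Z. push_forward \<phi> (structure_current M) f \<pi> -
        push_forward \<iota> (structure_current N) f \<pi> = U f \<pi> + boundary V f \<pi>"
    and m: "mass m Z U + mass (Suc m) Z V < e"
    using fl unfolding flat_distance_def Inf_less_iff by auto
  obtain A where A: "A \<subseteq> mspace Z" "separable_in Z A" "rectifiable_within m Z A U"
    using integer_rectifiable_separable U unfolding integral_current_def by metis
  obtain B where B: "B \<subseteq> mspace Z" "separable_in Z B" "rectifiable_within (Suc m) Z B V"
    using integer_rectifiable_separable V unfolding integral_current_def by metis
  have im: "\<xi> ` mspace (closure_metric L) \<subseteq> mspace Z \<and> separable_in Z (\<xi> ` mspace (closure_metric L))"
    if "isometric_embedding (closure_metric L) Z \<xi>" "integral_current_space m L" for L :: "'a current_space" and \<xi>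
    using that(1) separable_in_lipschitz_image[OF integral_current_space_separable[OF that(2)], of \<xi> Z 1]
    by (auto simp: isometric_embedding_def)
  define R where "R = \<phi> ` mspace (closure_metric M) \<union> \<iota> ` mspace (closure_metric N) \<union> (A \<union> B)"
  define Y where "Y = mtopology_of Z closure_of R"
  have RZ: "R \<subseteq> mspace Z" using im[OF \<phi> M] im[OF \<iota> N] A(1) B(1) by (auto simp: R_def)
  have RY: "R \<subseteq> Y" unfolding Y_def using RZ by (simp add: closure_of_subset)
  have "separable_in Z Y"
    unfolding Y_def R_def using im[OF \<phi> M] im[OF \<iota> N] A(2) B(2)
    by (intro separable_in_closure separable_in_Un) auto
  moreover have "closedin (mtopology_of Z) Y" by (simp add: Y_def)
  moreover have "rectifiable_within m Z Y U" "rectifiable_within (Suc m) Z Y V"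
    using RY by (auto intro!: rectifiable_within_mono[OF A(3)] rectifiable_within_mono[OF B(3)] simp: R_def)
  moreover have "\<phi> ` mspace (closure_metric M) \<subseteq> Y" "\<iota> ` mspace (closure_metric N) \<subseteq> Y"
    using RY by (auto simp: R_def)
  moreover have "\<forall>f \<pi>. (f, \<pi>) \<in> test_forms m Z \<longrightarrow> push_forward \<phi> (structure_current M) f \<pi> -
        push_forward \<iota> (structure_current N) f \<pi> = U f \<pi> + boundary V f \<pi>" using eq by fast
  ultimately have "flat_filling m M N e Z Y \<phi> \<iota> U V"
    unfolding flat_filling_def using Z \<phi> \<iota> U V m by simp
  then show ?thesis by blast
qed

lemma separable_closed_subspace:
  assumes R: "separable_in Z R" "R \<subseteq> mspace Z" and Z: "mcomplete_of Z"
  obtains W where "mcomplete_of W" "separable_space (mtopology_of W)" "R \<subseteq> mspace W" "mdist W = mdist Z"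
proof
  let ?C = "mtopology_of Z closure_of R"
  let ?W = "submetric Z ?C"
  have CZ: "?C \<subseteq> mspace Z" using closure_of_subset_topspace[of "mtopology_of Z" R] by simp
  interpret Submetric "mspace Z" "mdist Z" ?C
    by (simp add: Submetric_def Submetric_axioms_def CZ)
  show "mcomplete_of ?W"
    using closedin_mcomplete_imp_mcomplete Z closedin_closure_of[of "mtopology_of Z" R] CZ
    by (simp add: mcomplete_of_def mtopology_of_def Int_absorb2)
  show "R \<subseteq> mspace ?W" using R(2) closure_of_subset[of R "mtopology_of Z"] by simp
  show "mdist ?W = mdist Z" by simp
  obtain D where D: "countable D" "D \<subseteq> ?C" "\<And>x e. x \<in> ?C \<Longrightarrow> e > 0 \<Longrightarrow> \<exists>c\<in>D. mdist Z x c < e"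
    using separable_in_dense_subset[OF separable_in_closure[OF R(1)] CZ] by metis
  have "mtopology_of ?W closure_of D = mspace ?W"
    using D(2,3) CZ by (auto simp: in_closure_of_metric subset_iff)
  then show "separable_space (mtopology_of ?W)"
    unfolding separable_space_def using D(1,2) CZ by (intro exI[of _ D]) auto
qed

theorem theorem4p2:
  fixes m :: nat and M :: "nat \<Rightarrow> 'a current_space"
  assumes "\<And>j. integral_current_space m (M j)"
    and "(\<lambda>j. intrinsic_flat_distance TYPE('z) m (M j) (M 0)) \<longlonglongrightarrow> 0"
  shows "\<exists>(Z :: (nat \<Rightarrow> real) metric) (\<phi> :: nat \<Rightarrow> 'a \<Rightarrow> nat \<Rightarrow> real).
    mcomplete_of Z \<and> separable_space (mtopology_of Z) \<and>
    (\<forall>j. isometric_embedding (space_metric (M j)) Z (\<phi> j)) \<and>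
    (let S = (\<lambda>j. push_forward (extend_embedding (M j) Z (\<phi> j)) (structure_current (M j)))
     in (\<lambda>j. flat_distance m Z (S j) (S 0)) \<longlonglongrightarrow> 0 \<and> weakly_converges m Z S (S 0))"
proof -
  note M = assms(1)
  let ?X = "\<lambda>j. closure_metric (M j)"
  define d where "d j = intrinsic_flat_distance TYPE('z) m (M j) (M 0)" for j
  (* The infimum d j need not be attained. Adding a positive error that tends to 0 leaves room
     for an actual filling. *)
  define \<epsilon> where "\<epsilon> j = d j + ennreal (1 / real (Suc j))" for j
  (* Index 0 is excluded because the embedding of M 0 is the one along which everything is glued. *)
  define J where "J = {j. j \<noteq> 0 \<and> d j < \<infinity>}"
  have d0: "d \<longlonglongrightarrow> 0" using assms(2) by (simp add: d_def[abs_def])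
  have evJ: "eventually (\<lambda>j. j \<in> J) sequentially"
  proof -
    have "eventually (\<lambda>j. d j < \<infinity>) sequentially" using d0 by (rule order_tendstoD(2)) simp
    then show ?thesis
      using eventually_gt_at_top[of 0] by eventually_elim (simp add: J_def)
  qed
  then obtain i where i: "i \<in> J" by (auto simp: eventually_sequentially)
  have "\<forall>j\<in>J. \<exists>p :: 'z metric \<times> 'z set \<times> ('a \<Rightarrow> 'z) \<times> ('a \<Rightarrow> 'z) \<times> 'z functional \<times> 'z functional.
      case p of (Z, Y, \<phi>, \<iota>, U, V) \<Rightarrow> flat_filling m (M j) (M 0) (\<epsilon> j) Z Y \<phi> \<iota> U V"
  proof
    fix j assume j: "j \<in> J"
    have "d j + 0 < \<epsilon> j" unfolding \<epsilon>_def ennreal_add_left_cancel_less using j by (simp add: J_def less_top)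
    then have "intrinsic_flat_distance TYPE('z) m (M j) (M 0) < \<epsilon> j" by (simp add: d_def)
    from flat_filling_exists[OF M M this]
    show "\<exists>p :: 'z metric \<times> 'z set \<times> ('a \<Rightarrow> 'z) \<times> ('a \<Rightarrow> 'z) \<times> 'z functional \<times> 'z functional.
      case p of (Z, Y, \<phi>, \<iota>, U, V) \<Rightarrow> flat_filling m (M j) (M 0) (\<epsilon> j) Z Y \<phi> \<iota> U V" by auto
  qed
  from bchoice[OF this] obtain p :: "nat \<Rightarrow> 'z metric \<times> 'z set \<times> ('a \<Rightarrow> 'z) \<times> ('a \<Rightarrow> 'z) \<times> 'z functional \<times> 'z functional"
    where p: "\<forall>j\<in>J. case p j of (Z, Y, \<phi>, \<iota>, U, V) \<Rightarrow> flat_filling m (M j) (M 0) (\<epsilon> j) Z Y \<phi> \<iota> U V" ..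
  define N where "N j = fst (p j)" for j
  define Y where "Y j = fst (snd (p j))" for j
  define \<phi> where "\<phi> j = fst (snd (snd (p j)))" for j
  define \<iota> where "\<iota> j = fst (snd (snd (snd (p j))))" for j
  define U where "U j = fst (snd (snd (snd (snd (p j)))))" for j
  define V where "V j = snd (snd (snd (snd (snd (p j)))))" for j
  have fill: "flat_filling m (M j) (M 0) (\<epsilon> j) (N j) (Y j) (\<phi> j) (\<iota> j) (U j) (V j)" if "j \<in> J" for j
    using bspec[OF p that] by (simp add: N_def Y_def \<phi>_def \<iota>_def U_def V_def split_beta)
  note fillD = flat_fillingD[OF fill]
  have YN: "Y j \<subseteq> mspace (N j)" if "j \<in> J" for j
    using closedin_subset[OF fillD(2)[OF that]] by simp
  have \<iota>Y: "\<iota> j a \<in> Y j" if "j \<in> J" "a \<in> mspace (?X 0)" for j a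
    using fillD(7)[OF that(1)] that(2) by auto
  have "\<exists>F. (\<forall>j\<in>J. isometric_on (N j) (Y j) linf (F j)) \<and>
    (\<forall>i\<in>J. \<forall>j\<in>J. \<forall>a\<in>mspace (?X 0). F i (\<iota> i a) = F j (\<iota> j a))"
    by (rule common_embedding[OF fillD(3) YN \<iota>Y])
      (use fillD(6) in \<open>auto simp: isometric_embedding_def\<close>)
  then obtain F where F: "\<And>j. j \<in> J \<Longrightarrow> isometric_on (N j) (Y j) linf (F j)"
    "\<And>i j a. i \<in> J \<Longrightarrow> j \<in> J \<Longrightarrow> a \<in> mspace (?X 0) \<Longrightarrow> F i (\<iota> i a) = F j (\<iota> j a)" by metis
  have "\<forall>j. \<exists>k. isometric_on (?X j) (mspace (?X j)) linf k"
    using kuratowski_embedding integral_current_space_separable[OF M] by blast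
  from choice[OF this] obtain K where K: "\<forall>j. isometric_on (?X j) (mspace (?X j)) linf (K j)" ..
  (* The finitely many positive indices outside J do not influence the limit; their spaces are embedded
     without regard to the others. *)
  define \<Phi> where "\<Phi> j = (if j = 0 then F i \<circ> \<iota> i else if j \<in> J then F j \<circ> \<phi> j else K j)" for j
  have comp: "isometric_on (?X l) (mspace (?X l)) linf (F j \<circ> \<xi>)"
    if "j \<in> J" "isometric_embedding (?X l) (N j) \<xi>" "\<xi> ` mspace (?X l) \<subseteq> Y j" for j l \<xi>
    using isometric_onD[OF F(1)[OF that(1)]] that(2,3)
    by (auto simp: isometric_on_def isometric_embedding_def image_subset_iff)
  have \<Phi>: "isometric_on (?X j) (mspace (?X j)) linf (\<Phi> j)" for j
    unfolding \<Phi>_def using comp[OF i fillD(6,7)[OF i]] comp[OF _ fillD(4,5), of j] K by simp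
  have \<Phi>0: "\<Phi> 0 a = F j (\<iota> j a)" if "j \<in> J" "a \<in> mspace (?X 0)" for j a
    using F(2)[OF i that] by (simp add: \<Phi>_def)
  define R where "R = (\<Union>j. \<Phi> j ` mspace (?X j) \<union> (if j \<in> J then F j ` Y j else {}))"
  have RZ: "R \<subseteq> mspace linf"
    unfolding R_def using isometric_onD(2)[OF \<Phi>] isometric_onD(2)[OF F(1)] by (auto split: if_splits)
  have Rs: "separable_in linf R"
  proof -
    have "separable_in linf (\<Phi> j ` mspace (?X j))" for j
      by (rule separable_in_lipschitz_image[OF integral_current_space_separable[OF M] order_refl, where L=1])
        (use isometric_onD[OF \<Phi>[of j]] in auto)
    moreover have "separable_in linf (F j ` Y j)" if "j \<in> J" for j
      by (rule separable_in_lipschitz_image[OF _ YN[OF that], where L=1])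
        (use fillD(3)[OF that] isometric_onD[OF F(1)[OF that]] in auto)
    moreover have "separable_in linf {}" by (auto simp: separable_in_def)
    ultimately show ?thesis
      unfolding R_def by (intro separable_in_UN separable_in_Un) auto
  qed
  obtain W where W: "mcomplete_of W" "separable_space (mtopology_of W)" "R \<subseteq> mspace W" "mdist W = mdist linf"
    using separable_closed_subspace[OF Rs RZ mcomplete_linf] .
  have "\<Phi> j x \<in> R" if "x \<in> mspace (?X j)" for j x
    unfolding R_def using that by (intro UN_I[of j] UnI1 imageI) auto
  then have \<Phi>R: "\<Phi> j x \<in> mspace W" if "x \<in> mspace (?X j)" for j x using W(3) that by auto
  have "F j y \<in> R" if "j \<in> J" "y \<in> Y j" for j y
    unfolding R_def using that by (intro UN_I[of j] UnI2) auto
  then have FR: "F j y \<in> mspace W" if "j \<in> J" "y \<in> Y j" for j y using W(3) that by auto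
  have \<Phi>W: "isometric_embedding (?X j) W (\<Phi> j)" for j
    unfolding isometric_embedding_iff isometric_on_def W(4)
    using isometric_onD(3)[OF \<Phi>[of j]] \<Phi>R by auto
  have FW: "isometric_on (N j) (Y j) W (F j)" if "j \<in> J" for j
    unfolding isometric_on_def W(4)
    using isometric_onD(3)[OF F(1)[OF that]] FR[OF that] YN[OF that] by auto
  define S where "S j = push_forward (extend_embedding (M j) W (\<Phi> j)) (structure_current (M j))" for j
  have "flat_distance m W (S j) (S 0) \<le> \<epsilon> j" if j: "j \<in> J" for j
  proof -
    note fj = fillD[OF j]
    have "flat_distance m W (S j) (S 0) \<le> mass m (N j) (U j) + mass (Suc m) (N j) (V j)"
    proof (rule flat_distance_transport_le[OF FW[OF j] fj(1,2,8-11) fj(12)])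
      show "corresponds m (N j) (Y j) (push_forward (\<phi> j) (structure_current (M j))) W (F j) (S j)"
        unfolding S_def using j extend_embedding_eq(2)[OF M \<Phi>W, of _ j]
        by (intro push_forward_corresponds[OF fj(4) extend_embedding_eq(1)[OF M \<Phi>W] fj(5)]
            integral_current_space_determined[OF M]) (simp add: \<Phi>_def J_def)
      show "corresponds m (N j) (Y j) (push_forward (\<iota> j) (structure_current (M 0))) W (F j) (S 0)"
        unfolding S_def using extend_embedding_eq(2)[OF M \<Phi>W, of _ 0] \<Phi>0[OF j]
        by (intro push_forward_corresponds[OF fj(6) extend_embedding_eq(1)[OF M \<Phi>W] fj(7)]
            integral_current_space_determined[OF M]) simp
    qed
    also have "\<dots> \<le> \<epsilon> j" using fj(13) by (rule less_imp_le)
    finally show ?thesis .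
  qed
  then have ev: "eventually (\<lambda>j. flat_distance m W (S j) (S 0) \<le> \<epsilon> j) sequentially"
    using evJ by (auto elim: eventually_mono)
  have "(\<lambda>j. ennreal (1 / real (Suc j))) \<longlonglongrightarrow> ennreal 0"
    by (intro tendsto_ennrealI lim_1_over_n[THEN LIMSEQ_Suc])
  then have "\<epsilon> \<longlonglongrightarrow> 0 + 0" unfolding \<epsilon>_def[abs_def] using d0 by (intro tendsto_add) auto
  then have \<epsilon>0: "\<epsilon> \<longlonglongrightarrow> 0" by simp
  have flat: "(\<lambda>j. flat_distance m W (S j) (S 0)) \<longlonglongrightarrow> 0"
    by (rule tendsto_sandwich[OF _ ev tendsto_const \<epsilon>0]) simp
  have "isometric_embedding (space_metric (M j)) W (\<Phi> j)" for j
    using \<Phi>W[of j] by (auto simp: isometric_embedding_def space_metric_def)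
  then show ?thesis
    using W(1,2) flat flat_imp_weak_convergence[OF flat]
    by (intro exI[of _ W] exI[of _ \<Phi>]) (simp add: S_def[abs_def] Let_def)
qed

end
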